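(* Let $M$ be a topological space and let $(M_\alpha)_{\alpha\in A}$ be a directed family of topological spaces whose union $M_\infty:=\bigcup_{\alpha\in A}M_\alpha$ is a dense subset of $M$. Assume that all inclusion maps $M_\alpha\to M$ and $M_\alpha\to M_\beta$ (for $\alpha\le\beta$) are continuous. If $M$ admits well-filled charts, then $$\pi_k(M,p)=\varinjlim_{\alpha\in A_p}\pi_k(M_\alpha,p)\quad\text{for all }k\in\mathbb{N}_0\text{ and }p\in M_\infty,$$ where $A_p:=\{\alpha\in A:p\in M_\alpha\}$.
   Context: All topological spaces are Hausdorff, $\mathbb{N}_0=\{0,1,2,\dots\}$. Topological vector spaces are real and need not be locally convex. A directed family $(X_\alpha)_{\alpha\in A}$ is a family of sets indexed by a directed set $(A,\le)$ with $X_\alpha\subseteq X_\beta$ whenever $\alpha\le\beta$. For a subset $Y$ of a vector space, $\mathrm{conv}_2(Y):=\{ty_1+(1-t)y_2: y_1,y_2\in Y,\ t\in[0,1]\}$. Well-filled charts. Let $M$, $(M_\alpha)_{\alpha\in A}$, $M_\infty$ be as in the claim ($M_\infty$ dense in $M$, inclusions continuous). A well-filled chart of $M$ is a homeomorphism $\phi:U\to V\subseteq E$ from an open subset $U\subseteq M$ onto an arbitrary subset $V$ of a topological vector space $E$ such that there exist $\alpha_0\in A$ and, for all $\alpha\ge\alpha_0$, homeomorphisms $\phi_\alpha:U_\alpha\to V_\alpha\subseteq E_\alpha$ from open subsets $U_\alpha\subseteq M_\alpha$ onto subsets $V_\alpha$ of topological vector spaces $E_\alpha$, where the $E_\alpha$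 are vector subspaces of $E$ with $E_\alpha\subseteq E_\beta$ for $\beta\ge\alpha$, each endowed with its own vector topology in such a way that the inclusion maps $E_\alpha\to E$ and $E_\alpha\to E_\beta$ are continuous, and the following holds: (a) for all $\alpha\ge\alpha_0$: $U_\alpha\subseteq U$ and $\phi|_{U_\alpha}=\phi_\alpha$ (as maps to $E$); (b) for all $\beta\ge\alpha\ge\alpha_0$: $U_\alpha\subseteq U_\beta$ and $\phi_\beta|_{U_\alpha}=\phi_\alpha$; (d) $\bigcup_{\alpha\ge\alpha_0}U_\alpha=U\cap M_\infty$; (e) there is a non-empty, relatively open subset $V^{(2)}\subseteq V$ such that $\mathrm{conv}_2(V^{(2)})\subseteq V$ and $\mathrm{conv}_2(V^{(2)}\cap V_\infty)\subseteq V_\infty$, where $V_\infty:=\bigcup_{\alpha\ge\alpha_0}V_\alpha$; (f) for each $\alpha\ge\alpha_0$ and each set $K\subseteq V^{(2)}_\alpha:=V^{(2)}\cap V_\alpha$ which is compact (in the topology of $E_\alpha$), there exists $\beta\ge\alpha$ such that $\mathrm{conv}_2(K)\subseteq V_\beta$. Then $U^{(2)}:=\phi^{-1}(V^{(2)})$ is called a core of $\phi$. The space $M$ is said to admit well-filled charts if $M$ is covered by cores of well-filled charts. The equality with the direct limit means that $\pi_k(M,p)$, together with the maps $\pi_k(M_\alpha,p)\to\pi_k(M,p)$ induced by the inclusions, is a direct limit of the direct system of the $\pi_k(M_\alpha,p)$, $\alpha\in A_p$, with bonding maps induced by the inclusions: in the category of groups if $k\ge1$ (or if $k=0$, $M$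 and all $M_\alpha$ are topological groups, the inclusions are homomorphisms and $p=1$, in which case $\pi_0$ is the group of path components), and in the category of sets for $k=0$ otherwise. *)

theory Defs
  imports "HOL-Analysis.Analysis" "HOL-Algebra.Group"
begin

section \<open>Directed families of topological spaces\<close>

definition directed_set :: "'i set \<Rightarrow> ('i \<Rightarrow> 'i \<Rightarrow> bool) \<Rightarrow> bool" where
  "directed_set A leq \<longleftrightarrow>
     A \<noteq> {} \<and> reflp_on A leq \<and> transp_on A leq \<and>
     (\<forall>\<alpha>\<in>A. \<forall>\<beta>\<in>A. \<exists>\<gamma>\<in>A. leq \<alpha> \<gamma> \<and> leq \<beta> \<gamma>)"

definition directed_union :: "'i set \<Rightarrow> ('i \<Rightarrow> 'a topology) \<Rightarrow> 'a set" where
  "directed_union A Ms = (\<Union>\<alpha>\<in>A. topspace (Ms \<alpha>))"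

text \<open>The spaces \<open>Ms \<alpha>\<close> are subsets of \<open>M\<close> with their own topologies, which may be strictly
  finer than the induced ones.\<close>

definition dense_directed_family ::
  "'a topology \<Rightarrow> 'i set \<Rightarrow> ('i \<Rightarrow> 'i \<Rightarrow> bool) \<Rightarrow> ('i \<Rightarrow> 'a topology) \<Rightarrow> bool" where
  "dense_directed_family M A leq Ms \<longleftrightarrow>
     directed_set A leq \<and>
     Hausdorff_space M \<and> (\<forall>\<alpha>\<in>A. Hausdorff_space (Ms \<alpha>)) \<and>
     (\<forall>\<alpha>\<in>A. \<forall>\<beta>\<in>A. leq \<alpha> \<beta> \<longrightarrow>
        topspace (Ms \<alpha>) \<subseteq> topspace (Ms \<beta>) \<and> continuous_map (Ms \<alpha>) (Ms \<beta>) id) \<and>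
     (\<forall>\<alpha>\<in>A. topspace (Ms \<alpha>) \<subseteq> topspace M \<and> continuous_map (Ms \<alpha>) M id) \<and>
     M closure_of directed_union A Ms = topspace M"

section \<open>Topological vector spaces and well-filled charts\<close>

text \<open>A real Hausdorff topological vector space is encoded by a topology whose \<open>topspace\<close> is a linear
  subspace of a type of class \<^class>\<open>real_vector\<close>; the ambient type carries no topology. Any set of
  real vector spaces embeds into one such type (e.g. their direct sum), and one and the same type
  accommodates vector subspaces with vector topologies of their own.\<close>

definition topological_vector_space :: "'e::real_vector topology \<Rightarrow> bool" where
  "topological_vector_space E \<longleftrightarrow>
     subspace (topspace E) \<and> Hausdorff_space E \<and>
     continuous_map (prod_topology E E) E (\<lambda>(x, y). x + y) \<and>
     continuous_map (prod_topology euclideanreal E) E (\<lambda>(t, x). t *\<^sub>R x)"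

definition conv2 :: "'e::real_vector set \<Rightarrow> 'e set" where
  "conv2 Y = {t *\<^sub>R y1 + (1 - t) *\<^sub>R y2 | t y1 y2. y1 \<in> Y \<and> y2 \<in> Y \<and> t \<in> {0..1}}"

text \<open>\<open>\<phi> : U \<rightarrow> V \<subseteq> E\<close> is a well-filled chart whose core is the preimage of \<open>V2\<close> in \<open>U\<close>. The
  charts \<open>\<phi>s \<alpha>\<close> and their model spaces \<open>Es \<alpha>\<close> matter for indices \<open>\<alpha> \<ge> \<alpha>0\<close> only.\<close>

definition well_filled_chart ::
  "'a topology \<Rightarrow> 'i set \<Rightarrow> ('i \<Rightarrow> 'i \<Rightarrow> bool) \<Rightarrow> ('i \<Rightarrow> 'a topology) \<Rightarrow>
   'a set \<Rightarrow> 'e::real_vector topology \<Rightarrow> 'e set \<Rightarrow> ('a \<Rightarrow> 'e) \<Rightarrow> 'e set \<Rightarrow> bool" where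
  "well_filled_chart M A leq Ms U E V \<phi> V2 \<longleftrightarrow>
     topological_vector_space E \<and> openin M U \<and> V \<subseteq> topspace E \<and>
     homeomorphic_map (subtopology M U) (subtopology E V) \<phi> \<and>
     (\<exists>\<alpha>0\<in>A. \<exists>Us Es Vs \<phi>s.
        let I = {\<alpha>\<in>A. leq \<alpha>0 \<alpha>}; Vinf = (\<Union>\<alpha>\<in>I. Vs \<alpha>) in
        (\<forall>\<alpha>\<in>I. topological_vector_space (Es \<alpha>) \<and>
           topspace (Es \<alpha>) \<subseteq> topspace E \<and> continuous_map (Es \<alpha>) E id) \<and>
        (\<forall>\<alpha>\<in>I. \<forall>\<beta>\<in>I. leq \<alpha> \<beta> \<longrightarrow>
           topspace (Es \<alpha>) \<subseteq> topspace (Es \<beta>) \<and> continuous_map (Es \<alpha>) (Es \<beta>) id) \<and>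
        (\<forall>\<alpha>\<in>I. openin (Ms \<alpha>) (Us \<alpha>) \<and> Vs \<alpha> \<subseteq> topspace (Es \<alpha>) \<and>
           homeomorphic_map (subtopology (Ms \<alpha>) (Us \<alpha>)) (subtopology (Es \<alpha>) (Vs \<alpha>)) (\<phi>s \<alpha>)) \<and>
        (\<forall>\<alpha>\<in>I. Us \<alpha> \<subseteq> U \<and> (\<forall>x\<in>Us \<alpha>. \<phi> x = \<phi>s \<alpha> x)) \<and>
        (\<forall>\<alpha>\<in>I. \<forall>\<beta>\<in>I. leq \<alpha> \<beta> \<longrightarrow> Us \<alpha> \<subseteq> Us \<beta> \<and> (\<forall>x\<in>Us \<alpha>. \<phi>s \<beta> x = \<phi>s \<alpha> x)) \<and>
        (\<Union>\<alpha>\<in>I. Us \<alpha>) = U \<inter> directed_union A Ms \<and>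
        V2 \<noteq> {} \<and> openin (subtopology E V) V2 \<and> conv2 V2 \<subseteq> V \<and> conv2 (V2 \<inter> Vinf) \<subseteq> Vinf \<and>
        (\<forall>\<alpha>\<in>I. \<forall>K. K \<subseteq> V2 \<inter> Vs \<alpha> \<and> compactin (Es \<alpha>) K \<longrightarrow>
           (\<exists>\<beta>\<in>A. leq \<alpha> \<beta> \<and> conv2 K \<subseteq> Vs \<beta>)))"

text \<open>The type argument is the ambient vector space type of the model spaces, which may vary from
  chart to chart within that type.\<close>

definition admits_well_filled_charts ::
  "'e::real_vector itself \<Rightarrow> 'a topology \<Rightarrow> 'i set \<Rightarrow> ('i \<Rightarrow> 'i \<Rightarrow> bool) \<Rightarrow>
   ('i \<Rightarrow> 'a topology) \<Rightarrow> bool" where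
  "admits_well_filled_charts TYPE('e) M A leq Ms \<longleftrightarrow>
     topspace M = \<Union>{{x\<in>U. \<phi> x \<in> V2} | U (E :: 'e topology) V \<phi> V2.
                       well_filled_chart M A leq Ms U E V \<phi> V2}"

section \<open>Homotopy groups in positive degrees\<close>

text \<open>The unit cube, with its points encoded as functions that are extensional on \<open>{..<k}\<close>.\<close>

definition cube :: "nat \<Rightarrow> (nat \<Rightarrow> real) topology" where
  "cube k = product_topology (\<lambda>_. top_of_set {0..1}) {..<k}"

definition cube_boundary :: "nat \<Rightarrow> (nat \<Rightarrow> real) set" where
  "cube_boundary k = {x \<in> topspace (cube k). \<exists>i<k. x i = 0 \<or> x i = 1}"

definition cube_loops :: "nat \<Rightarrow> 'a topology \<Rightarrow> 'a \<Rightarrow> ((nat \<Rightarrow> real) \<Rightarrow> 'a) set" where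
  "cube_loops k X p = {f. continuous_map (cube k) X f \<and> (\<forall>x\<in>cube_boundary k. f x = p)}"

definition cube_homotopic ::
  "nat \<Rightarrow> 'a topology \<Rightarrow> 'a \<Rightarrow> ((nat \<Rightarrow> real) \<Rightarrow> 'a) \<Rightarrow> ((nat \<Rightarrow> real) \<Rightarrow> 'a) \<Rightarrow> bool" where
  "cube_homotopic k X p = homotopic_with (\<lambda>f. \<forall>x\<in>cube_boundary k. f x = p) (cube k) X"

text \<open>Homotopy classes are not restricted to functions that are extensional on the cube: functions
  that agree on the cube are homotopic.\<close>

definition cube_class ::
  "nat \<Rightarrow> 'a topology \<Rightarrow> 'a \<Rightarrow> ((nat \<Rightarrow> real) \<Rightarrow> 'a) \<Rightarrow> ((nat \<Rightarrow> real) \<Rightarrow> 'a) set" where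
  "cube_class k X p f = {g. cube_homotopic k X p f g}"

definition cube_concat ::
  "((nat \<Rightarrow> real) \<Rightarrow> 'a) \<Rightarrow> ((nat \<Rightarrow> real) \<Rightarrow> 'a) \<Rightarrow> (nat \<Rightarrow> real) \<Rightarrow> 'a" where
  "cube_concat f g x = (if x 0 \<le> 1/2 then f (x(0 := 2 * x 0)) else g (x(0 := 2 * x 0 - 1)))"

text \<open>Meaningful for \<open>k \<ge> 1\<close> only. The product of two classes is written without choosing
  representatives; it is the class of the concatenation of any two of them.\<close>

definition homotopy_group ::
  "nat \<Rightarrow> 'a topology \<Rightarrow> 'a \<Rightarrow> ((nat \<Rightarrow> real) \<Rightarrow> 'a) set monoid" where
  "homotopy_group k X p =
     \<lparr>carrier = cube_class k X p ` cube_loops k X p,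
      mult = (\<lambda>a b. {h. \<exists>f\<in>a. \<exists>g\<in>b. cube_homotopic k X p (cube_concat f g) h}),
      one = cube_class k X p (\<lambda>_. p)\<rparr>"

text \<open>The map induced by the inclusion of a space into \<open>Y\<close>, sending the class of \<open>f\<close> to the class of
  \<open>f\<close> as a map to \<open>Y\<close>.\<close>

definition homotopy_incl ::
  "nat \<Rightarrow> 'a topology \<Rightarrow> 'a \<Rightarrow> ((nat \<Rightarrow> real) \<Rightarrow> 'a) set \<Rightarrow> ((nat \<Rightarrow> real) \<Rightarrow> 'a) set" where
  "homotopy_incl k Y p c = {g. \<exists>f\<in>c. cube_homotopic k Y p f g}"

section \<open>Path components\<close>

text \<open>In degree 0, \<^const>\<open>path_components_of\<close> is used, independently of the base point. The map
  induced by the inclusion of a space into \<open>Y\<close> sends a path component to the one of \<open>Y\<close> containing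
  it.\<close>

definition path_components_incl :: "'a topology \<Rightarrow> 'a set \<Rightarrow> 'a set" where
  "path_components_incl Y C = {y. \<exists>x\<in>C. path_component_of Y x y}"

definition topological_group :: "'a topology \<Rightarrow> 'a monoid \<Rightarrow> bool" where
  "topological_group X G \<longleftrightarrow>
     group G \<and> carrier G = topspace X \<and>
     continuous_map (prod_topology X X) X (\<lambda>(x, y). x \<otimes>\<^bsub>G\<^esub> y) \<and>
     continuous_map X X (\<lambda>x. inv\<^bsub>G\<^esub> x)"

definition path_component_group :: "'a topology \<Rightarrow> 'a monoid \<Rightarrow> 'a set monoid" where
  "path_component_group X G =
     \<lparr>carrier = path_components_of X,
      mult = (\<lambda>C D. {z. \<exists>x\<in>C. \<exists>y\<in>D. path_component_of X (x \<otimes>\<^bsub>G\<^esub> y) z}),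
      one = path_component_of_set X \<one>\<^bsub>G\<^esub>\<rparr>"

section \<open>Direct limits\<close>

text \<open>\<open>b \<alpha> \<beta>\<close> are the bonding maps of a direct system, \<open>L\<close> with \<open>l \<alpha>\<close> is its direct limit. The type
  argument is the type of the test objects in the universal property; a statement that leaves it
  a type variable asserts the universal property for test objects of arbitrary type.\<close>

definition set_direct_system ::
  "'i set \<Rightarrow> ('i \<Rightarrow> 'i \<Rightarrow> bool) \<Rightarrow> ('i \<Rightarrow> 'b set) \<Rightarrow> ('i \<Rightarrow> 'i \<Rightarrow> 'b \<Rightarrow> 'b) \<Rightarrow> bool" where
  "set_direct_system A leq S b \<longleftrightarrow>
     directed_set A leq \<and>
     (\<forall>\<alpha>\<in>A. \<forall>\<beta>\<in>A. leq \<alpha> \<beta> \<longrightarrow> b \<alpha> \<beta> \<in> S \<alpha> \<rightarrow> S \<beta>) \<and>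
     (\<forall>\<alpha>\<in>A. \<forall>x\<in>S \<alpha>. b \<alpha> \<alpha> x = x) \<and>
     (\<forall>\<alpha>\<in>A. \<forall>\<beta>\<in>A. \<forall>\<gamma>\<in>A. leq \<alpha> \<beta> \<and> leq \<beta> \<gamma> \<longrightarrow> (\<forall>x\<in>S \<alpha>. b \<beta> \<gamma> (b \<alpha> \<beta> x) = b \<alpha> \<gamma> x))"

definition set_direct_limit ::
  "'h itself \<Rightarrow> 'i set \<Rightarrow> ('i \<Rightarrow> 'i \<Rightarrow> bool) \<Rightarrow> ('i \<Rightarrow> 'b set) \<Rightarrow> ('i \<Rightarrow> 'i \<Rightarrow> 'b \<Rightarrow> 'b) \<Rightarrow>
   'c set \<Rightarrow> ('i \<Rightarrow> 'b \<Rightarrow> 'c) \<Rightarrow> bool" where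
  "set_direct_limit TYPE('h) A leq S b L l \<longleftrightarrow>
     set_direct_system A leq S b \<and>
     (\<forall>\<alpha>\<in>A. l \<alpha> \<in> S \<alpha> \<rightarrow> L) \<and>
     (\<forall>\<alpha>\<in>A. \<forall>\<beta>\<in>A. leq \<alpha> \<beta> \<longrightarrow> (\<forall>x\<in>S \<alpha>. l \<beta> (b \<alpha> \<beta> x) = l \<alpha> x)) \<and>
     (\<forall>(H :: 'h set) f.
        (\<forall>\<alpha>\<in>A. f \<alpha> \<in> S \<alpha> \<rightarrow> H) \<and>
        (\<forall>\<alpha>\<in>A. \<forall>\<beta>\<in>A. leq \<alpha> \<beta> \<longrightarrow> (\<forall>x\<in>S \<alpha>. f \<beta> (b \<alpha> \<beta> x) = f \<alpha> x)) \<longrightarrow>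
        (\<exists>!h. h \<in> L \<rightarrow>\<^sub>E H \<and> (\<forall>\<alpha>\<in>A. \<forall>x\<in>S \<alpha>. h (l \<alpha> x) = f \<alpha> x)))"

definition group_direct_system ::
  "'i set \<Rightarrow> ('i \<Rightarrow> 'i \<Rightarrow> bool) \<Rightarrow> ('i \<Rightarrow> 'b monoid) \<Rightarrow> ('i \<Rightarrow> 'i \<Rightarrow> 'b \<Rightarrow> 'b) \<Rightarrow> bool" where
  "group_direct_system A leq G b \<longleftrightarrow>
     set_direct_system A leq (\<lambda>\<alpha>. carrier (G \<alpha>)) b \<and>
     (\<forall>\<alpha>\<in>A. group (G \<alpha>)) \<and>
     (\<forall>\<alpha>\<in>A. \<forall>\<beta>\<in>A. leq \<alpha> \<beta> \<longrightarrow> b \<alpha> \<beta> \<in> hom (G \<alpha>) (G \<beta>))"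

definition group_direct_limit ::
  "'h itself \<Rightarrow> 'i set \<Rightarrow> ('i \<Rightarrow> 'i \<Rightarrow> bool) \<Rightarrow> ('i \<Rightarrow> 'b monoid) \<Rightarrow> ('i \<Rightarrow> 'i \<Rightarrow> 'b \<Rightarrow> 'b) \<Rightarrow>
   'c monoid \<Rightarrow> ('i \<Rightarrow> 'b \<Rightarrow> 'c) \<Rightarrow> bool" where
  "group_direct_limit TYPE('h) A leq G b L l \<longleftrightarrow>
     group_direct_system A leq G b \<and> group L \<and>
     (\<forall>\<alpha>\<in>A. l \<alpha> \<in> hom (G \<alpha>) L) \<and>
     (\<forall>\<alpha>\<in>A. \<forall>\<beta>\<in>A. leq \<alpha> \<beta> \<longrightarrow> (\<forall>x\<in>carrier (G \<alpha>). l \<beta> (b \<alpha> \<beta> x) = l \<alpha> x)) \<and>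
     (\<forall>(H :: 'h monoid) f.
        group H \<and> (\<forall>\<alpha>\<in>A. f \<alpha> \<in> hom (G \<alpha>) H) \<and>
        (\<forall>\<alpha>\<in>A. \<forall>\<beta>\<in>A. leq \<alpha> \<beta> \<longrightarrow> (\<forall>x\<in>carrier (G \<alpha>). f \<beta> (b \<alpha> \<beta> x) = f \<alpha> x)) \<longrightarrow>
        (\<exists>!h. h \<in> hom L H \<and> h \<in> extensional (carrier L) \<and>
              (\<forall>\<alpha>\<in>A. \<forall>x\<in>carrier (G \<alpha>). h (l \<alpha> x) = f \<alpha> x)))"

end

theory Submission
  imports Defs
begin

text \<open>A continuous map \<open>F\<close> from a cube into \<open>M\<close> which takes its boundary into some \<open>M\<^sub>\<alpha>\<close> can be
  approximated by a map into some \<open>M\<^sub>\<beta>\<close>, unchanged on the boundary. Subdivide the cube into a fine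
  grid: vertices move into \<open>M\<^sub>\<infinity>\<close> by density, and a map on the boundary of a cell extends over the
  cell by coning it off inside a chart. Coning joins points to one fixed point only, so \<open>conv\<^sub>2\<close> of
  a compact set suffices, which is what well-filled charts provide. Approximation is measured by
  a nested sequence of neighbourhoods of the graph of \<open>F\<close>, one for each dimension of cells, so that
  cells of different charts fit together and control is lost only finitely often.

  Applied to a homotopy, seen as a map on a cube of one dimension more, this shows that loops in
  \<open>M\<^sub>\<alpha>\<close> which are homotopic in \<open>M\<close> are homotopic in some \<open>M\<^sub>\<beta>\<close>. Applied to a loop in \<open>M\<close>, it gives
  an approximating loop in some \<open>M\<^sub>\<beta>\<close>; applied once more, to the constant family \<open>M\<close> and the
  constant homotopy, it shows that sufficiently close loops are homotopic in \<open>M\<close>.\<close>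

section \<open>Coning off compact sets in well-filled charts\<close>

text \<open>The topology of \<open>Ms \<alpha>\<close> may be strictly finer than that of
  \<open>M\<close>, so a map with values in the union that is continuous into \<open>M\<close> need
  not be continuous into any stage. Maps into stages are therefore built only by pasting pieces,
  each continuous into some stage, and every new piece may force a later index; a grid has finitely
  many cells, so finitely many such moves suffice. Model spaces need not be locally convex, so a
  cone over a set in a small neighbourhood stays only in a larger one. Boundary values on a cell
  must lie in the smaller set, the extension in the larger; this is why neighbourhoods are lost once
  per dimension and must be chosen starting from the largest. Two nearby maps need not be joined by
  segments, as charts differ from place to place, whence the detour through the constant family. It
  works because of the order of quantifiers in \<open>approximate_extension\<close>: the tolerance
  depends on the given map and the target neighbourhood alone and serves all boundary maps into all
  stages.\<close>

text \<open>All that the proof uses of well-filled charts.\<close>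

definition cone_fillable ::
  "'i set \<Rightarrow> ('i \<Rightarrow> 'i \<Rightarrow> bool) \<Rightarrow> ('i \<Rightarrow> 'a topology) \<Rightarrow> 'a set \<Rightarrow> 'a set \<Rightarrow> bool" where
  "cone_fillable A leq Ms W' W \<longleftrightarrow>
     (\<forall>\<alpha>\<in>A. \<forall>K. compactin (Ms \<alpha>) K \<and> K \<subseteq> W' \<longrightarrow>
        (\<forall>y\<in>K. \<exists>\<beta>\<in>A. leq \<alpha> \<beta> \<and>
           (\<exists>h. continuous_map (prod_topology (top_of_set {0..1::real}) (subtopology (Ms \<alpha>) K)) (Ms \<beta>) h \<and>
                (\<forall>x\<in>K. h (1, x) = x \<and> h (0, x) = y) \<and> h ` ({0..1} \<times> K) \<subseteq> W)))"

definition locally_cone_fillable ::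
  "'a topology \<Rightarrow> 'i set \<Rightarrow> ('i \<Rightarrow> 'i \<Rightarrow> bool) \<Rightarrow> ('i \<Rightarrow> 'a topology) \<Rightarrow> bool" where
  "locally_cone_fillable M A leq Ms \<longleftrightarrow>
     (\<forall>W x. openin M W \<and> x \<in> W \<longrightarrow>
        (\<exists>W'. openin M W' \<and> x \<in> W' \<and> W' \<subseteq> W \<and> cone_fillable A leq Ms W' W))"

lemma continuous_map_segment:
  assumes "topological_vector_space E"
    and a: "continuous_map Z euclideanreal a" and f: "continuous_map Z E f" and g: "continuous_map Z E g"
  shows "continuous_map Z E (\<lambda>z. a z *\<^sub>R f z + (1 - a z) *\<^sub>R g z)"
proof -
  have add: "continuous_map (prod_topology E E) E (\<lambda>(x, y). x + y)"
    and scl: "continuous_map (prod_topology euclideanreal E) E (\<lambda>(t, x). t *\<^sub>R x)"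
    using assms(1) by (auto simp: topological_vector_space_def)
  have scale: "continuous_map Z E (\<lambda>z. b z *\<^sub>R e z)"
    if "continuous_map Z euclideanreal b" "continuous_map Z E e" for b e
    using continuous_map_compose[OF continuous_map_pairedI[OF that] scl] by (simp add: o_def)
  have "continuous_map Z euclideanreal (\<lambda>z. 1 - a z)"
    by (intro continuous_intros a)
  from continuous_map_compose[OF continuous_map_pairedI[OF scale[OF a f] scale[OF this g]] add]
  show ?thesis by (simp add: o_def)
qed

lemma conv2I: "y1 \<in> Y \<Longrightarrow> y2 \<in> Y \<Longrightarrow> t \<in> {0..1} \<Longrightarrow> t *\<^sub>R y1 + (1 - t) *\<^sub>R y2 \<in> conv2 Y"
  unfolding conv2_def by blast

lemma subset_conv2: "Y \<subseteq> conv2 Y"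
  using conv2I[of _ Y _ 1] by force

lemma conv2_mono: "X \<subseteq> Y \<Longrightarrow> conv2 X \<subseteq> conv2 Y"
  unfolding conv2_def by blast

text \<open>The segment map is constant on the compact set of all (t, v, v), so by the tube lemma it
  takes pairs close to (v, v) into \<open>Y\<close> for all t at once. This stands in for convex
  neighbourhoods; \<open>V3\<close> itself need not be convex.\<close>

lemma small_conv2:
  assumes E: "topological_vector_space E" and VE: "V \<subseteq> topspace E"
    and V2: "openin (subtopology E V) V2" and conv: "conv2 V2 \<subseteq> V"
    and Y: "openin (subtopology E V) Y" and v: "v \<in> Y" "v \<in> V2"
  obtains V3 where "openin (subtopology E V) V3" "v \<in> V3" "V3 \<subseteq> V2" "conv2 V3 \<subseteq> Y"
proof -
  let ?X = "subtopology E V2"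
  let ?I = "top_of_set {0..1::real}"
  let ?c = "\<lambda>z. fst z *\<^sub>R fst (snd z) + (1 - fst z) *\<^sub>R snd (snd z)"
  have V2V: "V2 \<subseteq> V"
    using V2 openin_imp_subset by blast
  have tsX: "topspace ?X = V2"
    using V2V VE by auto
  have "continuous_map (prod_topology ?I (prod_topology ?X ?X)) E ?c"
  proof (rule continuous_map_segment[OF E])
    show "continuous_map (prod_topology ?I (prod_topology ?X ?X)) euclideanreal fst"
      using continuous_map_fst continuous_map_into_fulltopology by blast
    have "continuous_map (prod_topology ?X ?X) E fst" "continuous_map (prod_topology ?X ?X) E snd"
      using continuous_map_fst continuous_map_snd continuous_map_into_fulltopology by blast+
    from this[THEN continuous_map_compose[OF continuous_map_snd]]
    show "continuous_map (prod_topology ?I (prod_topology ?X ?X)) E (\<lambda>z. fst (snd z))"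
      "continuous_map (prod_topology ?I (prod_topology ?X ?X)) E (\<lambda>z. snd (snd z))"
      by (auto simp: o_def)
  qed
  \<comment> \<open>\<open>V\<close> need not be open in \<open>E\<close>, so \<open>Y\<close> is
    open only relative to \<open>V\<close>, and the segments have to run inside \<open>V\<close> for
    the preimage of \<open>Y\<close> to be open. End points in \<open>V2\<close> ensure
    this.\<close>
  moreover have "?c z \<in> V" if "z \<in> topspace (prod_topology ?I (prod_topology ?X ?X))" for z
  proof -
    have "fst z \<in> {0..1}" "fst (snd z) \<in> V2" "snd (snd z) \<in> V2"
      using that by auto
    then have "?c z \<in> conv2 V2"
      by (intro conv2I)
    then show ?thesis using conv by auto
  qed
  ultimately have c: "continuous_map (prod_topology ?I (prod_topology ?X ?X)) (subtopology E V) ?c"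
    by (auto simp: continuous_map_in_subtopology)
  define P where "P = {z \<in> topspace (prod_topology ?I (prod_topology ?X ?X)). ?c z \<in> Y}"
  have P: "openin (prod_topology ?I (prod_topology ?X ?X)) P"
    unfolding P_def using openin_continuous_map_preimage[OF c Y] .
  have "topspace ?I \<times> {(v, v)} \<subseteq> P"
    using v tsX by (auto simp: P_def scaleR_diff_left)
  then have sub: "topspace ?I \<times> {(v, v)} \<subseteq> P" .
  have c1: "compactin ?I (topspace ?I)"
    by (simp add: compactin_subtopology)
  have c2: "compactin (prod_topology ?X ?X) {(v, v)}"
    using v V2V VE by (auto simp: compactin_sing)
  obtain T N where TN: "openin ?I T" "openin (prod_topology ?X ?X) N"
      "topspace ?I \<subseteq> T" "{(v, v)} \<subseteq> N" "T \<times> N \<subseteq> P"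
    using Wallace_theorem_prod_topology[OF c1 c2 P sub] by blast
  obtain N1 N2 where N: "openin ?X N1" "openin ?X N2" "v \<in> N1" "v \<in> N2" "N1 \<times> N2 \<subseteq> N"
    using TN(2)[unfolded openin_prod_topology_alt, rule_format, of v v] TN(4) by auto
  have o: "openin ?X (N1 \<inter> N2)"
    using N by auto
  show thesis
  proof
    have "?X = subtopology (subtopology E V) V2"
      using V2V by (simp add: subtopology_subtopology inf.absorb2)
    then show "openin (subtopology E V) (N1 \<inter> N2)"
      using o V2 openin_open_subtopology by metis
    show "v \<in> N1 \<inter> N2" using N by auto
    show "N1 \<inter> N2 \<subseteq> V2" using o openin_subset tsX by blast
    show "conv2 (N1 \<inter> N2) \<subseteq> Y"
    proof
      fix e assume "e \<in> conv2 (N1 \<inter> N2)"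
      then obtain t y1 y2 where e: "e = t *\<^sub>R y1 + (1 - t) *\<^sub>R y2" "y1 \<in> N1 \<inter> N2" "y2 \<in> N1 \<inter> N2" "t \<in> {0..1}"
        unfolding conv2_def by blast
      then have "(y1, y2) \<in> N" using N(5) by auto
      moreover have "t \<in> T" using e(4) TN(3) by auto
      ultimately have "(t, y1, y2) \<in> P" using TN(5) by auto
      then show "e \<in> Y" by (simp add: P_def e)
    qed
  qed
qed


text \<open>Finitely many of the sets cover \<open>K\<close>, and an upper bound of their indices
  serves alone. Only the traces on \<open>X\<close> are asked to be open, because each
  \<open>Us \<beta>\<close> will be open in a stage of its own.\<close>

lemma compactin_directed_absorb:
  assumes dir: "directed_set I leq"
    and mono: "\<And>\<beta> \<gamma>. \<lbrakk>\<beta> \<in> I; \<gamma> \<in> I; leq \<beta> \<gamma>\<rbrakk> \<Longrightarrow> Us \<beta> \<subseteq> Us \<gamma>"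
    and "open": "\<And>\<beta>. \<beta> \<in> I \<Longrightarrow> openin X (topspace X \<inter> Us \<beta>)"
    and K: "compactin X K" "K \<subseteq> (\<Union>\<beta>\<in>I. Us \<beta>)"
  obtains \<beta> where "\<beta> \<in> I" "K \<subseteq> Us \<beta>"
proof -
  have "\<exists>\<F>. finite \<F> \<and> \<F> \<subseteq> (\<lambda>\<beta>. topspace X \<inter> Us \<beta>) ` I \<and> K \<subseteq> \<Union>\<F>"
    by (rule compactinD[OF K(1)]) (use "open" K compactin_subset_topspace[OF K(1)] in auto)
  then obtain F where F: "finite F" "F \<subseteq> I" "K \<subseteq> (\<Union>\<beta>\<in>F. topspace X \<inter> Us \<beta>)"
    by (metis finite_subset_image)
  have ub: "\<exists>\<gamma>\<in>I. \<forall>\<beta>\<in>F. leq \<beta> \<gamma>"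
    using F(1,2)
  proof (induction F)
    case empty
    then show ?case using dir by (auto simp: directed_set_def)
  next
    case (insert \<beta> F)
    then obtain \<gamma> where g: "\<gamma> \<in> I" "\<forall>\<beta>\<in>F. leq \<beta> \<gamma>" by auto
    with insert.prems dir obtain \<delta> where d: "\<delta> \<in> I" "leq \<beta> \<delta>" "leq \<gamma> \<delta>"
      by (force simp: directed_set_def)
    have "leq \<beta>' \<delta>" if "\<beta>' \<in> F" for \<beta>'
      using dir g d that insert.prems by (auto simp: directed_set_def dest: transp_onD)
    then show ?case using d by auto
  qed
  then obtain \<gamma> where "\<gamma> \<in> I" "\<forall>\<beta>\<in>F. leq \<beta> \<gamma>" by auto
  with F(2,3) mono have "K \<subseteq> Us \<gamma>" by fastforce
  with \<open>\<gamma> \<in> I\<close> that show thesis by blast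
qed

lemma directed_set_above:
  assumes dir: "directed_set A leq" and "\<alpha>0 \<in> A"
  shows "directed_set {\<alpha>\<in>A. leq \<alpha>0 \<alpha>} leq"
  unfolding directed_set_def
proof (intro conjI ballI)
  have refl: "reflp_on A leq" and trans: "transp_on A leq"
    using dir by (auto simp: directed_set_def)
  show "{\<alpha>\<in>A. leq \<alpha>0 \<alpha>} \<noteq> {}" using refl \<open>\<alpha>0 \<in> A\<close> by (auto dest: reflp_onD)
  show "reflp_on {\<alpha>\<in>A. leq \<alpha>0 \<alpha>} leq" using refl by (auto intro: reflp_on_subset)
  show "transp_on {\<alpha>\<in>A. leq \<alpha>0 \<alpha>} leq" using trans by (auto intro: transp_on_subset)
  fix \<alpha> \<beta> assume ab: "\<alpha> \<in> {\<alpha>\<in>A. leq \<alpha>0 \<alpha>}" "\<beta> \<in> {\<alpha>\<in>A. leq \<alpha>0 \<alpha>}"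
  then obtain \<gamma> where "\<gamma> \<in> A" "leq \<alpha> \<gamma>" "leq \<beta> \<gamma>"
    using dir by (auto simp: directed_set_def)
  moreover have "leq \<alpha>0 \<gamma>"
    using transp_onD[OF trans \<open>\<alpha>0 \<in> A\<close> _ \<open>\<gamma> \<in> A\<close>, of \<alpha>] ab \<open>leq \<alpha> \<gamma>\<close> by auto
  ultimately show "\<exists>\<gamma>\<in>{\<alpha>\<in>A. leq \<alpha>0 \<alpha>}. leq \<alpha> \<gamma> \<and> leq \<beta> \<gamma>" by auto
qed

text \<open>In the chart the contraction is the segment to \<open>\<phi> y\<close>; the question is
  in which stage it runs. A first passage to a later index puts \<open>K\<close> into the domain of
  a stage chart, and a second one, granted by the filling condition, puts all segments between
  points of its image into the range of a stage chart, whose inverse carries them back.\<close>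

lemma well_filled_chart_cone_fillable:
  assumes fam: "dense_directed_family M A leq Ms"
    and chart: "well_filled_chart M A leq Ms U E V \<phi> V2"
    and W: "openin M W" and x: "x \<in> W" "x \<in> U" "\<phi> x \<in> V2"
  obtains W' where "openin M W'" "x \<in> W'" "W' \<subseteq> W" "cone_fillable A leq Ms W' W"
proof -
  have E: "topological_vector_space E" and U: "openin M U" and VE: "V \<subseteq> topspace E"
    and hom: "homeomorphic_map (subtopology M U) (subtopology E V) \<phi>"
    using chart by (auto simp: well_filled_chart_def)
  obtain \<alpha>0 Us Es Vs \<phi>s where \<alpha>0: "\<alpha>0 \<in> A" and ex:
    "let I = {\<alpha>\<in>A. leq \<alpha>0 \<alpha>}; Vinf = (\<Union>\<alpha>\<in>I. Vs \<alpha>) in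
        (\<forall>\<alpha>\<in>I. topological_vector_space (Es \<alpha>) \<and>
           topspace (Es \<alpha>) \<subseteq> topspace E \<and> continuous_map (Es \<alpha>) E id) \<and>
        (\<forall>\<alpha>\<in>I. \<forall>\<beta>\<in>I. leq \<alpha> \<beta> \<longrightarrow>
           topspace (Es \<alpha>) \<subseteq> topspace (Es \<beta>) \<and> continuous_map (Es \<alpha>) (Es \<beta>) id) \<and>
        (\<forall>\<alpha>\<in>I. openin (Ms \<alpha>) (Us \<alpha>) \<and> Vs \<alpha> \<subseteq> topspace (Es \<alpha>) \<and>
           homeomorphic_map (subtopology (Ms \<alpha>) (Us \<alpha>)) (subtopology (Es \<alpha>) (Vs \<alpha>)) (\<phi>s \<alpha>)) \<and>
        (\<forall>\<alpha>\<in>I. Us \<alpha> \<subseteq> U \<and> (\<forall>x\<in>Us \<alpha>. \<phi> x = \<phi>s \<alpha> x)) \<and>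
        (\<forall>\<alpha>\<in>I. \<forall>\<beta>\<in>I. leq \<alpha> \<beta> \<longrightarrow> Us \<alpha> \<subseteq> Us \<beta> \<and> (\<forall>x\<in>Us \<alpha>. \<phi>s \<beta> x = \<phi>s \<alpha> x)) \<and>
        (\<Union>\<alpha>\<in>I. Us \<alpha>) = U \<inter> directed_union A Ms \<and>
        V2 \<noteq> {} \<and> openin (subtopology E V) V2 \<and> conv2 V2 \<subseteq> V \<and> conv2 (V2 \<inter> Vinf) \<subseteq> Vinf \<and>
        (\<forall>\<alpha>\<in>I. \<forall>K. K \<subseteq> V2 \<inter> Vs \<alpha> \<and> compactin (Es \<alpha>) K \<longrightarrow>
           (\<exists>\<beta>\<in>A. leq \<alpha> \<beta> \<and> conv2 K \<subseteq> Vs \<beta>))"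
    using chart unfolding well_filled_chart_def by blast
  define I where "I = {\<alpha>\<in>A. leq \<alpha>0 \<alpha>}"
  note ex = ex[unfolded Let_def, folded I_def]
  note ex' = ex[THEN conjunct2] ex[THEN conjunct2, THEN conjunct2]
  note ex'' = ex'(2)[THEN conjunct2] ex'(2)[THEN conjunct2, THEN conjunct2]
  note ex3 = ex''(2)[THEN conjunct2] ex''(2)[THEN conjunct2, THEN conjunct2]
  have Es: "\<And>\<alpha>. \<alpha> \<in> I \<Longrightarrow> topological_vector_space (Es \<alpha>)"
    using ex[THEN conjunct1] by simp
  have Es_mono: "\<And>\<alpha> \<beta>. \<lbrakk>\<alpha> \<in> I; \<beta> \<in> I; leq \<alpha> \<beta>\<rbrakk> \<Longrightarrow> continuous_map (Es \<alpha>) (Es \<beta>) id"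
    using ex'(1)[THEN conjunct1] by simp
  have Us: "\<And>\<alpha>. \<alpha> \<in> I \<Longrightarrow> openin (Ms \<alpha>) (Us \<alpha>)"
    and Vs: "\<And>\<alpha>. \<alpha> \<in> I \<Longrightarrow> Vs \<alpha> \<subseteq> topspace (Es \<alpha>)"
    and homs: "\<And>\<alpha>. \<alpha> \<in> I \<Longrightarrow>
      homeomorphic_map (subtopology (Ms \<alpha>) (Us \<alpha>)) (subtopology (Es \<alpha>) (Vs \<alpha>)) (\<phi>s \<alpha>)"
    using ex'(2)[THEN conjunct1] by simp_all
  have UsU: "\<And>\<alpha>. \<alpha> \<in> I \<Longrightarrow> Us \<alpha> \<subseteq> U"
    and \<phi>s: "\<And>\<alpha> x. \<alpha> \<in> I \<Longrightarrow> x \<in> Us \<alpha> \<Longrightarrow> \<phi>s \<alpha> x = \<phi> x"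
    using ex''(1)[THEN conjunct1] by simp_all
  have Us_mono: "\<And>\<alpha> \<beta>. \<lbrakk>\<alpha> \<in> I; \<beta> \<in> I; leq \<alpha> \<beta>\<rbrakk> \<Longrightarrow> Us \<alpha> \<subseteq> Us \<beta>"
    using ex''(2)[THEN conjunct1] by simp
  have Us_Un: "(\<Union>\<alpha>\<in>I. Us \<alpha>) = U \<inter> directed_union A Ms"
    using ex3(1)[THEN conjunct1] .
  note ex4 = ex3(2)[THEN conjunct2]
  have V2: "openin (subtopology E V) V2" "conv2 V2 \<subseteq> V"
    using ex4[THEN conjunct1] ex4[THEN conjunct2, THEN conjunct1] by simp_all
  have fill: "\<And>\<alpha> K. \<lbrakk>\<alpha> \<in> I; K \<subseteq> V2 \<inter> Vs \<alpha>; compactin (Es \<alpha>) K\<rbrakk> \<Longrightarrow> \<exists>\<beta>\<in>A. leq \<alpha> \<beta> \<and> conv2 K \<subseteq> Vs \<beta>"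
    by (rule ex4[THEN conjunct2, THEN conjunct2, THEN conjunct2, THEN bspec, THEN spec, THEN mp]) simp_all
  have dirA: "directed_set A leq" and transA: "transp_on A leq"
    using fam by (auto simp: dense_directed_family_def directed_set_def)
  then have dirI: "directed_set I leq"
    using directed_set_above[OF _ \<alpha>0] by (simp add: I_def)
  have Ms_mono: "continuous_map (Ms \<alpha>) (Ms \<beta>) id" if "\<alpha> \<in> A" "\<beta> \<in> A" "leq \<alpha> \<beta>" for \<alpha> \<beta>
    using fam that by (auto simp: dense_directed_family_def)
  have UM: "U \<subseteq> topspace M" using U openin_subset by blast
  have inj: "inj_on \<phi> U"
    using hom UM VE by (auto simp: homeomorphic_eq_everything_map inf.absorb2)
  have "openin (subtopology M U) (U \<inter> W)"
    using W by (simp add: openin_subtopology_Int2)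
  then have "openin (subtopology E V) (\<phi> ` (U \<inter> W))"
    using homeomorphic_map_openness_eq[OF hom] by blast
  then obtain V3 where V3: "openin (subtopology E V) V3" "\<phi> x \<in> V3" "V3 \<subseteq> V2" "conv2 V3 \<subseteq> \<phi> ` (U \<inter> W)"
    using small_conv2[OF E VE V2, of "\<phi> ` (U \<inter> W)" "\<phi> x"] x by blast
  define W' where "W' = {y \<in> topspace (subtopology M U). \<phi> y \<in> V3}"
  have "openin (subtopology M U) W'"
    unfolding W'_def using openin_continuous_map_preimage[OF homeomorphic_imp_continuous_map[OF hom] V3(1)] .
  then have W'M: "openin M W'"
    using U openin_open_subtopology by blast
  have W'U: "W' \<subseteq> U" by (auto simp: W'_def)
  \<comment> \<open>By injectivity of \<open>\<phi>\<close> on \<open>U\<close>, a point of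
    \<open>U\<close> whose image lies in the image of \<open>U \<inter> W\<close> belongs to
    \<open>W\<close>.\<close>
  have in_W: "y \<in> W" if y: "y \<in> U" "\<phi> y \<in> conv2 V3" for y
  proof -
    obtain w where "w \<in> U \<inter> W" "\<phi> y = \<phi> w" using V3(4) y by blast
    then show ?thesis using inj y by (auto dest: inj_onD)
  qed
  have "cone_fillable A leq Ms W' W"
    unfolding cone_fillable_def
  proof (intro ballI allI impI)
    fix \<alpha> K y assume \<alpha>: "\<alpha> \<in> A" and "compactin (Ms \<alpha>) K \<and> K \<subseteq> W'" and y: "y \<in> K"
    then have K: "compactin (Ms \<alpha>) K" "K \<subseteq> W'" by auto
    \<comment> \<open>The stage charts exist only above \<open>\<alpha>0\<close>, to which
      \<open>\<alpha>\<close> need not be comparable.\<close>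
    obtain \<alpha>1 where \<alpha>1: "\<alpha>1 \<in> A" "leq \<alpha> \<alpha>1" "leq \<alpha>0 \<alpha>1"
      using dirA \<alpha> \<alpha>0 unfolding directed_set_def by blast
    have compK: "compactin (Ms \<beta>) K" if "\<beta> \<in> A" "leq \<alpha> \<beta>" for \<beta>
      using image_compactin[OF K(1) Ms_mono[OF \<alpha> that]] by simp
    have K1: "compactin (Ms \<alpha>1) K" using compK \<alpha>1 by blast
    define J where "J = {\<beta>\<in>I. leq \<alpha>1 \<beta>}"
    have "\<alpha>1 \<in> I" using \<alpha>1 by (simp add: I_def)
    then have dirJ: "directed_set J leq"
      unfolding J_def using directed_set_above[OF dirI] by simp
    obtain \<beta> where \<beta>: "\<beta> \<in> J" "K \<subseteq> Us \<beta>"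
    proof (rule compactin_directed_absorb[OF dirJ _ _ K1])
      show "Us \<beta> \<subseteq> Us \<gamma>" if "\<beta> \<in> J" "\<gamma> \<in> J" "leq \<beta> \<gamma>" for \<beta> \<gamma>
        using that Us_mono by (auto simp: J_def)
      show "openin (Ms \<alpha>1) (topspace (Ms \<alpha>1) \<inter> Us \<beta>)" if "\<beta> \<in> J" for \<beta>
      proof -
        have "continuous_map (Ms \<alpha>1) (Ms \<beta>) id"
          using that Ms_mono \<alpha>1 by (auto simp: J_def I_def)
        from openin_continuous_map_preimage[OF this Us] that
        show ?thesis by (auto simp: J_def Int_def)
      qed
      show "K \<subseteq> \<Union> (Us ` J)"
      proof
        fix z assume z: "z \<in> K"
        then have "z \<in> topspace (Ms \<alpha>)" using compactin_subset_topspace K(1) by blast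
        then have "z \<in> U \<inter> directed_union A Ms"
          using K W'U z \<alpha> by (auto simp: directed_union_def)
        then obtain \<beta> where b: "\<beta> \<in> I" "z \<in> Us \<beta>" using Us_Un by blast
        then obtain \<gamma> where c: "\<gamma> \<in> I" "leq \<beta> \<gamma>" "leq \<alpha>1 \<gamma>"
          using dirI \<open>\<alpha>1 \<in> I\<close> unfolding directed_set_def by blast
        then show "z \<in> \<Union> (Us ` J)" using b Us_mono by (auto simp: J_def)
      qed
    qed
    have \<beta>I: "\<beta> \<in> I" "\<beta> \<in> A" and \<beta>1: "leq \<alpha>1 \<beta>" using \<beta> by (auto simp: J_def I_def)
    have \<alpha>\<beta>: "leq \<alpha> \<beta>" using transp_onD[OF transA] \<alpha> \<alpha>1 \<beta>I \<beta>1 by blast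
    have cont_\<phi>: "continuous_map (subtopology (Ms \<beta>) (Us \<beta>)) (Es \<beta>) (\<phi>s \<beta>)"
      using homeomorphic_imp_continuous_map[OF homs[OF \<beta>I(1)]] continuous_map_into_fulltopology by blast
    have "continuous_map (subtopology (Ms \<alpha>) K) (subtopology (Ms \<beta>) (Us \<beta>)) id"
      unfolding continuous_map_in_subtopology
      using Ms_mono[OF \<alpha> \<beta>I(2) \<alpha>\<beta>] \<beta>(2) by (auto intro: continuous_map_from_subtopology)
    from continuous_map_compose[OF this cont_\<phi>]
    have "continuous_map (subtopology (Ms \<alpha>) K) (Es \<beta>) (\<phi>s \<beta>)" by simp
    then have cont_\<phi>K: "continuous_map (subtopology (Ms \<alpha>) K) (Es \<beta>) \<phi>"
      by (rule continuous_map_eq) (use \<phi>s \<beta> \<beta>I in auto)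
    have "compactin (subtopology (Ms \<alpha>) K) K"
      using K(1) by (simp add: compactin_subtopology)
    from image_compactin[OF this cont_\<phi>K] have "compactin (Es \<beta>) (\<phi> ` K)" .
    moreover have "\<phi> ` K \<subseteq> V3" using K(2) by (auto simp: W'_def)
    moreover have "\<phi> ` K \<subseteq> Vs \<beta>"
    proof -
      have "\<phi>s \<beta> ` Us \<beta> \<subseteq> Vs \<beta>"
        using homeomorphic_imp_surjective_map[OF homs[OF \<beta>I(1)]] Us[OF \<beta>I(1)] openin_subset
        by (fastforce simp: inf.absorb2)
      then show ?thesis using \<beta>(2) \<phi>s[OF \<beta>I(1)] by (metis image_cong image_mono subset_eq subset_trans)
    qed
    ultimately obtain \<gamma> where \<gamma>: "\<gamma> \<in> A" "leq \<beta> \<gamma>" "conv2 (\<phi> ` K) \<subseteq> Vs \<gamma>"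
      using fill[OF \<beta>I(1), of "\<phi> ` K"] V3(3) by blast
    have \<gamma>I: "\<gamma> \<in> I"
      using \<gamma> \<beta>I transp_onD[OF transA \<alpha>0 \<beta>I(2) \<gamma>(1)] by (auto simp: I_def)
    obtain \<psi> where \<psi>: "homeomorphic_maps (subtopology (Ms \<gamma>) (Us \<gamma>)) (subtopology (Es \<gamma>) (Vs \<gamma>)) (\<phi>s \<gamma>) \<psi>"
      using homs[OF \<gamma>I] homeomorphic_map_maps by blast
    have cont_\<psi>: "continuous_map (subtopology (Es \<gamma>) (Vs \<gamma>)) (Ms \<gamma>) \<psi>"
      using \<psi> by (auto simp: homeomorphic_maps_def dest: continuous_map_into_fulltopology)
    have \<psi>_in: "\<psi> v \<in> Us \<gamma>" and \<phi>_\<psi>: "\<phi> (\<psi> v) = v" if "v \<in> Vs \<gamma>" for v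
    proof -
      have v: "v \<in> topspace (subtopology (Es \<gamma>) (Vs \<gamma>))" using that Vs[OF \<gamma>I] by auto
      then show "\<psi> v \<in> Us \<gamma>"
        using \<psi> by (auto simp: homeomorphic_maps_def continuous_map_def Pi_iff)
      then have "\<phi>s \<gamma> (\<psi> v) = \<phi> (\<psi> v)"
        using \<phi>s[OF \<gamma>I] by blast
      moreover have "\<phi>s \<gamma> (\<psi> v) = v"
        using \<psi> v by (auto simp: homeomorphic_maps_def)
      ultimately show "\<phi> (\<psi> v) = v" by simp
    qed
    have \<psi>_\<phi>: "\<psi> (\<phi> z) = z" if "z \<in> Us \<gamma>" for z
    proof -
      have "z \<in> topspace (subtopology (Ms \<gamma>) (Us \<gamma>))"
        using that openin_subset[OF Us[OF \<gamma>I]] by auto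
      then have "\<psi> (\<phi>s \<gamma> z) = z"
        using \<psi> unfolding homeomorphic_maps_def by blast
      then show ?thesis using \<phi>s[OF \<gamma>I that] by simp
    qed
    have KU: "K \<subseteq> Us \<gamma>" using \<beta> Us_mono[OF \<beta>I(1) \<gamma>I \<gamma>(2)] by auto
    let ?Z = "prod_topology (top_of_set {0..1::real}) (subtopology (Ms \<alpha>) K)"
    \<comment> \<open>Parameter 1 gives the point itself and parameter 0 the apex, the orientation
      fixed in \<open>cone_fillable\<close>.\<close>
    let ?s = "\<lambda>z. fst z *\<^sub>R \<phi> (snd z) + (1 - fst z) *\<^sub>R \<phi> y"
    have \<alpha>\<gamma>: "leq \<alpha> \<gamma>" using transp_onD[OF transA \<alpha> \<beta>I(2) \<gamma>(1) \<alpha>\<beta> \<gamma>(2)] .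
    have seg_in: "?s z \<in> conv2 (\<phi> ` K)" if "fst z \<in> {0..1}" "snd z \<in> K" for z
      using that y by (intro conv2I) auto
    have "continuous_map ?Z (Es \<gamma>) ?s"
    proof (rule continuous_map_segment[OF Es[OF \<gamma>I]])
      show "continuous_map ?Z euclideanreal fst"
        using continuous_map_fst continuous_map_into_fulltopology by blast
      have c: "continuous_map (subtopology (Ms \<alpha>) K) (Es \<gamma>) \<phi>"
        using continuous_map_compose[OF cont_\<phi>K Es_mono[OF \<beta>I(1) \<gamma>I \<gamma>(2)]] by simp
      show "continuous_map ?Z (Es \<gamma>) (\<lambda>z. \<phi> (snd z))"
        using continuous_map_compose[OF continuous_map_snd c] by (simp add: o_def)
      have "\<phi> y \<in> topspace (Es \<gamma>)"
        using continuous_map_image_subset_topspace[OF c] y compactin_subset_topspace[OF K(1)] by auto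
      then show "continuous_map ?Z (Es \<gamma>) (\<lambda>z. \<phi> y)" by simp
    qed
    then have "continuous_map ?Z (subtopology (Es \<gamma>) (Vs \<gamma>)) ?s"
      using seg_in \<gamma>(3) by (auto simp: continuous_map_in_subtopology)
    from continuous_map_compose[OF this cont_\<psi>]
    have "continuous_map ?Z (Ms \<gamma>) (\<lambda>z. \<psi> (?s z))" by (simp add: o_def)
    moreover have "\<psi> (?s z) \<in> W" if "fst z \<in> {0..1}" "snd z \<in> K" for z
    proof (rule in_W)
      have s: "?s z \<in> Vs \<gamma>" using seg_in[OF that] \<gamma>(3) by auto
      then show "\<psi> (?s z) \<in> U" using \<psi>_in UsU[OF \<gamma>I] by blast
      show "\<phi> (\<psi> (?s z)) \<in> conv2 V3"
        using \<phi>_\<psi>[OF s] seg_in[OF that] conv2_mono[OF \<open>\<phi> ` K \<subseteq> V3\<close>] by auto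
    qed
    ultimately show "\<exists>\<beta>\<in>A. leq \<alpha> \<beta> \<and>
        (\<exists>h. continuous_map ?Z (Ms \<beta>) h \<and> (\<forall>x\<in>K. h (1, x) = x \<and> h (0, x) = y) \<and> h ` ({0..1} \<times> K) \<subseteq> W)"
      using \<gamma>(1) \<alpha>\<gamma> \<psi>_\<phi> KU y by (intro bexI[of _ \<gamma>] conjI exI[of _ "\<lambda>z. \<psi> (?s z)"]) auto
  qed
  moreover have "x \<in> W'" using x V3 UM by (auto simp: W'_def)
  moreover have "W' \<subseteq> W" using in_W subset_conv2 V3 by (fastforce simp: W'_def)
  ultimately show thesis using that W'M by blast
qed

lemma admits_well_filled_charts_locally_cone_fillable:
  assumes "dense_directed_family M A leq Ms"
    and "admits_well_filled_charts TYPE('e::real_vector) M A leq Ms"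
  shows "locally_cone_fillable M A leq Ms"
  unfolding locally_cone_fillable_def
proof (intro allI impI)
  fix W x assume W: "openin M W \<and> x \<in> W"
  then have "x \<in> topspace M" using openin_subset by blast
  then obtain U and E :: "'e topology" and V \<phi> V2
    where "well_filled_chart M A leq Ms U E V \<phi> V2" "x \<in> U" "\<phi> x \<in> V2"
    using assms(2) unfolding admits_well_filled_charts_def by blast
  with W show "\<exists>W'. openin M W' \<and> x \<in> W' \<and> W' \<subseteq> W \<and> cone_fillable A leq Ms W' W"
    using well_filled_chart_cone_fillable[OF assms(1)] by metis
qed

section \<open>Neighbourhoods of graphs\<close>

text \<open>Around each point there is a ball over which the graph of \<open>F\<close> runs in
  \<open>W'\<close> while all values in \<open>W\<close> are still allowed by \<open>N\<close>.
  Deleting from \<open>N\<close>, over each of finitely many such balls, the values outside the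
  respective \<open>W'\<close> leaves an open set that contains the graph. A Lebesgue number then
  puts every small \<open>T\<close> into one of the balls.\<close>

lemma refine_graph_neighbourhood:
  fixes S :: "'b::metric_space set"
  assumes lcf: "locally_cone_fillable M A leq Ms" and S: "compact S"
    and F: "continuous_map (top_of_set S) M F"
    and N: "openin (prod_topology (top_of_set S) M) N" "\<And>x. x \<in> S \<Longrightarrow> (x, F x) \<in> N"
  obtains N' \<delta> where "openin (prod_topology (top_of_set S) M) N'" "\<And>x. x \<in> S \<Longrightarrow> (x, F x) \<in> N'"
    "N' \<subseteq> N" "\<delta> > 0"
    "\<And>T. \<lbrakk>T \<subseteq> S; T \<noteq> {}; diameter T < \<delta>\<rbrakk> \<Longrightarrow>
       \<exists>W' W. cone_fillable A leq Ms W' W \<and> T \<times> W \<subseteq> N \<and> (\<forall>x\<in>T. \<forall>m. (x, m) \<in> N' \<longrightarrow> m \<in> W')"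
proof (cases "S = {}")
  case True
  then show ?thesis using that[of N 1] N by auto
next
  case False
  have "\<exists>r W W'. r > 0 \<and> cone_fillable A leq Ms W' W \<and> openin M W' \<and>
          (S \<inter> cball x r) \<times> W \<subseteq> N \<and> F ` (S \<inter> cball x r) \<subseteq> W'" if x: "x \<in> S" for x
  proof -
    obtain B W where B: "openin (top_of_set S) B" "x \<in> B" and W: "openin M W" "F x \<in> W" "B \<times> W \<subseteq> N"
      using N(1)[unfolded openin_prod_topology_alt, rule_format, OF N(2)[OF x]] by auto
    obtain W' where W': "openin M W'" "F x \<in> W'" "cone_fillable A leq Ms W' W"
      using lcf W(1,2) unfolding locally_cone_fillable_def by metis
    have "openin (top_of_set S) (B \<inter> {y \<in> S. F y \<in> W'})"
      using openin_continuous_map_preimage[OF F W'(1)] B(1) by auto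
    moreover have "x \<in> B \<inter> {y \<in> S. F y \<in> W'}" using x B W' by auto
    ultimately obtain r where "r > 0" "cball x r \<inter> S \<subseteq> B \<inter> {y \<in> S. F y \<in> W'}"
      by (meson openin_contains_cball)
    then show ?thesis using W W' by (intro exI[of _ r] exI[of _ W] exI[of _ W']) auto
  qed
  then obtain r W W' where rW: "\<And>x. x \<in> S \<Longrightarrow> r x > 0 \<and> cone_fillable A leq Ms (W' x) (W x) \<and> openin M (W' x) \<and>
          (S \<inter> cball x (r x)) \<times> W x \<subseteq> N \<and> F ` (S \<inter> cball x (r x)) \<subseteq> W' x"
    by metis
  obtain D where D: "D \<subseteq> S" "finite D" "S \<subseteq> (\<Union>x\<in>D. ball x (r x))"
  proof (rule compactE_image[OF S, of S "\<lambda>x. ball x (r x)"])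
    show "S \<subseteq> (\<Union>x\<in>S. ball x (r x))" using rW by force
  qed auto
  have "D \<noteq> {}" using D False by auto
  obtain \<delta> where \<delta>: "\<delta> > 0" "\<And>T. \<lbrakk>T \<subseteq> S; diameter T < \<delta>\<rbrakk> \<Longrightarrow> \<exists>B \<in> (\<lambda>x. ball x (r x)) ` D. T \<subseteq> B"
    by (rule Lebesgue_number_lemma[OF S, of "(\<lambda>x. ball x (r x)) ` D"]) (use D \<open>D \<noteq> {}\<close> in auto)
  \<comment> \<open>Closed balls, so that what is removed is a finite union of closed sets; the
    Lebesgue number refers to the open balls.\<close>
  define N' where "N' = N - (\<Union>x\<in>D. (S \<inter> cball x (r x)) \<times> (topspace M - W' x))"
  show ?thesis
  proof
    have "closedin (prod_topology (top_of_set S) M) ((S \<inter> cball x (r x)) \<times> (topspace M - W' x))" if "x \<in> D" for x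
    proof -
      have "closedin M (topspace M - W' x)"
        using rW[of x] D(1) that by blast
      then show ?thesis by (auto simp: closedin_prod_Times_iff closedin_closed_Int)
    qed
    then show "openin (prod_topology (top_of_set S) M) N'"
      unfolding N'_def using N(1) D(2) by (intro openin_diff closedin_Union) auto
    show "(x, F x) \<in> N'" if "x \<in> S" for x
    proof -
      have "F x \<in> W' y" if "y \<in> D" "x \<in> cball y (r y)" for y
        using rW[of y] D(1) that \<open>x \<in> S\<close> by blast
      then show ?thesis using N(2)[OF that] by (auto simp: N'_def)
    qed
    show "N' \<subseteq> N" by (auto simp: N'_def)
    show "\<delta> > 0" by fact
    show "\<exists>W' W. cone_fillable A leq Ms W' W \<and> T \<times> W \<subseteq> N \<and> (\<forall>x\<in>T. \<forall>m. (x, m) \<in> N' \<longrightarrow> m \<in> W')"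
      if T: "T \<subseteq> S" "T \<noteq> {}" "diameter T < \<delta>" for T
    proof -
      obtain x where x: "x \<in> D" "T \<subseteq> ball x (r x)" using \<delta>(2) T by blast
      then have sub: "T \<subseteq> S \<inter> cball x (r x)" using T(1) by force
      have "x \<in> S" using x D by auto
      have "m \<in> W' x" if "y \<in> T" "(y, m) \<in> N'" for y m
      proof -
        have "m \<in> topspace M"
          using openin_subset[OF N(1)] that by (auto simp: N'_def)
        then show ?thesis using that sub x(1) unfolding N'_def by blast
      qed
      moreover have "T \<times> W x \<subseteq> (S \<inter> cball x (r x)) \<times> W x" using sub by (rule Sigma_mono) simp
      then have "T \<times> W x \<subseteq> N" using rW[OF \<open>x \<in> S\<close>] by (elim conjE) (rule subset_trans)
      moreover have "cone_fillable A leq Ms (W' x) (W x)" using rW[OF \<open>x \<in> S\<close>] by simp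
      ultimately show ?thesis by meson
    qed
  qed
qed

section \<open>Extension over a box by coning\<close>

lemma continuous_on_coordinate: "continuous_on S (\<lambda>x::nat \<Rightarrow> real. x i)"
  by (rule continuous_on_subset[OF continuous_on_product_coordinates]) simp

lemma closed_coordinate_eq: "closed {x::nat \<Rightarrow> real. x i = c}"
  by (intro closed_Collect_eq continuous_on_coordinate continuous_on_const)

lemma compact_fun_atLeastAtMost: "compact {a..b :: nat \<Rightarrow> real}"
proof -
  have "{a..b} = PiE UNIV (\<lambda>i. {a i..b i})"
    by (auto simp: PiE_def Pi_def le_fun_def)
  moreover have "compactin (product_topology (\<lambda>i::nat. euclideanreal) UNIV) (PiE UNIV (\<lambda>i. {a i..b i}))"
    by (auto simp: compactin_PiE)
  ultimately show ?thesis
    by (simp add: euclidean_product_topology)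
qed

text \<open>Only coordinates in which the box has positive length count. A degenerate box thus gets
  its relative boundary, and cells of all dimensions are boxes in one and the same space; a single
  point has empty boundary.\<close>

definition box_boundary :: "(nat \<Rightarrow> real) \<Rightarrow> (nat \<Rightarrow> real) \<Rightarrow> (nat \<Rightarrow> real) set" where
  "box_boundary a b = {x \<in> {a..b}. \<exists>i. a i < b i \<and> (x i = a i \<or> x i = b i)}"

lemma box_boundary_subset: "box_boundary a b \<subseteq> {a..b}"
  by (auto simp: box_boundary_def)

lemma compact_box_boundary:
  assumes "finite {i. a i < b i}"
  shows "compact (box_boundary a b)"
proof -
  have "box_boundary a b = {a..b} \<inter> (\<Union>i\<in>{i. a i < b i}. {x. x i = a i} \<union> {x. x i = b i})"
    by (auto simp: box_boundary_def)
  moreover have "closed (\<Union>i\<in>{i. a i < b i}. {x. x i = a i} \<union> {x. x i = b i})"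
    using assms by (intro closed_UN ballI closed_Un closed_coordinate_eq)
  ultimately show ?thesis
    using compact_fun_atLeastAtMost by (simp add: compact_Int_closed)
qed

text \<open>Polar coordinates of the box about its midpoint: s = 0 is the midpoint, s = 1 the
  boundary point itself.\<close>

definition cone_map :: "(nat \<Rightarrow> real) \<Rightarrow> (nat \<Rightarrow> real) \<Rightarrow> real \<times> (nat \<Rightarrow> real) \<Rightarrow> nat \<Rightarrow> real" where
  "cone_map a b = (\<lambda>(s, y) i. (a i + b i) / 2 + s * (y i - (a i + b i) / 2))"

lemma continuous_on_cone_map: "continuous_on S (cone_map a b)"
proof (rule continuous_on_coordinatewise_then_product)
  fix i
  have "continuous_on S (\<lambda>z::real \<times> (nat \<Rightarrow> real). snd z i)"
    by (rule continuous_on_compose2[OF continuous_on_coordinate[of UNIV i] continuous_on_snd[OF continuous_on_id]]) simp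
  then show "continuous_on S (\<lambda>z. cone_map a b z i)"
    unfolding cone_map_def split_def
    by (intro continuous_on_add continuous_on_mult continuous_on_diff continuous_on_const
        continuous_on_fst continuous_on_id)
qed

context
  fixes a b :: "nat \<Rightarrow> real"
  assumes ab: "a \<le> b" and fin: "finite {i. a i < b i}" and ne: "{i. a i < b i} \<noteq> {}"
begin

text \<open>The gauge of the box about its midpoint, taken over the nondegenerate coordinates. On
  the box it is 1 exactly at the boundary, and it recovers the radius s from
  \<open>cone_map\<close>.\<close>

definition box_norm :: "(nat \<Rightarrow> real) \<Rightarrow> real" where
  "box_norm x = Max ((\<lambda>i. 2 * \<bar>x i - (a i + b i) / 2\<bar> / (b i - a i)) ` {i. a i < b i})"

lemma box_norm_ge: "a i < b i \<Longrightarrow> 2 * \<bar>x i - (a i + b i) / 2\<bar> / (b i - a i) \<le> box_norm x"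
  unfolding box_norm_def using fin by (intro Max_ge) auto

lemma box_norm_attained:
  obtains i where "a i < b i" "box_norm x = 2 * \<bar>x i - (a i + b i) / 2\<bar> / (b i - a i)"
proof -
  have "box_norm x \<in> (\<lambda>i. 2 * \<bar>x i - (a i + b i) / 2\<bar> / (b i - a i)) ` {i. a i < b i}"
    unfolding box_norm_def using fin ne by (intro Max_in) auto
  then show thesis using that by blast
qed

lemma box_norm_cone_map:
  assumes y: "y \<in> box_boundary a b" and s: "0 \<le> s"
  shows "box_norm (cone_map a b (s, y)) = s"
proof (rule antisym)
  obtain i where "a i < b i" "box_norm (cone_map a b (s, y)) =
      2 * \<bar>cone_map a b (s, y) i - (a i + b i) / 2\<bar> / (b i - a i)"
    using box_norm_attained by blast
  moreover have "\<bar>cone_map a b (s, y) i - (a i + b i) / 2\<bar> = s * \<bar>y i - (a i + b i) / 2\<bar>"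
    using s by (simp add: cone_map_def abs_mult)
  moreover have "\<bar>y i - (a i + b i) / 2\<bar> \<le> (b i - a i) / 2"
  proof -
    have "a i \<le> y i" "y i \<le> b i" using y by (auto simp: box_boundary_def le_fun_def)
    then show ?thesis by (simp add: abs_le_iff) argo
  qed
  then have "2 * (s * \<bar>y i - (a i + b i) / 2\<bar>) \<le> s * (b i - a i)"
    using s mult_left_mono[of "\<bar>y i - (a i + b i) / 2\<bar>" "(b i - a i) / 2" s] by simp
  ultimately show "box_norm (cone_map a b (s, y)) \<le> s"
    by (simp only: divide_le_eq) simp
next
  obtain i where i: "a i < b i" "y i = a i \<or> y i = b i"
    using y by (auto simp: box_boundary_def)
  then have "\<bar>y i - (a i + b i) / 2\<bar> = (b i - a i) / 2"
    by (auto simp: abs_if field_simps)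
  then have "\<bar>cone_map a b (s, y) i - (a i + b i) / 2\<bar> = s * ((b i - a i) / 2)"
    using s by (simp add: cone_map_def abs_mult)
  then have "2 * \<bar>cone_map a b (s, y) i - (a i + b i) / 2\<bar> / (b i - a i) = s"
    using i(1) by (simp only:) simp
  then show "s \<le> box_norm (cone_map a b (s, y))"
    using box_norm_ge[OF i(1), of "cone_map a b (s, y)"] by simp
qed

text \<open>The radius is read off by \<open>box_norm\<close>, and a positive radius can be divided
  out. Hence the level s = 0 is the only one that collapses, which determines the fibres in
  \<open>extend_over_box\<close>.\<close>

lemma cone_map_inj:
  assumes "y \<in> box_boundary a b" "y' \<in> box_boundary a b" "0 \<le> s" "0 \<le> s'"
    and eq: "cone_map a b (s, y) = cone_map a b (s', y')"
  shows "s = s'" "s = 0 \<or> y = y'"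
proof -
  show s: "s = s'"
    using box_norm_cone_map assms by metis
  have "s * (y i - (a i + b i) / 2) = s * (y' i - (a i + b i) / 2)" for i
    using fun_cong[OF eq, of i] s by (simp add: cone_map_def)
  then show "s = 0 \<or> y = y'" by (auto simp: fun_eq_iff)
qed

lemma image_cone_map: "cone_map a b ` ({0..1} \<times> box_boundary a b) = {a..b}"
proof
  have "cone_map a b (s, y) \<in> {a..b}" if "s \<in> {0..1}" "y \<in> {a..b}" for s y
  proof -
    have "a i \<le> cone_map a b (s, y) i \<and> cone_map a b (s, y) i \<le> b i" for i
    proof -
      have "cone_map a b (s, y) i = (1 - s) * ((a i + b i) / 2) + s * y i"
      proof -
        have "m + s * (z - m) = (1 - s) * m + s * z" for m z :: real
          by (simp add: algebra_simps)
        then show ?thesis by (simp add: cone_map_def)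
      qed
      moreover have "(a i + b i) / 2 \<in> {a i..b i}" "y i \<in> {a i..b i}"
        using that ab by (auto simp: le_fun_def field_simps)
      ultimately show ?thesis
        using convexD[OF convex_closed_interval[of "a i" "b i"], of "(a i + b i) / 2" "y i" "1 - s" s] that
        by auto
    qed
    then show ?thesis by (auto simp: le_fun_def)
  qed
  then show "cone_map a b ` ({0..1} \<times> box_boundary a b) \<subseteq> {a..b}"
    using box_boundary_subset by blast
  show "{a..b} \<subseteq> cone_map a b ` ({0..1} \<times> box_boundary a b)"
  proof
    fix x assume "x \<in> {a..b}"
    then have x: "\<And>i. a i \<le> x i" "\<And>i. x i \<le> b i" by (auto simp: le_fun_def)
    obtain j where j: "a j < b j" "box_norm x = 2 * \<bar>x j - (a j + b j) / 2\<bar> / (b j - a j)"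
      using box_norm_attained by blast
    define s where "s = box_norm x"
    have s0: "0 \<le> s" using j by (simp add: s_def)
    have "\<bar>x j - (a j + b j) / 2\<bar> \<le> (b j - a j) / 2"
      using x[of j] by (auto simp: abs_le_iff field_simps)
    then have "2 * \<bar>x j - (a j + b j) / 2\<bar> \<le> b j - a j" by simp
    then have s1: "s \<le> 1" using j(1) by (simp only: s_def j(2) divide_le_eq) simp
    have le: "\<bar>x i - (a i + b i) / 2\<bar> \<le> s * ((b i - a i) / 2)" for i
    proof (cases "a i < b i")
      case True
      then show ?thesis using box_norm_ge[OF True, of x] by (simp add: s_def field_simps)
    next
      case False
      then have "a i = b i" using ab by (auto simp: le_fun_def intro: antisym)
      then show ?thesis using x[of i] by auto
    qed
    show "x \<in> cone_map a b ` ({0..1} \<times> box_boundary a b)"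
    proof (cases "s = 0")
      case True
      then have "x i = (a i + b i) / 2" for i using le[of i] by simp
      \<comment> \<open>The midpoint arises from every boundary point; the corner \<open>b\<close>
        is one of them.\<close>
      then have "x = cone_map a b (0, b)" by (auto simp: cone_map_def fun_eq_iff)
      moreover have "b \<in> box_boundary a b" using ab j(1) by (auto simp: box_boundary_def)
      ultimately show ?thesis by auto
    next
      case False
      with s0 have s: "s > 0" by simp
      \<comment> \<open>Radial projection of \<open>x\<close> from the midpoint to the
        boundary.\<close>
      define y where "y = (\<lambda>i. (a i + b i) / 2 + (x i - (a i + b i) / 2) / s)"
      have y: "\<bar>y i - (a i + b i) / 2\<bar> \<le> (b i - a i) / 2" for i
        using le[of i] s by (simp add: y_def field_simps)
      have yj: "\<bar>y j - (a j + b j) / 2\<bar> = (b j - a j) / 2"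
      proof -
        have "\<bar>x j - (a j + b j) / 2\<bar> = s * ((b j - a j) / 2)"
          using j by (simp add: s_def)
        then show ?thesis using s by (simp add: y_def)
      qed
      have "y j = a j \<or> y j = b j"
        using yj by (auto simp: abs_if field_simps split: if_splits)
      moreover have "a i \<le> y i \<and> y i \<le> b i" for i
        using y[of i] by (auto simp: abs_le_iff field_simps)
      ultimately have "y \<in> box_boundary a b"
        using j(1) by (auto simp: box_boundary_def le_fun_def)
      moreover have "x = cone_map a b (s, y)"
        using s by (auto simp: cone_map_def y_def fun_eq_iff)
      ultimately show ?thesis using s s1 by auto
    qed
  qed
qed

text \<open>The box is the cone over its boundary: \<open>cone_map\<close> is a quotient map, being
  a continuous surjection from a compact space onto a Hausdorff space. Following \<open>g\<close> by
  the contraction \<open>h\<close> gives a map that is constant on the collapsed level, since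
  \<open>h\<close> ends in the single point \<open>y0\<close>, and so descends to the box.\<close>

lemma extend_over_box:
  assumes g: "continuous_map (top_of_set (box_boundary a b)) X g"
    and h: "continuous_map (prod_topology (top_of_set {0..1::real}) (subtopology X (g ` box_boundary a b))) Y h"
    and h1: "\<And>x. x \<in> g ` box_boundary a b \<Longrightarrow> h (1, x) = x"
    and h0: "\<And>x. x \<in> g ` box_boundary a b \<Longrightarrow> h (0, x) = y0"
    and hW: "h ` ({0..1} \<times> g ` box_boundary a b) \<subseteq> W"
  obtains G where "continuous_map (top_of_set {a..b}) Y G" "\<And>x. x \<in> box_boundary a b \<Longrightarrow> G x = g x"
    "G ` {a..b} \<subseteq> W"
proof -
  let ?B = "box_boundary a b"
  let ?Z = "top_of_set ({0..1::real} \<times> ?B)"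
  have q: "quotient_map ?Z (top_of_set {a..b}) (cone_map a b)"
  proof (rule T1_Spaces.continuous_imp_quotient_map)
    show "continuous_map ?Z (top_of_set {a..b}) (cone_map a b)"
      using image_cone_map continuous_on_cone_map by (auto simp: continuous_map_subtopology_eu)
    show "compact_space ?Z"
      using compact_Times[OF compact_Icc compact_box_boundary[OF fin], of 0 1]
      by (simp add: compact_space_subtopology)
    show "Hausdorff_space (top_of_set {a..b})"
      by (simp add: Hausdorff_space_subtopology)
    show "cone_map a b ` topspace ?Z = topspace (top_of_set {a..b})"
      using image_cone_map by simp
  qed
  define k where "k = (\<lambda>z. h (fst z, g (snd z)))"
  have "continuous_map ?Z Y k"
  proof -
    have "continuous_map ?Z (top_of_set {0..1}) fst" "continuous_map ?Z (top_of_set ?B) snd"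
      by (auto simp: continuous_map_subtopology_eu intro: continuous_intros)
    moreover have "continuous_map (top_of_set ?B) (subtopology X (g ` ?B)) g"
      using g by (simp add: continuous_map_in_subtopology)
    ultimately have "continuous_map ?Z (prod_topology (top_of_set {0..1::real}) (subtopology X (g ` ?B)))
        (\<lambda>z. (fst z, g (snd z)))"
      using continuous_map_compose[of ?Z "top_of_set ?B" snd _ g] by (auto simp: continuous_map_pairedI o_def)
    from continuous_map_compose[OF this h] show ?thesis by (simp add: k_def o_def)
  qed
  moreover have "k z = k z'" if "z \<in> topspace ?Z" "z' \<in> topspace ?Z" "cone_map a b z = cone_map a b z'" for z z'
  proof -
    obtain s y s' y' where z: "z = (s, y)" "z' = (s', y')" by (metis surj_pair)
    then have "s = s'" "s = 0 \<or> y = y'"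
      using cone_map_inj[of y y' s s'] that by auto
    then show ?thesis using that z h0 by (auto simp: k_def)
  qed
  ultimately obtain G where G: "continuous_map (top_of_set {a..b}) Y G"
    "G ` {a..b} = k ` ({0..1} \<times> ?B)" "\<And>z. z \<in> {0..1} \<times> ?B \<Longrightarrow> G (cone_map a b z) = k z"
    using quotient_map_lift_exists[OF q, of Y k] by (smt (verit, best) topspace_euclidean_subtopology)
  show thesis
  proof
    show "continuous_map (top_of_set {a..b}) Y G" by fact
    show "G x = g x" if "x \<in> ?B" for x
      using G(3)[of "(1, x)"] that h1 by (auto simp: k_def cone_map_def)
    show "G ` {a..b} \<subseteq> W" using G(2) hW by (auto simp: k_def)
  qed
qed

end

section \<open>Subdivision of boxes\<close>

lemma continuous_map_paste:
  fixes S T :: "'b::topological_space set"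
  assumes ST: "closed S" "closed T"
    and f: "continuous_map (top_of_set S) X f" and g: "continuous_map (top_of_set T) X g"
    and eq: "\<And>x. x \<in> S \<Longrightarrow> x \<in> T \<Longrightarrow> f x = g x"
  shows "continuous_map (top_of_set (S \<union> T)) X (\<lambda>x. if x \<in> S then f x else g x)"
proof (rule pasting_lemma_closed[where I = UNIV and T = "\<lambda>c. if c then S else T" and f = "\<lambda>c. if c then f else g"])
  show "closedin (top_of_set (S \<union> T)) (if c then S else T)" for c
    using ST closed_subset[of S "S \<union> T"] closed_subset[of T "S \<union> T"] by auto
  show "continuous_map (subtopology (top_of_set (S \<union> T)) (if c then S else T)) X (if c then f else g)" for c
    using f g by (auto simp: subtopology_subtopology Int_absorb1)
  show "\<exists>c. c \<in> UNIV \<and> x \<in> (if c then S else T) \<and>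
          (if x \<in> S then f x else g x) = (if c then f else g) x"
    if "x \<in> topspace (top_of_set (S \<union> T))" for x
    using that by (intro exI[of _ "x \<in> S"]) auto
qed (use eq in \<open>auto split: if_splits\<close>)

text \<open>Coordinates enter the metric with weights 1, 1/2, 1/4 and so on, whose sum is 2.\<close>

lemma dist_fun_le:
  fixes x y :: "nat \<Rightarrow> real"
  assumes "\<And>i. \<bar>x i - y i\<bar> \<le> e"
  shows "dist x y \<le> 2 * e"
proof -
  have "dist x y = (\<Sum>n. (1/2)^n * min (dist (x (from_nat n)) (y (from_nat n))) 1)"
    by (rule dist_fun_def)
  also have "\<dots> \<le> (\<Sum>n. (1/2)^n * e)"
  proof (rule suminf_le)
    show "(1/2)^n * min (dist (x (from_nat n)) (y (from_nat n))) 1 \<le> (1/2)^n * e" for n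
      using assms[of "from_nat n"] by (intro mult_left_mono) (auto simp: dist_real_def)
    show "summable (\<lambda>n. (1/2)^n * min (dist (x (from_nat n)) (y (from_nat n))) 1)"
      by (rule summable_comparison_test'[of "\<lambda>n. (1/2)^n"]) (auto simp: summable_geometric_iff)
    show "summable (\<lambda>n. (1/2)^n * e)"
      by (intro summable_mult2) (simp add: summable_geometric_iff)
  qed
  also have "\<dots> = 2 * e"
    using suminf_mult2[of "\<lambda>n. (1/2::real)^n" e] suminf_geometric[of "1/2::real"]
    by (simp add: summable_geometric_iff)
  finally show ?thesis .
qed

lemma diameter_box_le:
  fixes a b :: "nat \<Rightarrow> real"
  assumes "\<And>i. b i - a i \<le> e" "0 \<le> e"
  shows "diameter {a..b} \<le> 2 * e"
proof -
  have "dist x y \<le> 2 * e" if "x \<in> {a..b}" "y \<in> {a..b}" for x y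
  proof (rule dist_fun_le)
    fix i
    have "a i \<le> x i" "x i \<le> b i" "a i \<le> y i" "y i \<le> b i" using that by (auto simp: le_fun_def)
    then show "\<bar>x i - y i\<bar> \<le> e" using assms(1)[of i] by linarith
  qed
  then show ?thesis
    unfolding diameter_def using assms(2) by (auto intro!: cSUP_least)
qed

lemma box_upper_upd:
  fixes a b :: "nat \<Rightarrow> real"
  assumes "c \<le> b i"
  shows "{a..b(i := c)} = {x \<in> {a..b}. x i \<le> c}"
proof (intro equalityI subsetI)
  fix x assume x: "x \<in> {a..b(i := c)}"
  then have "x j \<le> (b(i := c)) j" for j by (simp add: le_fun_def)
  then have "x j \<le> b j" "x i \<le> c" for j using assms by (metis fun_upd_other fun_upd_same order_trans)+
  then show "x \<in> {x \<in> {a..b}. x i \<le> c}" using x by (simp add: le_fun_def)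
qed (auto simp: le_fun_def)

lemma box_lower_upd:
  fixes a b :: "nat \<Rightarrow> real"
  assumes "a i \<le> c"
  shows "{a(i := c)..b} = {x \<in> {a..b}. c \<le> x i}"
proof (intro equalityI subsetI)
  fix x assume x: "x \<in> {a(i := c)..b}"
  then have "(a(i := c)) j \<le> x j" for j by (simp add: le_fun_def)
  then have "a j \<le> x j" "c \<le> x i" for j using assms by (metis fun_upd_other fun_upd_same order_trans)+
  then show "x \<in> {x \<in> {a..b}. c \<le> x i}" using x by (simp add: le_fun_def)
qed (auto simp: le_fun_def)

section \<open>Boxes of any dimension with corners on the grid of mesh 1/N\<close>

definition grid_box :: "nat \<Rightarrow> nat \<Rightarrow> (nat \<Rightarrow> real) \<Rightarrow> (nat \<Rightarrow> real) \<Rightarrow> bool" where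
  "grid_box k N a b \<longleftrightarrow> a \<le> b \<and> (\<forall>i<k. of_nat N * a i \<in> \<int> \<and> of_nat N * b i \<in> \<int>) \<and> (\<forall>i\<ge>k. a i = b i)"

definition off_grid :: "nat \<Rightarrow> nat \<Rightarrow> (nat \<Rightarrow> real) \<Rightarrow> nat" where
  "off_grid k N x = card {i. i < k \<and> of_nat N * x i \<notin> \<int>}"

lemma grid_box_finite: "grid_box k N a b \<Longrightarrow> finite {i. a i < b i}"
  by (rule finite_subset[of _ "{..<k}"]) (auto simp: grid_box_def not_less[symmetric])

text \<open>The ends of a side are grid points, and a side of at most one grid unit has no grid
  point strictly between them.\<close>

lemma grid_cell_coordinate:
  assumes N: "N > 0" and Q: "grid_box k N a b" and small: "of_nat N * (b i - a i) \<le> 1"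
    and x: "x \<in> {a..b}" and i: "i < k"
  shows "of_nat N * x i \<notin> \<int> \<longleftrightarrow> a i < x i \<and> x i < b i"
proof
  have ax: "a i \<le> x i" "x i \<le> b i" using x by (auto simp: le_fun_def)
  show "a i < x i \<and> x i < b i" if "of_nat N * x i \<notin> \<int>"
    using that Q i ax unfolding grid_box_def by (metis order_less_le)
  show "of_nat N * x i \<notin> \<int>" if ab: "a i < x i \<and> x i < b i"
  proof
    assume "of_nat N * x i \<in> \<int>"
    then obtain m where m: "of_nat N * x i = of_int m" by (auto elim: Ints_cases)
    obtain n where n: "of_nat N * a i = of_int n"
      using Q i unfolding grid_box_def by (metis Ints_cases)
    have "of_nat N * a i < of_nat N * x i" "of_nat N * x i < of_nat N * b i"
      using ab N by auto
    then have "real_of_int n < of_int m" "real_of_int m < of_int n + 1"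
      using small by (auto simp: m n right_diff_distrib)
    then have "real_of_int n < of_int m" "real_of_int m < of_int (n + 1)" by simp_all
    then show False unfolding of_int_less_iff by simp
  qed
qed

text \<open>In the interior of a cell all nondegenerate coordinates are off the grid; at the
  boundary at least one of them is on it. So the control prescribed on the boundary of a cell always
  belongs to smaller dimensions than the control demanded inside.\<close>

lemma off_grid_cell:
  assumes N: "N > 0" and Q: "grid_box k N a b" and small: "\<And>i. i < k \<Longrightarrow> of_nat N * (b i - a i) \<le> 1"
    and x: "x \<in> {a..b}"
  shows "x \<in> box_boundary a b \<Longrightarrow> off_grid k N x < card {i. a i < b i}"
    and "x \<notin> box_boundary a b \<Longrightarrow> off_grid k N x = card {i. a i < b i}"
proof -
  have le: "a j \<le> x j" "x j \<le> b j" for j using x by (auto simp: le_fun_def)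
  have eq: "{i. i < k \<and> of_nat N * x i \<notin> \<int>} = {i. i < k \<and> a i < x i \<and> x i < b i}"
    using grid_cell_coordinate[OF N Q small x] by blast
  have k: "a i < b i \<Longrightarrow> i < k" for i
    using Q by (metis grid_box_def less_irrefl not_less)
  have sub: "{i. i < k \<and> a i < x i \<and> x i < b i} \<subseteq> {i. a i < b i}" by auto
  show "off_grid k N x < card {i. a i < b i}" if "x \<in> box_boundary a b"
    unfolding off_grid_def eq
  proof (rule psubset_card_mono[OF grid_box_finite[OF Q]])
    have "\<exists>i. a i < b i \<and> (x i = a i \<or> x i = b i)" using that by (auto simp: box_boundary_def)
    then obtain i where "a i < b i" "x i = a i \<or> x i = b i" by blast
    then have "i \<in> {i. a i < b i}" "i \<notin> {i. i < k \<and> a i < x i \<and> x i < b i}" by auto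
    then show "{i. i < k \<and> a i < x i \<and> x i < b i} \<subset> {i. a i < b i}"
      using sub by (metis psubsetI)
  qed
  show "off_grid k N x = card {i. a i < b i}" if "x \<notin> box_boundary a b"
  proof -
    have "a i < x i \<and> x i < b i" if "a i < b i" for i
    proof -
      have "x i \<noteq> a i" "x i \<noteq> b i"
        using \<open>x \<notin> box_boundary a b\<close> x that unfolding box_boundary_def by blast+
      then show ?thesis using le[of i] by simp
    qed
    then have "{i. i < k \<and> a i < x i \<and> x i < b i} = {i. a i < b i}"
      using k sub by blast
    then show ?thesis unfolding off_grid_def eq by simp
  qed
qed

lemma dense_directed_family_mono:
  assumes "dense_directed_family M A leq Ms" "\<alpha> \<in> A" "\<beta> \<in> A" "leq \<alpha> \<beta>"
  shows "continuous_map X (Ms \<alpha>) f \<Longrightarrow> continuous_map X (Ms \<beta>) f"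
  using assms continuous_map_compose[of X "Ms \<alpha>" f "Ms \<beta>" id] by (auto simp: dense_directed_family_def)

text \<open>The control demanded at \<open>x\<close> depends on the dimension \<open>off_grid k N x\<close> of the open grid cell
  containing \<open>x\<close>. It therefore survives cutting a box along a grid hyperplane and filling the cut
  first, which makes an induction on the number of cells possible.\<close>

lemma fill_grid_box:
  fixes P :: "nat \<Rightarrow> ((nat \<Rightarrow> real) \<times> 'a) set"
  assumes fam: "dense_directed_family M A leq Ms" and N: "N > 0"
    and mono: "\<And>j. P j \<subseteq> P (Suc j)"
    and dense: "\<And>x. x \<in> S \<Longrightarrow> \<exists>m\<in>directed_union A Ms. (x, m) \<in> P 0"
    and step: "\<And>j a b. \<lbrakk>grid_box k N a b; {a..b} \<subseteq> S; \<And>i. i < k \<Longrightarrow> of_nat N * (b i - a i) \<le> 1;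
        card {i. a i < b i} = Suc j\<rbrakk> \<Longrightarrow>
      \<exists>W' W. cone_fillable A leq Ms W' W \<and> {a..b} \<times> W \<subseteq> P (Suc j) \<and>
             (\<forall>x\<in>{a..b}. \<forall>m. (x, m) \<in> P j \<longrightarrow> m \<in> W')"
  shows "\<lbrakk>grid_box k N a b; {a..b} \<subseteq> S; \<alpha> \<in> A; continuous_map (top_of_set (box_boundary a b)) (Ms \<alpha>) g;
      \<And>x. x \<in> box_boundary a b \<Longrightarrow> (x, g x) \<in> P (off_grid k N x)\<rbrakk> \<Longrightarrow>
    \<exists>\<beta>\<in>A. leq \<alpha> \<beta> \<and> (\<exists>G. continuous_map (top_of_set {a..b}) (Ms \<beta>) G \<and>
      (\<forall>x\<in>box_boundary a b. G x = g x) \<and> (\<forall>x\<in>{a..b}. (x, G x) \<in> P (off_grid k N x)))"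
\<comment> \<open>The sum of the side lengths in grid units stands in for the number of cells: it
  drops for both halves of a cut box and also for the cut itself, whose length in the cutting
  direction is 0.\<close>
proof (induction "\<Sum>i<k. nat \<lfloor>of_nat N * (b i - a i)\<rfloor>" arbitrary: a b \<alpha> g rule: less_induct)
  case less
  note Q = less.prems(1) and QS = less.prems(2) and \<alpha> = less.prems(3) and g = less.prems(4,5)
  have ab: "a \<le> b" using Q by (simp add: grid_box_def)
  have dir: "directed_set A leq" and trans: "transp_on A leq"
    using fam by (auto simp: dense_directed_family_def directed_set_def)
  show ?case
  proof (cases "\<exists>i<k. of_nat N * (b i - a i) > 1")
    case True
    then obtain i where i: "i < k" "of_nat N * (b i - a i) > 1" by blast
    \<comment> \<open>The first grid hyperplane inside the box; it splits off a slab one grid unit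
      thick.\<close>
    define c where "c = a i + 1 / of_nat N"
    have Nc: "of_nat N * c = of_nat N * a i + 1" using N by (simp add: c_def distrib_left)
    have ac: "a i < c" using N by (simp add: c_def)
    have cb: "c < b i"
    proof -
      have "of_nat N * c < of_nat N * b i" using i(2) by (simp add: Nc right_diff_distrib)
      then show ?thesis using N by simp
    qed
    have NcZ: "of_nat N * c \<in> \<int>" using Q i(1) by (simp add: Nc grid_box_def)
    let ?b1 = "b(i := c)" and ?a2 = "a(i := c)"
    define D where "D = {?a2..?b1}"
    have Q1: "grid_box k N a ?b1" and Q2: "grid_box k N ?a2 b" and QD: "grid_box k N ?a2 ?b1"
      using Q i(1) ac cb NcZ by (auto simp: grid_box_def le_fun_def)
    have box1: "{a..?b1} = {x \<in> {a..b}. x i \<le> c}" and box2: "{?a2..b} = {x \<in> {a..b}. c \<le> x i}"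
      using ac cb by (simp_all add: box_upper_upd box_lower_upd)
    have "D = {x \<in> {?a2..b}. x i \<le> c}"
      unfolding D_def using cb by (intro box_upper_upd) simp
    then have D: "D = {x \<in> {a..b}. x i = c}"
      unfolding box2 by auto
    have sub: "{a..?b1} \<subseteq> {a..b}" "{?a2..b} \<subseteq> {a..b}" "D \<subseteq> {a..b}"
      and Un: "{a..b} = {a..?b1} \<union> {?a2..b}" and Int: "{a..?b1} \<inter> {?a2..b} = D"
      unfolding box1 box2 D by auto
    have measure: "(\<Sum>j<k. nat \<lfloor>of_nat N * (b' j - a' j)\<rfloor>) < (\<Sum>j<k. nat \<lfloor>of_nat N * (b j - a j)\<rfloor>)"
      if "\<And>j. j \<noteq> i \<Longrightarrow> a' j = a j \<and> b' j = b j" "of_nat N * (b' i - a' i) \<le> of_nat N * (b i - a i) - 1" for a' b'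
    proof (rule sum_strict_mono_ex1)
      have lt: "nat \<lfloor>of_nat N * (b' i - a' i)\<rfloor> < nat \<lfloor>of_nat N * (b i - a i)\<rfloor>"
        using that(2) i(2) by linarith
      then show "\<exists>j\<in>{..<k}. nat \<lfloor>of_nat N * (b' j - a' j)\<rfloor> < nat \<lfloor>of_nat N * (b j - a j)\<rfloor>"
        using i(1) by blast
      show "\<forall>j\<in>{..<k}. nat \<lfloor>of_nat N * (b' j - a' j)\<rfloor> \<le> nat \<lfloor>of_nat N * (b j - a j)\<rfloor>"
        using lt that(1) by (metis order_less_imp_le order_refl)
    qed simp
    \<comment> \<open>Here integrality enters: the side length in grid units is an integer above 1,
      hence at least 2, so the slab of thickness 1 is shorter by at least one unit.\<close>
    have m1: "of_nat N * (?b1 i - a i) \<le> of_nat N * (b i - a i) - 1"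
    proof -
      obtain p q where "of_nat N * a i = of_int p" "of_nat N * b i = of_int q"
        using Q i(1) unfolding grid_box_def by (metis Ints_cases)
      moreover from this i(2) have "q - p > 1" by (simp add: right_diff_distrib)
      ultimately show ?thesis by (simp add: right_diff_distrib Nc)
    qed
    have m2: "of_nat N * (b i - ?a2 i) \<le> of_nat N * (b i - a i) - 1"
      by (simp add: right_diff_distrib Nc)
    have mD: "of_nat N * (?b1 i - ?a2 i) \<le> of_nat N * (b i - a i) - 1"
      using i(2) by simp
    have LD: "(\<Sum>j<k. nat \<lfloor>of_nat N * (?b1 j - ?a2 j)\<rfloor>) < (\<Sum>j<k. nat \<lfloor>of_nat N * (b j - a j)\<rfloor>)"
      by (rule measure[of ?a2 ?b1, OF _ mD]) simp
    have L1: "(\<Sum>j<k. nat \<lfloor>of_nat N * (?b1 j - a j)\<rfloor>) < (\<Sum>j<k. nat \<lfloor>of_nat N * (b j - a j)\<rfloor>)"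
      by (rule measure[of a ?b1, OF _ m1]) simp
    have L2: "(\<Sum>j<k. nat \<lfloor>of_nat N * (b j - ?a2 j)\<rfloor>) < (\<Sum>j<k. nat \<lfloor>of_nat N * (b j - a j)\<rfloor>)"
      by (rule measure[of ?a2 b, OF _ m2]) simp
    \<comment> \<open>The cut has length 0 in direction \<open>i\<close>, so \<open>i\<close>
      contributes nothing to its relative boundary; in all other directions its sides are those of
      the whole box.\<close>
    have bdD: "box_boundary ?a2 ?b1 \<subseteq> box_boundary a b"
    proof
      fix x assume x: "x \<in> box_boundary ?a2 ?b1"
      then obtain j where "?a2 j < ?b1 j" "x j = ?a2 j \<or> x j = ?b1 j" by (auto simp: box_boundary_def)
      moreover from this have "j \<noteq> i" by auto
      ultimately show "x \<in> box_boundary a b"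
        using x box_boundary_subset sub(3) unfolding D_def by (auto simp: box_boundary_def)
    qed
    have D_bd: "D \<inter> box_boundary a b \<subseteq> box_boundary ?a2 ?b1"
    proof
      fix x assume x: "x \<in> D \<inter> box_boundary a b"
      then obtain j where j: "a j < b j" "x j = a j \<or> x j = b j" by (auto simp: box_boundary_def)
      have "x i = c" using x by (simp add: D)
      then have "j \<noteq> i" using j ac cb by auto
      then show "x \<in> box_boundary ?a2 ?b1"
        using x j unfolding D_def box_boundary_def by auto
    qed
    have gD: "continuous_map (top_of_set (box_boundary ?a2 ?b1)) (Ms \<alpha>) g"
      using g(1) bdD continuous_map_from_subtopology_mono by blast
    have gP: "(x, g x) \<in> P (off_grid k N x)" if "x \<in> box_boundary ?a2 ?b1" for x
      using g(2) bdD that by blast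
    obtain \<beta>1 hD where \<beta>1: "\<beta>1 \<in> A" "leq \<alpha> \<beta>1"
      and hD: "continuous_map (top_of_set D) (Ms \<beta>1) hD" "\<And>x. x \<in> box_boundary ?a2 ?b1 \<Longrightarrow> hD x = g x"
        "\<And>x. x \<in> D \<Longrightarrow> (x, hD x) \<in> P (off_grid k N x)"
      using less.hyps[OF LD QD _ \<alpha> gD gP, folded D_def, OF subset_trans[OF sub(3) QS]] by blast
    \<comment> \<open>The cut together with the old boundary contains the boundary of either half.
      The overlap of the two lies in the relative boundary of the cut, where \<open>hD\<close> was
      required to agree with \<open>g\<close>.\<close>
    define g' where "g' = (\<lambda>x. if x \<in> D then hD x else g x)"
    have cl: "closed D" "closed {a..?b1}" "closed {?a2..b}" "closed (box_boundary a b)"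
      using compact_fun_atLeastAtMost compact_box_boundary[OF grid_box_finite[OF Q]] compact_imp_closed
      by (auto simp: D_def)
    have g': "continuous_map (top_of_set (D \<union> box_boundary a b)) (Ms \<beta>1) g'"
      unfolding g'_def
    proof (rule continuous_map_paste[OF cl(1) cl(4) hD(1)])
      show "continuous_map (top_of_set (box_boundary a b)) (Ms \<beta>1) g"
        using dense_directed_family_mono[OF fam \<alpha> \<beta>1] g(1) by blast
      show "hD x = g x" if "x \<in> D" "x \<in> box_boundary a b" for x
        using hD(2) D_bd that by blast
    qed
    have g'_g: "g' x = g x" if "x \<in> box_boundary a b" for x
      using that D_bd hD(2) by (auto simp: g'_def)
    have g'_P: "(x, g' x) \<in> P (off_grid k N x)" if "x \<in> D \<union> box_boundary a b" for x
      using that hD(3) g(2) by (auto simp: g'_def)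
    have bd1: "box_boundary a ?b1 \<subseteq> D \<union> box_boundary a b"
    proof
      fix x assume x: "x \<in> box_boundary a ?b1"
      then obtain j where j: "a j < ?b1 j" "x j = a j \<or> x j = ?b1 j" by (auto simp: box_boundary_def)
      have xQ: "x \<in> {a..?b1}" using x box_boundary_subset by blast
      show "x \<in> D \<union> box_boundary a b"
      proof (cases "x i = c")
        case True
        then have "x \<in> D" using xQ unfolding box1 box2 D by simp
        then show ?thesis by simp
      next
        case False
        then have "a j < b j \<and> (x j = a j \<or> x j = b j)" using j ac cb by (cases "j = i") auto
        then show ?thesis using xQ sub(1) by (auto simp: box_boundary_def)
      qed
    qed
    have bd2: "box_boundary ?a2 b \<subseteq> D \<union> box_boundary a b"
    proof
      fix x assume x: "x \<in> box_boundary ?a2 b"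
      then obtain j where j: "?a2 j < b j" "x j = ?a2 j \<or> x j = b j" by (auto simp: box_boundary_def)
      have xQ: "x \<in> {?a2..b}" using x box_boundary_subset by blast
      show "x \<in> D \<union> box_boundary a b"
      proof (cases "x i = c")
        case True
        then have "x \<in> D" using xQ unfolding box1 box2 D by simp
        then show ?thesis by simp
      next
        case False
        then have "a j < b j \<and> (x j = a j \<or> x j = b j)" using j ac cb by (cases "j = i") auto
        then show ?thesis using xQ sub(2) by (auto simp: box_boundary_def)
      qed
    qed
    \<comment> \<open>The cut is a face of both halves, so both fillings restrict to
      \<open>g'\<close> on it and can be pasted.\<close>
    have D_bd1: "D \<subseteq> box_boundary a ?b1" "D \<subseteq> box_boundary ?a2 b"
    proof -
      have "x i = c" if "x \<in> D" for x
        using that by (simp add: D)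
      moreover have "D \<subseteq> {a..?b1}" "D \<subseteq> {?a2..b}" using Int by auto
      ultimately show "D \<subseteq> box_boundary a ?b1" "D \<subseteq> box_boundary ?a2 b"
        using ac cb unfolding box_boundary_def by (auto intro!: exI[of _ i])
    qed
    have g'1: "continuous_map (top_of_set (box_boundary a ?b1)) (Ms \<beta>1) g'"
      using g' bd1 continuous_map_from_subtopology_mono by blast
    obtain \<beta>2 G1 where \<beta>2: "\<beta>2 \<in> A" "leq \<beta>1 \<beta>2"
      and G1: "continuous_map (top_of_set {a..?b1}) (Ms \<beta>2) G1" "\<And>x. x \<in> box_boundary a ?b1 \<Longrightarrow> G1 x = g' x"
        "\<And>x. x \<in> {a..?b1} \<Longrightarrow> (x, G1 x) \<in> P (off_grid k N x)"
      using less.hyps[OF L1 Q1 subset_trans[OF sub(1) QS] \<beta>1(1) g'1 g'_P[OF subsetD[OF bd1]]] by blast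
    \<comment> \<open>The second half starts from the stage reached by the first, so that the final
      stage \<open>\<beta>3\<close> serves both.\<close>
    have g'2: "continuous_map (top_of_set (box_boundary ?a2 b)) (Ms \<beta>2) g'"
      using g' bd2 continuous_map_from_subtopology_mono dense_directed_family_mono[OF fam \<beta>1(1) \<beta>2] by blast
    obtain \<beta>3 G2 where \<beta>3: "\<beta>3 \<in> A" "leq \<beta>2 \<beta>3"
      and G2: "continuous_map (top_of_set {?a2..b}) (Ms \<beta>3) G2" "\<And>x. x \<in> box_boundary ?a2 b \<Longrightarrow> G2 x = g' x"
        "\<And>x. x \<in> {?a2..b} \<Longrightarrow> (x, G2 x) \<in> P (off_grid k N x)"
      using less.hyps[OF L2 Q2 subset_trans[OF sub(2) QS] \<beta>2(1) g'2 g'_P[OF subsetD[OF bd2]]] by blast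
    define G where "G = (\<lambda>x. if x \<in> {a..?b1} then G1 x else G2 x)"
    have contG: "continuous_map (top_of_set {a..b}) (Ms \<beta>3) G"
      unfolding G_def Un
    proof (rule continuous_map_paste[OF cl(2,3) _ G2(1)])
      show "continuous_map (top_of_set {a..?b1}) (Ms \<beta>3) G1"
        using dense_directed_family_mono[OF fam \<beta>2(1) \<beta>3] G1(1) by blast
      show "G1 x = G2 x" if "x \<in> {a..?b1}" "x \<in> {?a2..b}" for x
        using that Int D_bd1 G1(2) G2(2) by (metis IntI subset_iff)
    qed
    have G_g: "G x = g x" if x: "x \<in> box_boundary a b" for x
    proof -
      obtain j where j: "a j < b j" "x j = a j \<or> x j = b j" using x by (auto simp: box_boundary_def)
      have "x \<in> {a..b}" using x box_boundary_subset by blast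
      show ?thesis
      proof (cases "x \<in> {a..?b1}")
        case True
        then have "x i \<le> c" unfolding box1 box2 by simp
        then have "a j < ?b1 j \<and> (x j = a j \<or> x j = ?b1 j)" using j ac cb by (cases "j = i") auto
        then have "x \<in> box_boundary a ?b1" using True unfolding box_boundary_def by blast
        then show ?thesis using True G1(2) g'_g[OF x] by (simp add: G_def)
      next
        case False
        then have x2: "x \<in> {?a2..b}" using Un \<open>x \<in> {a..b}\<close> by blast
        then have "c \<le> x i" unfolding box1 box2 by simp
        then have "?a2 j < b j \<and> (x j = ?a2 j \<or> x j = b j)" using j ac cb by (cases "j = i") auto
        then have "x \<in> box_boundary ?a2 b" using x2 unfolding box_boundary_def by blast
        moreover have "G x = G2 x" unfolding G_def using False by (rule if_not_P)
        ultimately show ?thesis using G2(2) g'_g[OF x] by simp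
      qed
    qed
    have G_P: "(x, G x) \<in> P (off_grid k N x)" if "x \<in> {a..b}" for x
      using that Un G1(3) G2(3) unfolding G_def by (metis UnE)
    have "leq \<alpha> \<beta>3"
      using transp_onD[OF trans] \<alpha> \<beta>1 \<beta>2 \<beta>3 by metis
    then show ?thesis using \<beta>3(1) contG G_g G_P by blast
  next
    case False
    then have small: "\<And>i. i < k \<Longrightarrow> of_nat N * (b i - a i) \<le> 1" by force
    show ?thesis
    proof (cases "{i. a i < b i} = {}")
      case True
      \<comment> \<open>The box is a single grid vertex. Its boundary is empty and prescribes
        nothing; density supplies a value allowed by \<open>P 0\<close>, and directedness a stage
        above \<open>\<alpha>\<close> that contains this value.\<close>
      then have "a = b" using ab by (auto simp: fun_eq_iff le_fun_def order_less_le)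
      have bd: "box_boundary a b = {}" using True by (auto simp: box_boundary_def)
      have "off_grid k N a = 0"
        using Q by (simp add: off_grid_def grid_box_def card_eq_0_iff)
      moreover have "a \<in> S" using QS \<open>a = b\<close> by simp
      then obtain m \<gamma> where m: "\<gamma> \<in> A" "m \<in> topspace (Ms \<gamma>)" "(a, m) \<in> P 0"
        using dense[of a] unfolding directed_union_def by blast
      obtain \<beta> where \<beta>: "\<beta> \<in> A" "leq \<alpha> \<beta>" "leq \<gamma> \<beta>"
        using dir \<alpha> m(1) by (auto simp: directed_set_def)
      have "continuous_map (top_of_set {a..b}) (Ms \<beta>) (\<lambda>_. m)"
        using dense_directed_family_mono[OF fam m(1) \<beta>(1,3), of "top_of_set {a..b}" "\<lambda>_. m"] m(2) by simp
      ultimately show ?thesis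
        using \<beta> m(3) bd \<open>a = b\<close> by (intro bexI[of _ \<beta>] conjI exI[of _ "\<lambda>_. m"]) auto
    next
      case False
      then obtain j where j: "card {i. a i < b i} = Suc j"
        using grid_box_finite[OF Q] by (metis card_eq_0_iff not0_implies_Suc)
      obtain W' W where W: "cone_fillable A leq Ms W' W" "{a..b} \<times> W \<subseteq> P (Suc j)"
          "\<And>x m. \<lbrakk>x \<in> {a..b}; (x, m) \<in> P j\<rbrakk> \<Longrightarrow> m \<in> W'"
        using step[OF Q QS small j] by blast
      let ?B = "box_boundary a b"
      have gW: "g ` ?B \<subseteq> W'"
      proof
        fix m assume "m \<in> g ` ?B"
        then obtain x where x: "x \<in> ?B" "m = g x" by blast
        then have "x \<in> {a..b}" using box_boundary_subset by blast
        \<comment> \<open>Boundary points lie in open cells of dimension at most \<open>j\<close>,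
          and the sets \<open>P\<close> increase, so the different controls on the boundary all fit
          into \<open>P j\<close>, from which coning starts.\<close>
        then have "off_grid k N x \<le> j" using off_grid_cell(1)[OF N Q small] x(1) j by fastforce
        then have "P (off_grid k N x) \<subseteq> P j" using mono lift_Suc_mono_le[of P] by blast
        then show "m \<in> W'" using W(3)[OF \<open>x \<in> {a..b}\<close>] g(2)[OF x(1)] x(2) by blast
      qed
      have "compactin (top_of_set ?B) ?B"
        using compact_box_boundary[OF grid_box_finite[OF Q]] by (simp add: compactin_subtopology)
      from image_compactin[OF this g(1)] have K: "compactin (Ms \<alpha>) (g ` ?B)" .
      \<comment> \<open>The apex has to be a point of the compact set being coned off, as only
        segments between two of its points are available; the value at a corner will do.\<close>
      have "b \<in> ?B" using False ab by (auto simp: box_boundary_def)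
      then have "g b \<in> g ` ?B" by blast
      with W(1) gW K \<alpha> obtain \<beta> h where \<beta>: "\<beta> \<in> A" "leq \<alpha> \<beta>"
        and h: "continuous_map (prod_topology (top_of_set {0..1::real}) (subtopology (Ms \<alpha>) (g ` ?B))) (Ms \<beta>) h"
          "\<And>x. x \<in> g ` ?B \<Longrightarrow> h (1, x) = x" "\<And>x. x \<in> g ` ?B \<Longrightarrow> h (0, x) = g b" "h ` ({0..1} \<times> g ` ?B) \<subseteq> W"
        unfolding cone_fillable_def by metis
      obtain G where G: "continuous_map (top_of_set {a..b}) (Ms \<beta>) G" "\<And>x. x \<in> ?B \<Longrightarrow> G x = g x" "G ` {a..b} \<subseteq> W"
        using extend_over_box[OF ab grid_box_finite[OF Q] False g(1) h] by blast
      have "(x, G x) \<in> P (off_grid k N x)" if x: "x \<in> {a..b}" for x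
      proof (cases "x \<in> ?B")
        case True
        then show ?thesis using G(2) g(2) by simp
      next
        case nb: False
        then have "off_grid k N x = Suc j" using off_grid_cell(2)[OF N Q small x] j by simp
        moreover have "G x \<in> W" using G(3) x by blast
        ultimately show ?thesis using W(2) x by auto
      qed
      then show ?thesis using \<beta> G by blast
    qed
  qed
qed

section \<open>Approximation relative to the boundary\<close>

text \<open>Coning is to lead from \<open>Q j\<close> into \<open>Q (Suc j)\<close>, so the larger
  set has to be known first. The chain is therefore built downwards from \<open>P\<close>, each
  refinement being prepended as the new index 0, and the minimum of the finitely many Lebesgue
  numbers serves all levels.\<close>

lemma graph_neighbourhood_chain:
  fixes S :: "'b::metric_space set"
  assumes lcf: "locally_cone_fillable M A leq Ms" and S: "compact S"
    and F: "continuous_map (top_of_set S) M F"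
    and P: "openin (prod_topology (top_of_set S) M) P" "\<forall>x\<in>S. (x, F x) \<in> P"
  shows "\<exists>Q \<delta>. \<delta> > 0 \<and> (\<forall>j. Q j \<subseteq> Q (Suc j)) \<and> (\<forall>j. Q j \<subseteq> P) \<and>
    openin (prod_topology (top_of_set S) M) (Q 0) \<and> (\<forall>x\<in>S. (x, F x) \<in> Q 0) \<and>
    (\<forall>j<n. \<forall>T. T \<subseteq> S \<longrightarrow> T \<noteq> {} \<longrightarrow> diameter T < \<delta> \<longrightarrow>
       (\<exists>W' W. cone_fillable A leq Ms W' W \<and> T \<times> W \<subseteq> Q (Suc j) \<and> (\<forall>x\<in>T. \<forall>m. (x, m) \<in> Q j \<longrightarrow> m \<in> W')))"
proof (induction n)
  case 0
  show ?case
    by (intro exI[of _ "\<lambda>_. P"] exI[of _ "1::real"]) (use P in simp)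
next
  case (Suc n)
  then obtain Q \<delta> where Q: "\<delta> > 0" "\<forall>j. Q j \<subseteq> Q (Suc j)" "\<forall>j. Q j \<subseteq> P"
    "openin (prod_topology (top_of_set S) M) (Q 0)" "\<forall>x\<in>S. (x, F x) \<in> Q 0"
    "\<forall>j<n. \<forall>T. T \<subseteq> S \<longrightarrow> T \<noteq> {} \<longrightarrow> diameter T < \<delta> \<longrightarrow>
       (\<exists>W' W. cone_fillable A leq Ms W' W \<and> T \<times> W \<subseteq> Q (Suc j) \<and> (\<forall>x\<in>T. \<forall>m. (x, m) \<in> Q j \<longrightarrow> m \<in> W'))"
    by (elim exE conjE) (rule that)
  note \<open>\<delta> > 0\<close> and mono = Q(2)[rule_format] and QP = Q(3)[rule_format] and Q0 = Q(4) Q(5)[rule_format]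
    and step = Q(6)[rule_format]
  obtain N \<epsilon> where N: "openin (prod_topology (top_of_set S) M) N" "\<And>x. x \<in> S \<Longrightarrow> (x, F x) \<in> N"
    "N \<subseteq> Q 0" and "\<epsilon> > 0" and N_step:
    "\<And>T. \<lbrakk>T \<subseteq> S; T \<noteq> {}; diameter T < \<epsilon>\<rbrakk> \<Longrightarrow>
       \<exists>W' W. cone_fillable A leq Ms W' W \<and> T \<times> W \<subseteq> Q 0 \<and> (\<forall>x\<in>T. \<forall>m. (x, m) \<in> N \<longrightarrow> m \<in> W')"
    by (rule refine_graph_neighbourhood[OF lcf S F Q0]) auto
  define Q' where "Q' = case_nat N Q"
  have "\<exists>W' W. cone_fillable A leq Ms W' W \<and> T \<times> W \<subseteq> Q' (Suc j) \<and> (\<forall>x\<in>T. \<forall>m. (x, m) \<in> Q' j \<longrightarrow> m \<in> W')"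
    if "j < Suc n" "T \<subseteq> S" "T \<noteq> {}" "diameter T < min \<delta> \<epsilon>" for j T
  proof (cases j)
    case 0
    then show ?thesis using N_step[of T] that by (simp add: Q'_def)
  next
    case (Suc i)
    then show ?thesis using step[of i T] that by (simp add: Q'_def)
  qed
  moreover have "Q' j \<subseteq> Q' (Suc j)" "Q' j \<subseteq> P" for j
    using N(3) mono QP subset_trans[OF N(3) QP] by (simp_all add: Q'_def split: nat.split)
  moreover have "openin (prod_topology (top_of_set S) M) (Q' 0)" "\<forall>x\<in>S. (x, F x) \<in> Q' 0"
    using N by (simp_all add: Q'_def)
  ultimately show ?case
    using \<open>\<delta> > 0\<close> \<open>\<epsilon> > 0\<close>
    by (intro exI[of _ Q'] exI[of _ "min \<delta> \<epsilon>"] conjI allI impI) (simp_all only: min_less_iff_conj)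
qed

text \<open>\<open>P'\<close> is the smallest set of the chain, found before \<open>\<alpha>\<close>
  and \<open>g\<close> are given; it is contained in the control demanded at every boundary point.
  Integral corners lie on the grid for every \<open>N\<close>, so the mesh can be chosen last,
  according to the Lebesgue number of the chain.\<close>

lemma approximate_extension:
  assumes fam: "dense_directed_family M A leq Ms" and lcf: "locally_cone_fillable M A leq Ms"
    and ab: "a \<le> b" and int: "\<And>i. i < k \<Longrightarrow> a i \<in> \<int> \<and> b i \<in> \<int>" and degen: "\<And>i. i \<ge> k \<Longrightarrow> a i = b i"
    and F: "continuous_map (top_of_set {a..b}) M F"
    and P: "openin (prod_topology (top_of_set {a..b}) M) P" "\<And>x. x \<in> {a..b} \<Longrightarrow> (x, F x) \<in> P"
  obtains P' where "openin (prod_topology (top_of_set {a..b}) M) P'" "\<And>x. x \<in> {a..b} \<Longrightarrow> (x, F x) \<in> P'"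
    "\<And>\<alpha> g. \<lbrakk>\<alpha> \<in> A; continuous_map (top_of_set (box_boundary a b)) (Ms \<alpha>) g;
       \<And>x. x \<in> box_boundary a b \<Longrightarrow> (x, g x) \<in> P'\<rbrakk> \<Longrightarrow>
      \<exists>\<beta>\<in>A. leq \<alpha> \<beta> \<and> (\<exists>G. continuous_map (top_of_set {a..b}) (Ms \<beta>) G \<and>
        (\<forall>x\<in>box_boundary a b. G x = g x) \<and> (\<forall>x\<in>{a..b}. (x, G x) \<in> P))"
proof -
  have P': "\<forall>x\<in>{a..b}. (x, F x) \<in> P" using P(2) by blast
  obtain Q \<delta> where Q: "\<delta> > 0" "\<forall>j. Q j \<subseteq> Q (Suc j)" "\<forall>j. Q j \<subseteq> P"
    "openin (prod_topology (top_of_set {a..b}) M) (Q 0)" "\<forall>x\<in>{a..b}. (x, F x) \<in> Q 0"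
    "\<forall>j<k. \<forall>T. T \<subseteq> {a..b} \<longrightarrow> T \<noteq> {} \<longrightarrow> diameter T < \<delta> \<longrightarrow>
       (\<exists>W' W. cone_fillable A leq Ms W' W \<and> T \<times> W \<subseteq> Q (Suc j) \<and> (\<forall>x\<in>T. \<forall>m. (x, m) \<in> Q j \<longrightarrow> m \<in> W'))"
    using graph_neighbourhood_chain[OF lcf compact_fun_atLeastAtMost F P(1) P', of k]
    by (elim exE conjE) (rule that)
  note \<open>\<delta> > 0\<close> and mono = Q(2)[rule_format] and QP = Q(3)[rule_format] and Q0 = Q(4) Q(5)[rule_format]
    and step = Q(6)[rule_format]
  \<comment> \<open>The factor 2 is the one in \<open>diameter_box_le\<close>.\<close>
  obtain N :: nat where N: "N > 0" "2 * (1 / of_nat N) < \<delta>"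
  proof -
    obtain N :: nat where "N > 0" "1 / of_nat N < \<delta> / 2"
      using nat_approx_posE[of "\<delta> / 2"] \<open>\<delta> > 0\<close> by (metis half_gt_zero zero_less_Suc)
    then show thesis using that[of N] by simp
  qed
  have grid: "grid_box k N a b"
    using ab int degen by (auto simp: grid_box_def)
  have dense: "\<exists>m\<in>directed_union A Ms. (x, m) \<in> Q 0" if x: "x \<in> {a..b}" for x
  proof -
    obtain U V where UV: "openin M V" "F x \<in> V" "x \<in> U" "U \<times> V \<subseteq> Q 0"
      using Q0(1)[unfolded openin_prod_topology_alt, rule_format, OF Q0(2)[OF x]] by auto
    have "M closure_of directed_union A Ms = topspace M"
      using fam by (simp add: dense_directed_family_def)
    then have "directed_union A Ms \<inter> V \<noteq> {}"
      using UV(1,2) unfolding dense_intersects_open by blast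
    then show ?thesis using UV by blast
  qed
  have cell: "\<exists>W' W. cone_fillable A leq Ms W' W \<and> {a'..b'} \<times> W \<subseteq> Q (Suc j) \<and>
             (\<forall>x\<in>{a'..b'}. \<forall>m. (x, m) \<in> Q j \<longrightarrow> m \<in> W')"
    if Q: "grid_box k N a' b'" and sub: "{a'..b'} \<subseteq> {a..b}"
      and small: "\<And>i. i < k \<Longrightarrow> of_nat N * (b' i - a' i) \<le> 1" and card: "card {i. a' i < b' i} = Suc j"
    for j a' b'
  proof (rule step)
    have "{i. a' i < b' i} \<subseteq> {..<k}"
    proof
      fix i assume "i \<in> {i. a' i < b' i}"
      then have "\<not> k \<le> i" using Q by (auto simp: grid_box_def)
      then show "i \<in> {..<k}" by simp
    qed
    \<comment> \<open>At most \<open>k\<close> coordinates of a cell are nondegenerate, so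
      \<open>k\<close> refinements cover every dimension in which coning takes place.\<close>
    then have "card {i. a' i < b' i} \<le> k" using card_mono[of "{..<k}"] by fastforce
    then show "j < k" using card by simp
    show "{a'..b'} \<noteq> {}" using Q by (auto simp: grid_box_def)
    have "b' i - a' i \<le> 1 / of_nat N" for i
    proof (cases "i < k")
      case True
      then show ?thesis using small[OF True] N(1) by (simp add: field_simps)
    next
      case False
      then show ?thesis using Q by (simp add: grid_box_def)
    qed
    then have "diameter {a'..b'} \<le> 2 * (1 / of_nat N)"
      by (rule diameter_box_le) simp
    then show "diameter {a'..b'} < \<delta>" using N(2) by simp
  qed (rule sub)
  have mono0: "Q 0 \<subseteq> Q j" for j
    using lift_Suc_mono_le[of Q, OF mono] by simp
  show thesis
  proof (rule that[OF Q0])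
    fix \<alpha> g assume g: "\<alpha> \<in> A" "continuous_map (top_of_set (box_boundary a b)) (Ms \<alpha>) g"
       "\<And>x. x \<in> box_boundary a b \<Longrightarrow> (x, g x) \<in> Q 0"
    have "(x, g x) \<in> Q (off_grid k N x)" if "x \<in> box_boundary a b" for x
      using g(3)[OF that] mono0 by blast
    then obtain \<beta> G where "\<beta> \<in> A" "leq \<alpha> \<beta>" "continuous_map (top_of_set {a..b}) (Ms \<beta>) G"
      "\<forall>x\<in>box_boundary a b. G x = g x" "\<forall>x\<in>{a..b}. (x, G x) \<in> Q (off_grid k N x)"
      using fill_grid_box[where P = Q and S = "{a..b}" and k = k, OF fam N(1) mono dense cell grid order_refl g(1,2)]
      by blast
    then show "\<exists>\<beta>\<in>A. leq \<alpha> \<beta> \<and> (\<exists>G. continuous_map (top_of_set {a..b}) (Ms \<beta>) G \<and>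
        (\<forall>x\<in>box_boundary a b. G x = g x) \<and> (\<forall>x\<in>{a..b}. (x, G x) \<in> P))"
      using QP by blast
  qed
qed

text \<open>The constant family \<open>M\<close> turns approximation results into statements about homotopies in \<open>M\<close>.\<close>

lemma dense_directed_family_trivial:
  "Hausdorff_space M \<Longrightarrow> dense_directed_family M {()} (\<lambda>_ _. True) (\<lambda>_. M)"
  by (auto simp: dense_directed_family_def directed_set_def directed_union_def reflp_on_def transp_on_def)

text \<open>The chart itself is its own stage chart, so the conditions on segments in the stages all
  reduce to \<open>conv2 V2 \<subseteq> V\<close>.\<close>

lemma well_filled_chart_trivial:
  assumes "well_filled_chart M A leq Ms U E V \<phi> V2"
  shows "well_filled_chart M {()} (\<lambda>_ _. True) (\<lambda>_. M) U E V \<phi> V2"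
proof -
  have V2: "V2 \<noteq> {}" "openin (subtopology E V) V2" "conv2 V2 \<subseteq> V"
    using assms unfolding well_filled_chart_def Let_def by - (elim conjE bexE exE, assumption)+
  have "V2 \<subseteq> V" using V2(2) openin_imp_subset by blast
  have E: "topological_vector_space E" "openin M U" "V \<subseteq> topspace E"
    "homeomorphic_map (subtopology M U) (subtopology E V) \<phi>"
    using assms unfolding well_filled_chart_def by simp_all
  have "U \<inter> directed_union {()} (\<lambda>_. M) = U"
    using openin_subset[OF E(2)] by (auto simp: directed_union_def)
  moreover have "conv2 K \<subseteq> V" if "K \<subseteq> V2" for K
    using conv2_mono[OF that] V2(3) by blast
  ultimately show ?thesis
    unfolding well_filled_chart_def Let_def using V2 E \<open>V2 \<subseteq> V\<close>
    by (intro conjI bexI[of _ "()"] exI[of _ "\<lambda>_. U"] exI[of _ "\<lambda>_. E"] exI[of _ "\<lambda>_. V"] exI[of _ "\<lambda>_. \<phi>"])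
      (auto simp: Int_absorb2)
qed

lemma admits_well_filled_charts_trivial:
  assumes "admits_well_filled_charts TYPE('e::real_vector) M A leq Ms"
  shows "admits_well_filled_charts TYPE('e) M {()} (\<lambda>_ _. True) (\<lambda>_. M)"
  unfolding admits_well_filled_charts_def
proof (rule equalityI)
  show "topspace M \<subseteq> \<Union> {{x \<in> U. \<phi> x \<in> V2} |U (E :: 'e topology) V \<phi> V2.
      well_filled_chart M {()} (\<lambda>_ _. True) (\<lambda>_. M) U E V \<phi> V2}"
  proof
    fix x assume "x \<in> topspace M"
    then obtain U and E :: "'e topology" and V \<phi> V2
      where "well_filled_chart M A leq Ms U E V \<phi> V2" "x \<in> U" "\<phi> x \<in> V2"
      using assms unfolding admits_well_filled_charts_def by blast
    note chart = well_filled_chart_trivial[OF this(1)] and x = this(2,3)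
    show "x \<in> \<Union> {{x \<in> U. \<phi> x \<in> V2} |U (E :: 'e topology) V \<phi> V2.
      well_filled_chart M {()} (\<lambda>_ _. True) (\<lambda>_. M) U E V \<phi> V2}"
      by (intro UnionI CollectI exI conjI) (rule refl, rule chart, use x in auto)
  qed
  show "\<Union> {{x \<in> U. \<phi> x \<in> V2} |U (E :: 'e topology) V \<phi> V2.
      well_filled_chart M {()} (\<lambda>_ _. True) (\<lambda>_. M) U E V \<phi> V2} \<subseteq> topspace M"
  proof (rule Union_least)
    fix X assume "X \<in> {{x \<in> U. \<phi> x \<in> V2} |U (E :: 'e topology) V \<phi> V2.
      well_filled_chart M {()} (\<lambda>_ _. True) (\<lambda>_. M) U E V \<phi> V2}"
    then obtain U and E :: "'e topology" and V \<phi> V2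
      where "well_filled_chart M {()} (\<lambda>_ _. True) (\<lambda>_. M) U E V \<phi> V2" "X = {x \<in> U. \<phi> x \<in> V2}"
      by blast
    then show "X \<subseteq> topspace M"
      unfolding well_filled_chart_def using openin_subset by fastforce
  qed
qed

section \<open>Homotopies of cube loops\<close>

text \<open>The cube is a box in \<open>nat \<Rightarrow> real\<close> which is degenerate in the coordinates \<open>i \<ge> k\<close>, where
  extensional functions are \<open>undefined\<close>.\<close>

definition cube_lower :: "nat \<Rightarrow> nat \<Rightarrow> real" where
  "cube_lower k = (\<lambda>i. if i < k then 0 else undefined)"

definition cube_upper :: "nat \<Rightarrow> nat \<Rightarrow> real" where
  "cube_upper k = (\<lambda>i. if i < k then 1 else undefined)"

lemma topspace_cube: "topspace (cube k) = {cube_lower k..cube_upper k}"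
proof -
  have "x \<in> topspace (cube k) \<longleftrightarrow> x \<in> {cube_lower k..cube_upper k}" for x
  proof -
    have "x \<in> {cube_lower k..cube_upper k} \<longleftrightarrow>
        (\<forall>i. (if i < k then 0 else undefined) \<le> x i \<and> x i \<le> (if i < k then 1 else undefined))"
      by (auto simp: le_fun_def cube_lower_def cube_upper_def)
    also have "\<dots> \<longleftrightarrow> (\<forall>i. if i < k then x i \<in> {0..1} else x i = undefined)"
      by (rule all_cong1) auto
    also have "\<dots> \<longleftrightarrow> x \<in> topspace (cube k)"
      by (auto simp: cube_def PiE_iff extensional_def split: if_splits)
    finally show ?thesis by simp
  qed
  then show ?thesis by blast
qed

lemma mem_topspace_cube:
  "x \<in> topspace (cube k) \<longleftrightarrow> (\<forall>i<k. x i \<in> {0..1}) \<and> (\<forall>i\<ge>k. x i = undefined)"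
  by (auto simp: cube_def PiE_iff extensional_def)

text \<open>All coordinates from \<open>k\<close> on are constant on the cube, so the product
  topology over the first \<open>k\<close> factors and the subspace topology of the full product
  coincide there.\<close>

lemma cube_eq_box: "cube k = top_of_set {cube_lower k..cube_upper k}"
proof -
  let ?Q = "{cube_lower k..cube_upper k}"
  have eu: "(euclidean :: (nat \<Rightarrow> real) topology) = product_topology (\<lambda>i. euclideanreal) UNIV"
    by (simp add: euclidean_product_topology)
  have "continuous_map (top_of_set ?Q) (cube k) id"
    unfolding cube_def continuous_map_componentwise
  proof (intro conjI ballI)
    show "id ` topspace (top_of_set ?Q) \<subseteq> extensional {..<k}"
      unfolding topspace_euclidean_subtopology topspace_cube[symmetric]
      by (auto simp: mem_topspace_cube extensional_def)
    fix i assume i: "i \<in> {..<k}"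
    have "x i \<in> {0..1}" if "x \<in> ?Q" for x
      using that i unfolding topspace_cube[symmetric] mem_topspace_cube by blast
    then show "continuous_map (top_of_set ?Q) (top_of_set {0..1::real}) (\<lambda>x. id x i)"
      using continuous_on_coordinate[of ?Q i] by (auto simp: continuous_map_in_subtopology continuous_map_iff_continuous)
  qed
  moreover have "continuous_map (cube k) (top_of_set ?Q) id"
    unfolding continuous_map_in_subtopology
  proof
    show "id \<in> topspace (cube k) \<rightarrow> ?Q" using topspace_cube by simp
    show "continuous_map (cube k) euclidean id"
      unfolding eu continuous_map_componentwise_UNIV
    proof
      fix i
      show "continuous_map (cube k) euclideanreal (\<lambda>x. id x i)"
      proof (cases "i < k")
        case True
        then have "continuous_map (cube k) (top_of_set {0..1}) (\<lambda>x. x i)"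
          unfolding cube_def by (intro continuous_map_product_projection) simp
        then show ?thesis using continuous_map_into_fulltopology by simp
      next
        case False
        have "continuous_map (cube k) euclideanreal (\<lambda>x. undefined)" by simp
        then show ?thesis
          by (rule continuous_map_eq) (use False in \<open>auto simp: mem_topspace_cube\<close>)
      qed
    qed
  qed
  ultimately have "homeomorphic_maps (cube k) (top_of_set ?Q) id id"
    by (simp add: homeomorphic_maps_def)
  then show ?thesis by (simp add: homeomorphic_maps_id)
qed

lemma cube_eq_top_of_set: "cube k = top_of_set (topspace (cube k))"
  using cube_eq_box topspace_cube by simp

lemma box_boundary_cube: "box_boundary (cube_lower k) (cube_upper k) = cube_boundary k"
proof -
  have "cube_lower k i < cube_upper k i \<and> (x i = cube_lower k i \<or> x i = cube_upper k i) \<longleftrightarrow>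
      i < k \<and> (x i = 0 \<or> x i = 1)" for i and x :: "nat \<Rightarrow> real"
    by (simp add: cube_lower_def cube_upper_def)
  then show ?thesis
    by (simp add: box_boundary_def cube_boundary_def topspace_cube)
qed

lemma cube_boundary_subset: "cube_boundary k \<subseteq> topspace (cube k)"
  by (auto simp: cube_boundary_def)

lemma approximate_cube_extension:
  assumes fam: "dense_directed_family M A leq Ms" and lcf: "locally_cone_fillable M A leq Ms"
    and F: "continuous_map (cube k) M F"
    and P: "openin (prod_topology (cube k) M) P" "\<forall>x\<in>topspace (cube k). (x, F x) \<in> P"
  shows "\<exists>P'. openin (prod_topology (cube k) M) P' \<and> (\<forall>x\<in>topspace (cube k). (x, F x) \<in> P') \<and>
    (\<forall>\<alpha>\<in>A. \<forall>g. continuous_map (top_of_set (cube_boundary k)) (Ms \<alpha>) g \<longrightarrow>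
       (\<forall>x\<in>cube_boundary k. (x, g x) \<in> P') \<longrightarrow>
       (\<exists>\<beta>\<in>A. leq \<alpha> \<beta> \<and> (\<exists>G. continuous_map (cube k) (Ms \<beta>) G \<and>
          (\<forall>x\<in>cube_boundary k. G x = g x) \<and> (\<forall>x\<in>topspace (cube k). (x, G x) \<in> P))))"
proof (rule approximate_extension[where a = "cube_lower k" and b = "cube_upper k" and k = k and F = F and P = P,
      OF fam lcf, folded cube_eq_box topspace_cube, unfolded box_boundary_cube])
  show "cube_lower k \<le> cube_upper k"
    by (auto simp: le_fun_def cube_lower_def cube_upper_def)
  show "cube_lower k i \<in> \<int> \<and> cube_upper k i \<in> \<int>" if "i < k" for i
    using that by (simp add: cube_lower_def cube_upper_def)
  show "cube_lower k i = cube_upper k i" if "k \<le> i" for i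
    using that by (simp add: cube_lower_def cube_upper_def)
  fix P'
  assume "openin (prod_topology (cube k) M) P'" "\<And>x. x \<in> topspace (cube k) \<Longrightarrow> (x, F x) \<in> P'"
    "\<And>\<alpha> g. \<lbrakk>\<alpha> \<in> A; continuous_map (top_of_set (cube_boundary k)) (Ms \<alpha>) g;
       \<And>x. x \<in> cube_boundary k \<Longrightarrow> (x, g x) \<in> P'\<rbrakk> \<Longrightarrow>
      \<exists>\<beta>\<in>A. leq \<alpha> \<beta> \<and> (\<exists>G. continuous_map (cube k) (Ms \<beta>) G \<and>
        (\<forall>x\<in>cube_boundary k. G x = g x) \<and> (\<forall>x\<in>topspace (cube k). (x, G x) \<in> P))"
  then show ?thesis
    by (intro exI[of _ P'] conjI ballI allI impI) auto
qed (use F P in auto)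

section \<open>Homotopies as maps on a cube of one dimension more\<close>

lemma continuous_map_face: "continuous_map (cube (Suc k)) (cube k) (\<lambda>y. y(k := undefined))"
proof -
  have "y(k := undefined) \<in> topspace (cube k)" if "y \<in> topspace (cube (Suc k))" for y
    using that by (auto simp: mem_topspace_cube)
  moreover have "continuous_on (topspace (cube (Suc k))) (\<lambda>y. y(k := undefined))"
  proof (rule continuous_on_coordinatewise_then_product)
    show "continuous_on (topspace (cube (Suc k))) (\<lambda>y. (y(k := undefined)) i)" for i
      by (cases "i = k") (auto intro: continuous_on_coordinate)
  qed
  ultimately show ?thesis
    by (subst (1 2) cube_eq_top_of_set) (auto simp: continuous_map_subtopology_eu)
qed

lemma continuous_map_last_coordinate: "continuous_map (cube (Suc k)) (top_of_set {0..1}) (\<lambda>y. y k)"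
  unfolding cube_def by (rule continuous_map_product_projection) simp

lemma continuous_map_suspend:
  "continuous_map (prod_topology (top_of_set {0..1}) (cube k)) (cube (Suc k)) (\<lambda>(t, x). x(k := t))"
proof -
  have "x(k := t) \<in> topspace (cube (Suc k))" if "t \<in> {0..1}" "x \<in> topspace (cube k)" for t x
    using that by (auto simp: mem_topspace_cube)
  moreover have "continuous_on ({0..1} \<times> topspace (cube k)) (\<lambda>(t, x). x(k := t))"
  proof (rule continuous_on_coordinatewise_then_product)
    fix i
    have "continuous_on ({0..1} \<times> topspace (cube k)) (\<lambda>z::real \<times> (nat \<Rightarrow> real). snd z i)"
      by (rule continuous_on_compose2[OF continuous_on_coordinate[of UNIV i] continuous_on_snd[OF continuous_on_id]]) simp
    then show "continuous_on ({0..1} \<times> topspace (cube k)) (\<lambda>z. (case z of (t, x) \<Rightarrow> x(k := t)) i)"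
      by (cases "i = k") (auto simp: split_def intro: continuous_on_fst continuous_on_id)
  qed
  ultimately show ?thesis
    by (subst (1 2) cube_eq_top_of_set) (auto simp: continuous_map_subtopology_eu)
qed

lemma cube_boundary_Suc:
  "y \<in> cube_boundary (Suc k) \<longleftrightarrow>
     y \<in> topspace (cube (Suc k)) \<and> (y k = 0 \<or> y k = 1 \<or> y(k := undefined) \<in> cube_boundary k)"
proof (cases "y \<in> topspace (cube (Suc k))")
  case True
  then have "y(k := undefined) \<in> topspace (cube k)" by (auto simp: mem_topspace_cube)
  then show ?thesis using True by (auto simp: cube_boundary_def less_Suc_eq)
qed (auto simp: cube_boundary_def)

lemma cube_face_eq: "x \<in> topspace (cube k) \<Longrightarrow> x(k := undefined) = x"
  by (auto simp: mem_topspace_cube fun_eq_iff)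

lemma cube_homotopic_iff:
  "cube_homotopic k X p f g \<longleftrightarrow>
     (\<exists>h. continuous_map (prod_topology (top_of_set {0..1::real}) (cube k)) X h \<and>
          (\<forall>x\<in>topspace (cube k). h (0, x) = f x) \<and> (\<forall>x\<in>topspace (cube k). h (1, x) = g x) \<and>
          (\<forall>t\<in>{0..1}. \<forall>x\<in>cube_boundary k. h (t, x) = p))"
  unfolding cube_homotopic_def
  by (rule homotopic_with, rule ball_cong[OF refl]) (simp add: subsetD[OF cube_boundary_subset])

text \<open>Time becomes the last coordinate, which leaves the indices of the others unchanged.
  Resetting it to \<open>undefined\<close> turns a point of the larger cube into an extensional
  point of \<open>cube k\<close>.\<close>

lemma cube_homotopic_altdef:
  "cube_homotopic k X p f g \<longleftrightarrow> (\<exists>H. continuous_map (cube (Suc k)) X H \<and>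
     (\<forall>y\<in>topspace (cube (Suc k)). y k = 0 \<longrightarrow> H y = f (y(k := undefined))) \<and>
     (\<forall>y\<in>topspace (cube (Suc k)). y k = 1 \<longrightarrow> H y = g (y(k := undefined))) \<and>
     (\<forall>y\<in>topspace (cube (Suc k)). y(k := undefined) \<in> cube_boundary k \<longrightarrow> H y = p))"
proof -
  have face: "y(k := undefined) \<in> topspace (cube k)" if "y \<in> topspace (cube (Suc k))" for y
    using that by (auto simp: mem_topspace_cube)
  have last: "y k \<in> {0..1}" if "y \<in> topspace (cube (Suc k))" for y
    using that by (auto simp: mem_topspace_cube)
  have susp: "x(k := t) \<in> topspace (cube (Suc k))" if "x \<in> topspace (cube k)" "t \<in> {0..1}" for x t
    using that by (auto simp: mem_topspace_cube)
  show ?thesis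
    unfolding cube_homotopic_iff
  proof
    assume "\<exists>h. continuous_map (prod_topology (top_of_set {0..1::real}) (cube k)) X h \<and>
           (\<forall>x\<in>topspace (cube k). h (0, x) = f x) \<and> (\<forall>x\<in>topspace (cube k). h (1, x) = g x) \<and>
           (\<forall>t\<in>{0..1}. \<forall>x\<in>cube_boundary k. h (t, x) = p)"
    then obtain h where h: "continuous_map (prod_topology (top_of_set {0..1::real}) (cube k)) X h"
      "\<And>x. x\<in>topspace (cube k) \<Longrightarrow> h (0, x) = f x" "\<And>x. x\<in>topspace (cube k) \<Longrightarrow> h (1, x) = g x"
      "\<And>t x. t \<in> {0..1} \<Longrightarrow> x \<in> cube_boundary k \<Longrightarrow> h (t, x) = p"
      by blast
    have "continuous_map (cube (Suc k)) X (\<lambda>y. h (y k, y(k := undefined)))"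
      using continuous_map_compose[OF continuous_map_pairedI[OF continuous_map_last_coordinate continuous_map_face] h(1)]
      by (simp add: o_def)
    then show "\<exists>H. continuous_map (cube (Suc k)) X H \<and>
     (\<forall>y\<in>topspace (cube (Suc k)). y k = 0 \<longrightarrow> H y = f (y(k := undefined))) \<and>
     (\<forall>y\<in>topspace (cube (Suc k)). y k = 1 \<longrightarrow> H y = g (y(k := undefined))) \<and>
     (\<forall>y\<in>topspace (cube (Suc k)). y(k := undefined) \<in> cube_boundary k \<longrightarrow> H y = p)"
      using h(2-4) face last by (intro exI[of _ "\<lambda>y. h (y k, y(k := undefined))"]) auto
  next
    assume "\<exists>H. continuous_map (cube (Suc k)) X H \<and>
     (\<forall>y\<in>topspace (cube (Suc k)). y k = 0 \<longrightarrow> H y = f (y(k := undefined))) \<and>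
     (\<forall>y\<in>topspace (cube (Suc k)). y k = 1 \<longrightarrow> H y = g (y(k := undefined))) \<and>
     (\<forall>y\<in>topspace (cube (Suc k)). y(k := undefined) \<in> cube_boundary k \<longrightarrow> H y = p)"
    then obtain H where H: "continuous_map (cube (Suc k)) X H"
      "\<And>y. y\<in>topspace (cube (Suc k)) \<Longrightarrow> y k = 0 \<Longrightarrow> H y = f (y(k := undefined))"
      "\<And>y. y\<in>topspace (cube (Suc k)) \<Longrightarrow> y k = 1 \<Longrightarrow> H y = g (y(k := undefined))"
      "\<And>y. y\<in>topspace (cube (Suc k)) \<Longrightarrow> y(k := undefined) \<in> cube_boundary k \<Longrightarrow> H y = p"
      by blast
    show "\<exists>h. continuous_map (prod_topology (top_of_set {0..1::real}) (cube k)) X h \<and>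
           (\<forall>x\<in>topspace (cube k). h (0, x) = f x) \<and> (\<forall>x\<in>topspace (cube k). h (1, x) = g x) \<and>
           (\<forall>t\<in>{0..1}. \<forall>x\<in>cube_boundary k. h (t, x) = p)"
    proof (intro exI[of _ "H \<circ> (\<lambda>(t, x). x(k := t))"] conjI ballI)
      show "continuous_map (prod_topology (top_of_set {0..1::real}) (cube k)) X (H \<circ> (\<lambda>(t, x). x(k := t)))"
        by (rule continuous_map_compose[OF continuous_map_suspend H(1)])
      fix x assume x: "x \<in> topspace (cube k)"
      show "(H \<circ> (\<lambda>(t, x). x(k := t))) (0, x) = f x"
        using H(2)[OF susp[OF x, of 0]] cube_face_eq[OF x] by simp
      show "(H \<circ> (\<lambda>(t, x). x(k := t))) (1, x) = g x"
        using H(3)[OF susp[OF x, of 1]] cube_face_eq[OF x] by simp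
    next
      fix t :: real and x assume t: "t \<in> {0..1}" and x: "x \<in> cube_boundary k"
      then have "x \<in> topspace (cube k)" using cube_boundary_subset by blast
      then show "(H \<circ> (\<lambda>(t, x). x(k := t))) (t, x) = p"
        using H(4)[OF susp[OF _ t, of x]] cube_face_eq x by simp
    qed
  qed
qed

text \<open>The boundary values of a homotopy from \<open>f\<close> to \<open>g\<close> relative to
  the boundary; for loops, such a homotopy is the same as an extension of this map to the whole
  cube.\<close>

definition glue_faces :: "nat \<Rightarrow> 'a \<Rightarrow> ((nat \<Rightarrow> real) \<Rightarrow> 'a) \<Rightarrow> ((nat \<Rightarrow> real) \<Rightarrow> 'a) \<Rightarrow> (nat \<Rightarrow> real) \<Rightarrow> 'a" where
  "glue_faces k p f g y = (if y k = 0 then f (y(k := undefined)) else if y k = 1 then g (y(k := undefined)) else p)"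

text \<open>Bottom, top and sides are closed, bottom and top are disjoint, and where the sides meet
  either of them the loops have the value \<open>p\<close> already.\<close>

lemma continuous_map_glue_faces:
  assumes f: "f \<in> cube_loops k X p" and g: "g \<in> cube_loops k X p" and p: "p \<in> topspace X"
  shows "continuous_map (top_of_set (cube_boundary (Suc k))) X (glue_faces k p f g)"
proof -
  let ?C = "topspace (cube (Suc k))"
  define S0 where "S0 = ?C \<inter> {y. y k = 0}"
  define S1 where "S1 = ?C \<inter> {y. y k = 1}"
  define S2 where "S2 = ?C \<inter> (\<Union>i\<in>{..<k}. {y. y i = 0} \<union> {y. y i = 1})"
  have "closed ?C"
    unfolding topspace_cube using compact_fun_atLeastAtMost compact_imp_closed by blast
  then have cl: "closed S0" "closed S1" "closed S2"
    unfolding S0_def S1_def S2_def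
    by (intro closed_Int closed_UN closed_Un closed_coordinate_eq finite_lessThan ballI; assumption)+
  have S2: "y \<in> S2 \<longleftrightarrow> y \<in> ?C \<and> y(k := undefined) \<in> cube_boundary k" for y
  proof -
    have "y \<in> ?C \<Longrightarrow> y(k := undefined) \<in> topspace (cube k)" by (auto simp: mem_topspace_cube)
    then show ?thesis by (auto simp: S2_def cube_boundary_def)
  qed
  have bd: "cube_boundary (Suc k) = S0 \<union> (S1 \<union> S2)"
    using cube_boundary_Suc[of _ k] S2 by (auto simp: S0_def S1_def)
  have cont: "continuous_map (top_of_set S) X (\<lambda>y. e (y(k := undefined)))"
    if "S \<subseteq> ?C" "e \<in> cube_loops k X p" for S e
  proof -
    have "continuous_map (cube (Suc k)) X (\<lambda>y. e (y(k := undefined)))"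
      using continuous_map_compose[OF continuous_map_face, of k X e] that(2) by (simp add: cube_loops_def o_def)
    then have "continuous_map (top_of_set ?C) X (\<lambda>y. e (y(k := undefined)))"
      using cube_eq_top_of_set by metis
    then show ?thesis using that(1) continuous_map_from_subtopology_mono by blast
  qed
  have loop: "e (y(k := undefined)) = p" if "y \<in> S2" "e \<in> cube_loops k X p" for y e
    using that S2 by (auto simp: cube_loops_def)
  have c12: "continuous_map (top_of_set (S1 \<union> S2)) X (\<lambda>y. if y \<in> S1 then g (y(k := undefined)) else p)"
    by (rule continuous_map_paste[OF cl(2,3) cont[OF _ g]]) (use p loop g in \<open>auto simp: S1_def\<close>)
  have "continuous_map (top_of_set (S0 \<union> (S1 \<union> S2))) X
      (\<lambda>y. if y \<in> S0 then f (y(k := undefined)) else if y \<in> S1 then g (y(k := undefined)) else p)"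
  proof (rule continuous_map_paste[OF cl(1) _ cont[OF _ f] c12])
    show "closed (S1 \<union> S2)" using cl by blast
    show "S0 \<subseteq> ?C" by (auto simp: S0_def)
    show "f (y(k := undefined)) = (if y \<in> S1 then g (y(k := undefined)) else p)"
      if "y \<in> S0" "y \<in> S1 \<union> S2" for y
      using that loop[OF _ f] by (auto simp: S0_def S1_def)
  qed
  then show ?thesis
    unfolding bd by (rule continuous_map_eq) (auto simp: S0_def S1_def S2_def glue_faces_def)
qed

lemma cube_homotopic_extend_faces:
  assumes H: "continuous_map (cube (Suc k)) X H"
    and eq: "\<And>y. y \<in> cube_boundary (Suc k) \<Longrightarrow> H y = glue_faces k p f g y"
    and f: "f \<in> cube_loops k X p" and g: "g \<in> cube_loops k X p"
  shows "cube_homotopic k X p f g"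
  unfolding cube_homotopic_altdef
  using f g eq by (intro exI[of _ H] conjI H) (auto simp: cube_boundary_Suc glue_faces_def cube_loops_def)

lemma cube_homotopic_imp_cube_loops:
  assumes "cube_homotopic k X p f g"
  shows "f \<in> cube_loops k X p" "g \<in> cube_loops k X p"
  using assms homotopic_with_imp_continuous_maps[of _ "cube k" X f g]
    homotopic_with_imp_property[of _ "cube k" X f g]
  unfolding cube_homotopic_def cube_loops_def by auto

lemma cube_homotopic_in_stage:
  assumes fam: "dense_directed_family M A leq Ms" and lcf: "locally_cone_fillable M A leq Ms"
    and \<alpha>: "\<alpha> \<in> A" "p \<in> topspace (Ms \<alpha>)"
    and f: "f \<in> cube_loops k (Ms \<alpha>) p" and g: "g \<in> cube_loops k (Ms \<alpha>) p"
    and hom: "cube_homotopic k M p f g"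
  shows "\<exists>\<beta>\<in>A. leq \<alpha> \<beta> \<and> cube_homotopic k (Ms \<beta>) p f g"
proof -
  obtain H where H: "continuous_map (cube (Suc k)) M H"
      "\<And>y. y\<in>topspace (cube (Suc k)) \<Longrightarrow> y k = 0 \<Longrightarrow> H y = f (y(k := undefined))"
      "\<And>y. y\<in>topspace (cube (Suc k)) \<Longrightarrow> y k = 1 \<Longrightarrow> H y = g (y(k := undefined))"
      "\<And>y. y\<in>topspace (cube (Suc k)) \<Longrightarrow> y(k := undefined) \<in> cube_boundary k \<Longrightarrow> H y = p"
    using hom unfolding cube_homotopic_altdef by blast
  \<comment> \<open>The new homotopy need not be close to \<open>H\<close>, so the whole product
    serves as target neighbourhood. Its boundary values equal those of \<open>H\<close> and hence
    meet any tolerance.\<close>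
  let ?P = "topspace (prod_topology (cube (Suc k)) M)"
  have graph: "\<forall>y\<in>topspace (cube (Suc k)). (y, H y) \<in> ?P"
    using continuous_map_image_subset_topspace[OF H(1)] by auto
  obtain P' where P': "\<forall>y\<in>topspace (cube (Suc k)). (y, H y) \<in> P'"
    and ext: "\<forall>\<alpha>\<in>A. \<forall>g. continuous_map (top_of_set (cube_boundary (Suc k))) (Ms \<alpha>) g \<longrightarrow>
       (\<forall>x\<in>cube_boundary (Suc k). (x, g x) \<in> P') \<longrightarrow>
       (\<exists>\<beta>\<in>A. leq \<alpha> \<beta> \<and> (\<exists>G. continuous_map (cube (Suc k)) (Ms \<beta>) G \<and>
          (\<forall>x\<in>cube_boundary (Suc k). G x = g x) \<and> (\<forall>x\<in>topspace (cube (Suc k)). (x, G x) \<in> ?P)))"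
    using approximate_cube_extension[OF fam lcf H(1) openin_topspace graph] by (elim exE conjE) (rule that)
  have H_glue: "H y = glue_faces k p f g y" if "y \<in> cube_boundary (Suc k)" for y
    using that H(2-4)[of y] by (auto simp: cube_boundary_Suc glue_faces_def)
  have "(y, glue_faces k p f g y) \<in> P'" if "y \<in> cube_boundary (Suc k)" for y
    using P'[rule_format, of y] H_glue[OF that] that cube_boundary_subset by auto
  from ext[rule_format, OF \<alpha>(1) continuous_map_glue_faces[OF f g \<alpha>(2)] this]
  obtain \<beta> G where \<beta>: "\<beta> \<in> A" "leq \<alpha> \<beta>" and G: "continuous_map (cube (Suc k)) (Ms \<beta>) G"
    "\<And>y. y \<in> cube_boundary (Suc k) \<Longrightarrow> G y = glue_faces k p f g y"
    by blast
  have "f \<in> cube_loops k (Ms \<beta>) p" "g \<in> cube_loops k (Ms \<beta>) p"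
    using f g dense_directed_family_mono[OF fam \<alpha>(1) \<beta>] by (auto simp: cube_loops_def)
  then have "cube_homotopic k (Ms \<beta>) p f g"
    using cube_homotopic_extend_faces[OF G] by blast
  then show ?thesis using \<beta> by blast
qed

text \<open>The tolerances are chosen backwards. The constant homotopy of \<open>f\<close>, with
  \<open>M\<close> as the only stage, tells how near to it boundary values must be in order to
  extend over the larger cube. Then \<open>f\<close> is approximated in a stage to within this
  tolerance, and the approximation is placed on the top face; the extension is the homotopy
  sought.\<close>

lemma cube_loop_homotopic_into_stage:
  assumes fam: "dense_directed_family M A leq Ms" and lcf: "locally_cone_fillable M A leq Ms"
    and lcf0: "locally_cone_fillable M {()} (\<lambda>_ _. True) (\<lambda>_. M)"
    and \<alpha>: "\<alpha> \<in> A" "p \<in> topspace (Ms \<alpha>)" and f: "f \<in> cube_loops k M p"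
  shows "\<exists>\<beta>\<in>A. leq \<alpha> \<beta> \<and> (\<exists>g\<in>cube_loops k (Ms \<beta>) p. cube_homotopic k M p f g)"
proof -
  have "Hausdorff_space M" and Ms_M: "\<And>\<beta>. \<beta> \<in> A \<Longrightarrow> continuous_map (Ms \<beta>) M id"
    using fam by (simp_all add: dense_directed_family_def)
  then have fam0: "dense_directed_family M {()} (\<lambda>_ _. True) (\<lambda>_. M)"
    by (intro dense_directed_family_trivial)
  have pM: "p \<in> topspace M"
    using continuous_map_image_subset_topspace[OF Ms_M[OF \<alpha>(1)]] \<alpha>(2) by auto
  have contf: "continuous_map (cube k) M f" and bdf: "\<And>x. x \<in> cube_boundary k \<Longrightarrow> f x = p"
    using f by (auto simp: cube_loops_def)
  define F where "F = (\<lambda>y. f (y(k := undefined)))"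
  have F: "continuous_map (cube (Suc k)) M F"
    using continuous_map_compose[OF continuous_map_face contf] by (simp add: F_def o_def)
  let ?P = "topspace (prod_topology (cube (Suc k)) M)"
  have graph: "\<forall>y\<in>topspace (cube (Suc k)). (y, F y) \<in> ?P"
    using continuous_map_image_subset_topspace[OF F] by auto
  obtain P' where P': "openin (prod_topology (cube (Suc k)) M) P'"
      "\<forall>y\<in>topspace (cube (Suc k)). (y, F y) \<in> P'"
    and ext0: "\<forall>\<alpha>\<in>{()}. \<forall>g. continuous_map (top_of_set (cube_boundary (Suc k))) ((\<lambda>_. M) \<alpha>) g \<longrightarrow>
       (\<forall>x\<in>cube_boundary (Suc k). (x, g x) \<in> P') \<longrightarrow>
       (\<exists>\<beta>\<in>{()}. True \<and> (\<exists>G. continuous_map (cube (Suc k)) ((\<lambda>_. M) \<beta>) G \<and>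
          (\<forall>x\<in>cube_boundary (Suc k). G x = g x) \<and> (\<forall>x\<in>topspace (cube (Suc k)). (x, G x) \<in> ?P)))"
    using approximate_cube_extension[OF fam0 lcf0 F openin_topspace graph] by (elim exE conjE) (rule that)
  note P' = P'(1) P'(2)[rule_format]
  have ext: "\<exists>G. continuous_map (cube (Suc k)) M G \<and> (\<forall>x\<in>cube_boundary (Suc k). G x = g x)"
    if "continuous_map (top_of_set (cube_boundary (Suc k))) M g"
      "\<And>x. x \<in> cube_boundary (Suc k) \<Longrightarrow> (x, g x) \<in> P'" for g
    using ext0[rule_format, OF singletonI that] by blast
  \<comment> \<open>The tolerance on the top face, where coordinate \<open>k\<close> is 1, read as a
    neighbourhood of the graph of \<open>f\<close>.\<close>
  define O1 where "O1 = {z \<in> topspace (prod_topology (cube k) M). ((fst z)(k := 1), snd z) \<in> P'}"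
  have "continuous_map (cube k) (prod_topology (top_of_set {0..1}) (cube k)) (\<lambda>x. (1::real, x))"
    by (intro continuous_map_pairedI) auto
  from continuous_map_compose[OF this continuous_map_suspend]
  have top_face: "continuous_map (cube k) (cube (Suc k)) (\<lambda>x. x(k := 1))"
    by (simp add: o_def)
  from continuous_map_compose[OF continuous_map_fst this]
  have "continuous_map (prod_topology (cube k) M) (prod_topology (cube (Suc k)) M) (\<lambda>z. ((fst z)(k := 1), snd z))"
    by (intro continuous_map_pairedI continuous_map_snd) (simp add: o_def)
  then have O1: "openin (prod_topology (cube k) M) O1"
    unfolding O1_def by (rule openin_continuous_map_preimage[OF _ P'(1)])
  have graph1: "\<forall>x\<in>topspace (cube k). (x, f x) \<in> O1"
  proof
    fix x assume x: "x \<in> topspace (cube k)"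
    have "x(k := 1) \<in> topspace (cube (Suc k))"
      using x by (auto simp: mem_topspace_cube)
    from P'(2)[OF this] have "(x(k := 1), f x) \<in> P'"
      using cube_face_eq[OF x] by (simp add: F_def)
    moreover have "f x \<in> topspace M" using continuous_map_image_subset_topspace[OF contf] x by auto
    ultimately show "(x, f x) \<in> O1" using x by (simp add: O1_def)
  qed
  obtain P'' where P'': "\<forall>x\<in>topspace (cube k). (x, f x) \<in> P''"
    and ext1: "\<forall>\<alpha>\<in>A. \<forall>g. continuous_map (top_of_set (cube_boundary k)) (Ms \<alpha>) g \<longrightarrow>
       (\<forall>x\<in>cube_boundary k. (x, g x) \<in> P'') \<longrightarrow>
       (\<exists>\<beta>\<in>A. leq \<alpha> \<beta> \<and> (\<exists>G. continuous_map (cube k) (Ms \<beta>) G \<and>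
          (\<forall>x\<in>cube_boundary k. G x = g x) \<and> (\<forall>x\<in>topspace (cube k). (x, G x) \<in> O1)))"
    using approximate_cube_extension[OF fam lcf contf O1 graph1] by (elim exE conjE) (rule that)
  have "(x, p) \<in> P''" if "x \<in> cube_boundary k" for x
    using P''[rule_format, of x] bdf[OF that] that cube_boundary_subset by auto
  moreover have "continuous_map (top_of_set (cube_boundary k)) (Ms \<alpha>) (\<lambda>_. p)"
    using \<alpha>(2) by simp
  ultimately obtain \<beta> G where \<beta>: "\<beta> \<in> A" "leq \<alpha> \<beta>" and G: "continuous_map (cube k) (Ms \<beta>) G"
    "\<And>x. x \<in> cube_boundary k \<Longrightarrow> G x = p" "\<And>x. x \<in> topspace (cube k) \<Longrightarrow> (x, G x) \<in> O1"
    using ext1[rule_format, OF \<alpha>(1), of "\<lambda>_. p"] by blast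
  have GM: "G \<in> cube_loops k M p"
    using continuous_map_compose[OF G(1) Ms_M[OF \<beta>(1)]] G(2) by (simp add: cube_loops_def)
  \<comment> \<open>Off the top face the glued map coincides with the constant homotopy
    \<open>F\<close>, so closeness has to be checked for \<open>G\<close> only.\<close>
  have "(y, glue_faces k p f G y) \<in> P'" if y: "y \<in> cube_boundary (Suc k)" for y
  proof (cases "y k = 1")
    case True
    have yC: "y \<in> topspace (cube (Suc k))" using y cube_boundary_subset by blast
    have "y(k := undefined) \<in> topspace (cube k)"
      using yC by (auto simp: mem_topspace_cube)
    from G(3)[OF this] have "((y(k := undefined))(k := 1), G (y(k := undefined))) \<in> P'"
      by (simp add: O1_def)
    moreover have "(y(k := undefined))(k := 1) = y" using True by auto
    ultimately show ?thesis using True by (simp add: glue_faces_def)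
  next
    case False
    then have "glue_faces k p f G y = F y"
      using y bdf by (auto simp: cube_boundary_Suc glue_faces_def F_def)
    then show ?thesis using P'(2) y cube_boundary_subset by auto
  qed
  from ext[OF continuous_map_glue_faces[OF f GM pM] this]
  obtain H where H: "continuous_map (cube (Suc k)) M H"
    "\<And>y. y \<in> cube_boundary (Suc k) \<Longrightarrow> H y = glue_faces k p f G y"
    by blast
  have "cube_homotopic k M p f G"
    by (rule cube_homotopic_extend_faces[OF H f GM])
  moreover have "G \<in> cube_loops k (Ms \<beta>) p" using G by (simp add: cube_loops_def)
  ultimately show ?thesis using \<beta> by blast
qed

section \<open>Direct limits and homotopy groups\<close>

text \<open>Elements with the same image under \<open>l\<close> can be moved to a common index and
  become equal at a later one, so every cocone takes the same value on them. Sets and groups share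
  this part of the universal property.\<close>

lemma direct_system_cocone_factors:
  assumes sys: "set_direct_system A leq S b"
    and compat: "\<And>\<alpha> \<beta> x. \<lbrakk>\<alpha> \<in> A; \<beta> \<in> A; leq \<alpha> \<beta>; x \<in> S \<alpha>\<rbrakk> \<Longrightarrow> l \<beta> (b \<alpha> \<beta> x) = l \<alpha> x"
    and inj: "\<And>\<alpha> x y. \<lbrakk>\<alpha> \<in> A; x \<in> S \<alpha>; y \<in> S \<alpha>; l \<alpha> x = l \<alpha> y\<rbrakk> \<Longrightarrow> \<exists>\<beta>\<in>A. leq \<alpha> \<beta> \<and> b \<alpha> \<beta> x = b \<alpha> \<beta> y"
    and f: "\<And>\<alpha> \<beta> x. \<lbrakk>\<alpha> \<in> A; \<beta> \<in> A; leq \<alpha> \<beta>; x \<in> S \<alpha>\<rbrakk> \<Longrightarrow> f \<beta> (b \<alpha> \<beta> x) = f \<alpha> x"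
  obtains h where "\<And>\<alpha> x. \<lbrakk>\<alpha> \<in> A; x \<in> S \<alpha>\<rbrakk> \<Longrightarrow> h (l \<alpha> x) = f \<alpha> x"
proof -
  have wd: "f \<alpha> x = f \<beta> y" if "\<alpha> \<in> A" "\<beta> \<in> A" "x \<in> S \<alpha>" "y \<in> S \<beta>" "l \<alpha> x = l \<beta> y" for \<alpha> \<beta> x y
  proof -
    obtain \<gamma> where \<gamma>: "\<gamma> \<in> A" "leq \<alpha> \<gamma>" "leq \<beta> \<gamma>"
      using sys \<open>\<alpha> \<in> A\<close> \<open>\<beta> \<in> A\<close> unfolding set_direct_system_def directed_set_def by meson
    have S: "b \<alpha> \<gamma> x \<in> S \<gamma>" "b \<beta> \<gamma> y \<in> S \<gamma>"
      using sys that \<gamma> unfolding set_direct_system_def by (meson Pi_mem)+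
    have "l \<gamma> (b \<alpha> \<gamma> x) = l \<gamma> (b \<beta> \<gamma> y)"
      using compat that \<gamma> by simp
    then obtain \<delta> where \<delta>: "\<delta> \<in> A" "leq \<gamma> \<delta>" "b \<gamma> \<delta> (b \<alpha> \<gamma> x) = b \<gamma> \<delta> (b \<beta> \<gamma> y)"
      using inj[OF \<gamma>(1) S] by blast
    have "f \<alpha> x = f \<gamma> (b \<alpha> \<gamma> x)" using f[OF that(1) \<gamma>(1,2) that(3)] by simp
    also have "\<dots> = f \<delta> (b \<gamma> \<delta> (b \<beta> \<gamma> y))" using f[OF \<gamma>(1) \<delta>(1,2) S(1)] \<delta>(3) by simp
    also have "\<dots> = f \<beta> y" using f[OF \<gamma>(1) \<delta>(1,2) S(2)] f[OF that(2) \<gamma>(1,3) that(4)] by simp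
    finally show ?thesis .
  qed
  \<comment> \<open>Outside the images of the maps \<open>l \<alpha>\<close> the choice is
    arbitrary; nothing is claimed there.\<close>
  define h where "h = (\<lambda>y. SOME z. \<exists>\<alpha>\<in>A. \<exists>x\<in>S \<alpha>. l \<alpha> x = y \<and> z = f \<alpha> x)"
  have "h (l \<alpha> x) = f \<alpha> x" if "\<alpha> \<in> A" "x \<in> S \<alpha>" for \<alpha> x
    unfolding h_def
  proof (rule some_equality)
    show "\<exists>\<beta>\<in>A. \<exists>y\<in>S \<beta>. l \<beta> y = l \<alpha> x \<and> f \<alpha> x = f \<beta> y" using that by blast
    show "z = f \<alpha> x" if "\<exists>\<beta>\<in>A. \<exists>y\<in>S \<beta>. l \<beta> y = l \<alpha> x \<and> z = f \<beta> y" for z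
      using that wd \<open>\<alpha> \<in> A\<close> \<open>x \<in> S \<alpha>\<close> by metis
  qed
  then show thesis by (rule that)
qed

text \<open>Eventual injectivity makes the factoring map well defined, joint surjectivity determines
  it and keeps its values in \<open>H\<close>.\<close>

lemma set_direct_limitI:
  assumes sys: "set_direct_system A leq S b"
    and l: "\<And>\<alpha>. \<alpha> \<in> A \<Longrightarrow> l \<alpha> \<in> S \<alpha> \<rightarrow> L"
    and compat: "\<And>\<alpha> \<beta> x. \<lbrakk>\<alpha> \<in> A; \<beta> \<in> A; leq \<alpha> \<beta>; x \<in> S \<alpha>\<rbrakk> \<Longrightarrow> l \<beta> (b \<alpha> \<beta> x) = l \<alpha> x"
    and surj: "\<And>y. y \<in> L \<Longrightarrow> \<exists>\<alpha>\<in>A. \<exists>x\<in>S \<alpha>. l \<alpha> x = y"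
    and inj: "\<And>\<alpha> x y. \<lbrakk>\<alpha> \<in> A; x \<in> S \<alpha>; y \<in> S \<alpha>; l \<alpha> x = l \<alpha> y\<rbrakk> \<Longrightarrow> \<exists>\<beta>\<in>A. leq \<alpha> \<beta> \<and> b \<alpha> \<beta> x = b \<alpha> \<beta> y"
  shows "set_direct_limit TYPE('h) A leq S b L l"
  unfolding set_direct_limit_def
proof (intro conjI ballI impI allI)
  fix H :: "'h set" and f
  assume f: "(\<forall>\<alpha>\<in>A. f \<alpha> \<in> S \<alpha> \<rightarrow> H) \<and>
     (\<forall>\<alpha>\<in>A. \<forall>\<beta>\<in>A. leq \<alpha> \<beta> \<longrightarrow> (\<forall>x\<in>S \<alpha>. f \<beta> (b \<alpha> \<beta> x) = f \<alpha> x))"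
  obtain h where h: "\<And>\<alpha> x. \<lbrakk>\<alpha> \<in> A; x \<in> S \<alpha>\<rbrakk> \<Longrightarrow> h (l \<alpha> x) = f \<alpha> x"
    by (rule direct_system_cocone_factors[OF sys compat inj, of f]) (use f in blast)+
  show "\<exists>!h. h \<in> L \<rightarrow>\<^sub>E H \<and> (\<forall>\<alpha>\<in>A. \<forall>x\<in>S \<alpha>. h (l \<alpha> x) = f \<alpha> x)"
  proof (rule ex1I)
    have "h y \<in> H" if "y \<in> L" for y
      using surj[OF that] h f by (metis Pi_mem)
    then show "restrict h L \<in> L \<rightarrow>\<^sub>E H \<and> (\<forall>\<alpha>\<in>A. \<forall>x\<in>S \<alpha>. restrict h L (l \<alpha> x) = f \<alpha> x)"
      using h l by (auto simp: Pi_iff)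
    show "h' = restrict h L" if "h' \<in> L \<rightarrow>\<^sub>E H \<and> (\<forall>\<alpha>\<in>A. \<forall>x\<in>S \<alpha>. h' (l \<alpha> x) = f \<alpha> x)" for h'
    proof
      show "h' y = restrict h L y" for y
        using that surj[of y] h by (cases "y \<in> L") (auto simp: PiE_iff extensional_def)
    qed
  qed
qed (use assms in auto)

lemma group_direct_limitI:
  assumes sys: "group_direct_system A leq G b" and L: "group L"
    and l: "\<And>\<alpha>. \<alpha> \<in> A \<Longrightarrow> l \<alpha> \<in> hom (G \<alpha>) L"
    and compat: "\<And>\<alpha> \<beta> x. \<lbrakk>\<alpha> \<in> A; \<beta> \<in> A; leq \<alpha> \<beta>; x \<in> carrier (G \<alpha>)\<rbrakk> \<Longrightarrow> l \<beta> (b \<alpha> \<beta> x) = l \<alpha> x"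
    and surj: "\<And>y. y \<in> carrier L \<Longrightarrow> \<exists>\<alpha>\<in>A. \<exists>x\<in>carrier (G \<alpha>). l \<alpha> x = y"
    and inj: "\<And>\<alpha> x y. \<lbrakk>\<alpha> \<in> A; x \<in> carrier (G \<alpha>); y \<in> carrier (G \<alpha>); l \<alpha> x = l \<alpha> y\<rbrakk> \<Longrightarrow>
      \<exists>\<beta>\<in>A. leq \<alpha> \<beta> \<and> b \<alpha> \<beta> x = b \<alpha> \<beta> y"
  shows "group_direct_limit TYPE('h) A leq G b L l"
  unfolding group_direct_limit_def
proof (intro conjI ballI impI allI)
  have set_sys: "set_direct_system A leq (\<lambda>\<alpha>. carrier (G \<alpha>)) b"
    using sys by (simp add: group_direct_system_def)
  fix H :: "'h monoid" and f
  assume f: "group H \<and> (\<forall>\<alpha>\<in>A. f \<alpha> \<in> hom (G \<alpha>) H) \<and>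
     (\<forall>\<alpha>\<in>A. \<forall>\<beta>\<in>A. leq \<alpha> \<beta> \<longrightarrow> (\<forall>x\<in>carrier (G \<alpha>). f \<beta> (b \<alpha> \<beta> x) = f \<alpha> x))"
  obtain h where h: "\<And>\<alpha> x. \<lbrakk>\<alpha> \<in> A; x \<in> carrier (G \<alpha>)\<rbrakk> \<Longrightarrow> h (l \<alpha> x) = f \<alpha> x"
    by (rule direct_system_cocone_factors[OF set_sys compat inj, of f]) (use f in blast)+
  have l_in: "l \<alpha> x \<in> carrier L" if "\<alpha> \<in> A" "x \<in> carrier (G \<alpha>)" for \<alpha> x
    using l that by (meson hom_in_carrier)
  \<comment> \<open>Two elements of the limit are represented at one common index, where their
    product can be formed before it is mapped to \<open>H\<close>.\<close>
  have common: "\<exists>\<gamma>\<in>A. \<exists>x\<in>carrier (G \<gamma>). \<exists>y\<in>carrier (G \<gamma>). l \<gamma> x = u \<and> l \<gamma> y = v"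
    if uv: "u \<in> carrier L" "v \<in> carrier L" for u v
  proof -
    obtain \<alpha> x where x: "\<alpha> \<in> A" "x \<in> carrier (G \<alpha>)" "l \<alpha> x = u" using surj[OF uv(1)] by blast
    obtain \<beta> y where y: "\<beta> \<in> A" "y \<in> carrier (G \<beta>)" "l \<beta> y = v" using surj[OF uv(2)] by blast
    obtain \<gamma> where \<gamma>: "\<gamma> \<in> A" "leq \<alpha> \<gamma>" "leq \<beta> \<gamma>"
      using set_sys x(1) y(1) unfolding set_direct_system_def directed_set_def by meson
    have "b \<alpha> \<gamma> x \<in> carrier (G \<gamma>)" "b \<beta> \<gamma> y \<in> carrier (G \<gamma>)"
      using set_sys x y \<gamma> unfolding set_direct_system_def by (meson Pi_mem)+
    then show ?thesis using compat x y \<gamma> by metis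
  qed
  show "\<exists>!h. h \<in> hom L H \<and> h \<in> extensional (carrier L) \<and>
     (\<forall>\<alpha>\<in>A. \<forall>x\<in>carrier (G \<alpha>). h (l \<alpha> x) = f \<alpha> x)"
  proof (rule ex1I)
    have hH: "h u \<in> carrier H" if "u \<in> carrier L" for u
      using surj[OF that] h f by (metis hom_in_carrier)
    have h_mult: "h (u \<otimes>\<^bsub>L\<^esub> v) = h u \<otimes>\<^bsub>H\<^esub> h v" if "u \<in> carrier L" "v \<in> carrier L" for u v
    proof -
      obtain \<gamma> x y where xy: "\<gamma> \<in> A" "x \<in> carrier (G \<gamma>)" "y \<in> carrier (G \<gamma>)" "l \<gamma> x = u" "l \<gamma> y = v"
        using common[OF \<open>u \<in> carrier L\<close> \<open>v \<in> carrier L\<close>] by blast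
      interpret G: group "G \<gamma>" using sys xy(1) by (simp add: group_direct_system_def)
      have "u \<otimes>\<^bsub>L\<^esub> v = l \<gamma> (x \<otimes>\<^bsub>G \<gamma>\<^esub> y)"
        using hom_mult[OF l[OF xy(1)] xy(2,3)] xy by simp
      then have "h (u \<otimes>\<^bsub>L\<^esub> v) = f \<gamma> (x \<otimes>\<^bsub>G \<gamma>\<^esub> y)"
        using h[OF xy(1)] xy by simp
      also have "\<dots> = f \<gamma> x \<otimes>\<^bsub>H\<^esub> f \<gamma> y"
        using hom_mult[OF _ xy(2,3), of "f \<gamma>" H] f xy(1) by simp
      finally show ?thesis using h xy by metis
    qed
    have closed: "u \<otimes>\<^bsub>L\<^esub> v \<in> carrier L" if "u \<in> carrier L" "v \<in> carrier L" for u v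
      using that L by (meson group.is_monoid monoid.m_closed)
    show "restrict h (carrier L) \<in> hom L H \<and> restrict h (carrier L) \<in> extensional (carrier L) \<and>
        (\<forall>\<alpha>\<in>A. \<forall>x\<in>carrier (G \<alpha>). restrict h (carrier L) (l \<alpha> x) = f \<alpha> x)"
      using h hH h_mult l_in closed by (auto intro!: homI)
    show "h' = restrict h (carrier L)"
      if "h' \<in> hom L H \<and> h' \<in> extensional (carrier L) \<and> (\<forall>\<alpha>\<in>A. \<forall>x\<in>carrier (G \<alpha>). h' (l \<alpha> x) = f \<alpha> x)" for h'
    proof
      show "h' y = restrict h (carrier L) y" for y
        using that surj[of y] h by (cases "y \<in> carrier L") (auto simp: extensional_def)
    qed
  qed
qed (use assms in auto)

section \<open>The group structure on homotopy classes of cube loops\<close>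

lemma cube_homotopic_refl: "f \<in> cube_loops k X p \<Longrightarrow> cube_homotopic k X p f f"
  by (simp add: cube_homotopic_def cube_loops_def)

lemma cube_homotopic_sym: "cube_homotopic k X p f g \<Longrightarrow> cube_homotopic k X p g f"
  by (simp add: cube_homotopic_def homotopic_with_sym)

lemma cube_homotopic_trans:
  "\<lbrakk>cube_homotopic k X p f g; cube_homotopic k X p g h\<rbrakk> \<Longrightarrow> cube_homotopic k X p f h"
  unfolding cube_homotopic_def by (rule homotopic_with_trans)

lemma cube_homotopic_cong:
  assumes "\<And>x. x \<in> topspace (cube k) \<Longrightarrow> f x = f' x" "\<And>x. x \<in> topspace (cube k) \<Longrightarrow> g x = g' x"
  shows "cube_homotopic k X p f g \<longleftrightarrow> cube_homotopic k X p f' g'"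
  unfolding cube_homotopic_iff using assms by simp

lemma cube_homotopic_mono:
  assumes "continuous_map X Y id" "cube_homotopic k X p f g"
  shows "cube_homotopic k Y p f g"
  using assms homotopic_with_compose_continuous_map_left[OF _ assms(1)]
  unfolding cube_homotopic_def by fastforce

text \<open>A map that is not a loop has the empty class, so equality of classes yields a homotopy
  only if \<open>f\<close> is a loop.\<close>

lemma cube_class_eq_iff:
  assumes "f \<in> cube_loops k X p"
  shows "cube_class k X p f = cube_class k X p g \<longleftrightarrow> cube_homotopic k X p f g"
  unfolding cube_class_def
  using cube_homotopic_refl[OF assms] cube_homotopic_sym cube_homotopic_trans by (metis mem_Collect_eq subsetI equalityI)

lemma homotopy_incl_class:
  assumes "continuous_map X Y id" "f \<in> cube_loops k X p"
  shows "homotopy_incl k Y p (cube_class k X p f) = cube_class k Y p f"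
  unfolding homotopy_incl_def cube_class_def
  using cube_homotopic_refl[OF assms(2)] cube_homotopic_mono[OF assms(1)] cube_homotopic_trans
  by (metis (no_types, lifting) mem_Collect_eq)

lemma continuous_map_upd_first:
  assumes "0 < k" and c: "continuous_map Z (cube k) c" and e: "continuous_map Z (top_of_set {0..1}) e"
  shows "continuous_map Z (cube k) (\<lambda>z. (c z)(0 := e z))"
  unfolding cube_def continuous_map_componentwise
proof (intro conjI ballI)
  show "(\<lambda>z. (c z)(0 := e z)) ` topspace Z \<subseteq> extensional {..<k}"
  proof
    fix y assume "y \<in> (\<lambda>z. (c z)(0 := e z)) ` topspace Z"
    then obtain z where z: "z \<in> topspace Z" "y = (c z)(0 := e z)" by blast
    then have "c z \<in> topspace (cube k)" using continuous_map_image_subset_topspace[OF c] by blast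
    then show "y \<in> extensional {..<k}" using z(2) \<open>0 < k\<close> by (auto simp: mem_topspace_cube extensional_def)
  qed
  fix i assume "i \<in> {..<k}"
  then have "continuous_map (cube k) (top_of_set {0..1}) (\<lambda>x. x i)"
    unfolding cube_def by (rule continuous_map_product_projection)
  from continuous_map_compose[OF c this]
  show "continuous_map Z (top_of_set {0..1}) (\<lambda>z. ((c z)(0 := e z)) i)"
    using e by (cases "i = 0") (simp_all add: o_def)
qed

lemma continuous_map_cube_first: "0 < k \<Longrightarrow> continuous_map (cube k) (top_of_set {0..1}) (\<lambda>x. x 0)"
  unfolding cube_def by (rule continuous_map_product_projection) simp

lemma upd_first_cube: "\<lbrakk>x \<in> topspace (cube k); 0 < k; s \<in> {0..1}\<rbrakk> \<Longrightarrow> x(0 := s) \<in> topspace (cube k)"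
  by (auto simp: mem_topspace_cube)

lemma upd_first_boundary:
  assumes x: "x \<in> cube_boundary k" and s: "s \<in> {0..1}"
    and "x 0 = 0 \<or> x 0 = 1 \<Longrightarrow> s = 0 \<or> s = 1"
  shows "x(0 := s) \<in> cube_boundary k"
proof -
  obtain i where i: "i < k" "x i = 0 \<or> x i = 1" using x by (auto simp: cube_boundary_def)
  have "x(0 := s) \<in> topspace (cube k)"
    using x s i by (intro upd_first_cube) (auto simp: cube_boundary_def)
  moreover have "(x(0 := s)) i = 0 \<or> (x(0 := s)) i = 1" using i assms(3) by (cases "i = 0") auto
  ultimately show ?thesis using i(1) unfolding cube_boundary_def by blast
qed

lemma cube_loops_first:
  assumes "f \<in> cube_loops k X p" "x \<in> topspace (cube k)" "0 < k" "s = 0 \<or> s = 1"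
  shows "f (x(0 := s)) = p"
proof -
  have "x(0 := s) \<in> topspace (cube k)" using assms by (intro upd_first_cube) auto
  then have "x(0 := s) \<in> cube_boundary k"
    using assms(3,4) unfolding cube_boundary_def by (auto intro!: exI[of _ 0])
  then show ?thesis using assms(1) by (auto simp: cube_loops_def)
qed

text \<open>Two reparametrisations of the first coordinate are joined by segments in the unit
  interval. Their common values at 0 and 1 are again 0 or 1, which keeps the two faces in the first
  coordinate inside the boundary; the other faces are not affected. Since the ends need not be fixed
  or even distinct, the laws for associativity, unit and inverse are all instances.\<close>

lemma cube_homotopic_reparametrize:
  assumes k: "0 < k" and f: "f \<in> cube_loops k X p"
    and u: "continuous_on {0..1} u" "u \<in> {0..1} \<rightarrow> {0..1}" and v: "continuous_on {0..1} v" "v \<in> {0..1} \<rightarrow> {0..1}"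
    and uv: "u 0 = v 0" "u 1 = v 1" "u 0 = 0 \<or> u 0 = (1::real)" "u 1 = 0 \<or> u 1 = 1"
  shows "cube_homotopic k X p (\<lambda>x. f (x(0 := u (x 0)))) (\<lambda>x. f (x(0 := v (x 0))))"
  unfolding cube_homotopic_iff
proof (intro exI conjI ballI)
  let ?Z = "prod_topology (top_of_set {0..1::real}) (cube k)"
  let ?w = "\<lambda>z. (1 - fst z) * u (snd z 0) + fst z * v (snd z 0)"
  have w_in: "(1 - t) * u s + t * v s \<in> {0..1}" if "t \<in> {0..1}" "s \<in> {0..1}" for s t
  proof (rule convexD[OF convex_closed_interval, of "u s" 0 1 "v s" "1 - t" t, unfolded real_scaleR_def])
    show "u s \<in> {0..1}" "v s \<in> {0..1}" using that u(2) v(2) by (blast dest: Pi_mem)+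
  qed (use that in auto)
  have first: "continuous_map ?Z (top_of_set {0..1}) (\<lambda>z. snd z 0)"
    using continuous_map_compose[OF continuous_map_snd continuous_map_cube_first[OF k]] by (simp add: o_def)
  have "continuous_map (top_of_set {0..1}) euclideanreal u" "continuous_map (top_of_set {0..1}) euclideanreal v"
    using u v by simp_all
  from this[THEN continuous_map_compose[OF first]]
  have "continuous_map ?Z euclideanreal (\<lambda>z. u (snd z 0))" "continuous_map ?Z euclideanreal (\<lambda>z. v (snd z 0))"
    by (simp_all add: o_def)
  moreover have "continuous_map ?Z euclideanreal fst"
    using continuous_map_fst continuous_map_into_fulltopology by blast
  ultimately have "continuous_map ?Z euclideanreal ?w"
    by (intro continuous_map_add continuous_map_real_mult continuous_map_diff) auto
  then have "continuous_map ?Z (top_of_set {0..1}) ?w"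
    using w_in k by (auto simp: continuous_map_in_subtopology mem_topspace_cube)
  from continuous_map_compose[OF continuous_map_upd_first[OF k continuous_map_snd this], of X f]
  show "continuous_map ?Z X (\<lambda>z. f ((snd z)(0 := ?w z)))"
    using f by (simp add: o_def cube_loops_def)
  fix x t
  show "f ((snd (0, x))(0 := ?w (0, x))) = f (x(0 := u (x 0)))" "f ((snd (1, x))(0 := ?w (1, x))) = f (x(0 := v (x 0)))"
    by simp_all
  assume t: "t \<in> {0..1::real}" and x: "x \<in> cube_boundary k"
  have "x 0 \<in> {0..1}" using x k by (auto simp: cube_boundary_def mem_topspace_cube)
  then have "x(0 := ?w (t, x)) \<in> cube_boundary k"
    using uv w_in[OF t] by (intro upd_first_boundary[OF x]) (auto simp: algebra_simps)
  then show "f ((snd (t, x))(0 := ?w (t, x))) = p"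
    using f by (simp add: cube_loops_def)
qed

text \<open>This makes the product of classes independent of representatives. At first coordinate
  1/2 both halves take the value \<open>p\<close>, so the two homotopies can be pasted
  there.\<close>

lemma cube_homotopic_concat:
  assumes k: "0 < k" and f: "cube_homotopic k X p f f'" and g: "cube_homotopic k X p g g'"
  shows "cube_homotopic k X p (cube_concat f g) (cube_concat f' g')"
proof -
  let ?Z = "prod_topology (top_of_set {0..1::real}) (cube k)"
  obtain H where H: "continuous_map ?Z X H" "\<forall>x\<in>topspace (cube k). H (0, x) = f x"
    "\<forall>x\<in>topspace (cube k). H (1, x) = f' x" "\<forall>t\<in>{0..1}. \<forall>x\<in>cube_boundary k. H (t, x) = p"
    using f unfolding cube_homotopic_iff by blast
  obtain K where K: "continuous_map ?Z X K" "\<forall>x\<in>topspace (cube k). K (0, x) = g x"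
    "\<forall>x\<in>topspace (cube k). K (1, x) = g' x" "\<forall>t\<in>{0..1}. \<forall>x\<in>cube_boundary k. K (t, x) = p"
    using g unfolding cube_homotopic_iff by blast
  let ?h = "\<lambda>z. if snd z 0 \<le> 1/2 then H (fst z, (snd z)(0 := 2 * snd z 0))
                 else K (fst z, (snd z)(0 := 2 * snd z 0 - 1))"
  have first: "continuous_map ?Z euclideanreal (\<lambda>z. snd z 0)"
    using continuous_map_compose[OF continuous_map_snd continuous_map_cube_first[OF k]]
    by (auto simp: o_def dest: continuous_map_into_fulltopology)
  have first_in: "snd z 0 \<in> {0..1}" if "z \<in> topspace ?Z" for z
    using that k by (auto simp: mem_topspace_cube)
  have half: "continuous_map (subtopology ?Z S) X (\<lambda>z. J (fst z, (snd z)(0 := 2 * snd z 0 - c)))"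
    if J: "continuous_map ?Z X J" and S: "\<And>z. z \<in> topspace ?Z \<Longrightarrow> z \<in> S \<Longrightarrow> 2 * snd z 0 - c \<in> {0..1}" for S J c
  proof -
    have "continuous_map (subtopology ?Z S) euclideanreal (\<lambda>z. 2 * snd z 0 - c)"
      by (intro continuous_map_diff continuous_map_real_mult continuous_map_from_subtopology[OF first]) auto
    then have "continuous_map (subtopology ?Z S) (top_of_set {0..1}) (\<lambda>z. 2 * snd z 0 - c)"
      using S by (auto simp: continuous_map_in_subtopology)
    from continuous_map_upd_first[OF k continuous_map_from_subtopology[OF continuous_map_snd] this]
    have "continuous_map (subtopology ?Z S) ?Z (\<lambda>z. (fst z, (snd z)(0 := 2 * snd z 0 - c)))"
      by (intro continuous_map_pairedI continuous_map_from_subtopology[OF continuous_map_fst])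
    from continuous_map_compose[OF this J] show ?thesis by (simp add: o_def)
  qed
  have bd: "x(0 := s) \<in> cube_boundary k" if "x \<in> topspace (cube k)" "s = 0 \<or> s = 1" for x s
  proof -
    have "x(0 := s) \<in> topspace (cube k)" using that k by (intro upd_first_cube) auto
    then show ?thesis using that k unfolding cube_boundary_def by (auto intro!: exI[of _ 0])
  qed
  have "continuous_map ?Z X ?h"
  proof (rule continuous_map_cases_le[OF first])
    show "continuous_map ?Z euclideanreal (\<lambda>z. 1/2)" by simp
    show "continuous_map (subtopology ?Z {z \<in> topspace ?Z. snd z 0 \<le> 1/2}) X (\<lambda>z. H (fst z, (snd z)(0 := 2 * snd z 0)))"
      using half[OF H(1), of "{z \<in> topspace ?Z. snd z 0 \<le> 1/2}" 0] first_in by simp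
    show "continuous_map (subtopology ?Z {z \<in> topspace ?Z. 1/2 \<le> snd z 0}) X (\<lambda>z. K (fst z, (snd z)(0 := 2 * snd z 0 - 1)))"
      using half[OF K(1), of "{z \<in> topspace ?Z. 1/2 \<le> snd z 0}" 1] first_in by simp
    show "H (fst z, (snd z)(0 := 2 * snd z 0)) = K (fst z, (snd z)(0 := 2 * snd z 0 - 1))"
      if "z \<in> topspace ?Z" "snd z 0 = 1/2" for z
    proof -
      have "2 * snd z 0 = 1" using that(2) by simp
      then show ?thesis using that(1) bd[of "snd z" 1] bd[of "snd z" 0] H(4) K(4) by auto
    qed
  qed
  moreover have "?h (0, x) = cube_concat f g x" "?h (1, x) = cube_concat f' g' x" if "x \<in> topspace (cube k)" for x
  proof -
    have "x 0 \<in> {0..1}" using that k by (auto simp: mem_topspace_cube)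
    then have "x 0 \<le> 1/2 \<Longrightarrow> x(0 := 2 * x 0) \<in> topspace (cube k)"
      "\<not> x 0 \<le> 1/2 \<Longrightarrow> x(0 := 2 * x 0 - 1) \<in> topspace (cube k)"
      using that k by (auto intro!: upd_first_cube)
    then show "?h (0, x) = cube_concat f g x" "?h (1, x) = cube_concat f' g' x"
      using H(2,3) K(2,3) by (auto simp: cube_concat_def)
  qed
  moreover have "?h (t, x) = p" if t: "t \<in> {0..1}" and x: "x \<in> cube_boundary k" for t x
  proof -
    have "x 0 \<in> {0..1}" using x k by (auto simp: cube_boundary_def mem_topspace_cube)
    then have "x 0 \<le> 1/2 \<Longrightarrow> x(0 := 2 * x 0) \<in> cube_boundary k"
      "\<not> x 0 \<le> 1/2 \<Longrightarrow> x(0 := 2 * x 0 - 1) \<in> cube_boundary k"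
      by (auto intro!: upd_first_boundary[OF x])
    then show ?thesis using H(4) K(4) t by auto
  qed
  ultimately show ?thesis unfolding cube_homotopic_iff by (intro exI[of _ ?h]) blast
qed

text \<open>Loops are exactly the maps homotopic to themselves, so the diagonal case of
  \<open>cube_homotopic_concat\<close> suffices.\<close>

lemma cube_concat_loops:
  "\<lbrakk>0 < k; f \<in> cube_loops k X p; g \<in> cube_loops k X p\<rbrakk> \<Longrightarrow> cube_concat f g \<in> cube_loops k X p"
  using cube_homotopic_concat[of k X p f f g g] cube_homotopic_refl cube_homotopic_imp_cube_loops by metis

lemma const_cube_loop: "p \<in> topspace X \<Longrightarrow> (\<lambda>_. p) \<in> cube_loops k X p"
  by (simp add: cube_loops_def)

lemma homotopy_group_simps [simp]:
  "carrier (homotopy_group k X p) = cube_class k X p ` cube_loops k X p"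
  "\<one>\<^bsub>homotopy_group k X p\<^esub> = cube_class k X p (\<lambda>_. p)"
  by (simp_all add: homotopy_group_def)

lemma homotopy_group_mult:
  assumes "0 < k" "f \<in> cube_loops k X p" "g \<in> cube_loops k X p"
  shows "cube_class k X p f \<otimes>\<^bsub>homotopy_group k X p\<^esub> cube_class k X p g = cube_class k X p (cube_concat f g)"
proof -
  have "(\<exists>f'. cube_homotopic k X p f f' \<and> (\<exists>g'. cube_homotopic k X p g g' \<and> cube_homotopic k X p (cube_concat f' g') h))
      \<longleftrightarrow> cube_homotopic k X p (cube_concat f g) h" for h
    using cube_homotopic_concat[OF assms(1)] cube_homotopic_refl[OF assms(2)] cube_homotopic_refl[OF assms(3)]
      cube_homotopic_trans by metis
  then show ?thesis by (simp add: homotopy_group_def cube_class_def)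
qed

lemma cube_concat_assoc:
  assumes "0 < k" "f \<in> cube_loops k X p" "g \<in> cube_loops k X p" "h \<in> cube_loops k X p"
  shows "cube_homotopic k X p (cube_concat (cube_concat f g) h) (cube_concat f (cube_concat g h))"
proof -
  \<comment> \<open>The piecewise linear map taking the breakpoints 1/4 and 1/2 of the left
    bracketing to the breakpoints 1/2 and 3/4 of the right one. Its slopes 2, 1, 1/2 decrease, so it
    is the minimum of the three linear pieces.\<close>
  define u :: "real \<Rightarrow> real" where "u = (\<lambda>t. min (2 * t) (min (t + 1/4) ((t + 1) / 2)))"
  have "cube_homotopic k X p (\<lambda>x. cube_concat f (cube_concat g h) (x(0 := u (x 0))))
     (\<lambda>x. cube_concat f (cube_concat g h) (x(0 := x 0)))"
  proof (rule cube_homotopic_reparametrize[where v = "\<lambda>t. t"])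
    show "cube_concat f (cube_concat g h) \<in> cube_loops k X p"
      by (intro cube_concat_loops assms)
    show "continuous_on {0..1} u" unfolding u_def by (intro continuous_intros) simp_all
  qed (use assms in \<open>auto simp: u_def min_def\<close>)
  moreover have "cube_concat f (cube_concat g h) (x(0 := u (x 0))) = cube_concat (cube_concat f g) h x" for x
  proof -
    consider "x 0 \<le> 1/4" | "1/4 < x 0" "x 0 \<le> 1/2" | "1/2 < x 0" by linarith
    then show ?thesis
    proof cases
      case 1
      then have "u (x 0) = 2 * x 0" by (simp add: u_def min_def)
      then show ?thesis using 1 by (simp add: cube_concat_def)
    next
      case 2
      then have "u (x 0) = x 0 + 1/4" by (simp add: u_def min_def)
      then show ?thesis using 2 by (simp add: cube_concat_def algebra_simps)
    next
      case 3
      then have "u (x 0) = (x 0 + 1) / 2" by (simp add: u_def min_def)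
      then show ?thesis using 3 by (simp add: cube_concat_def algebra_simps)
    qed
  qed
  ultimately show ?thesis by simp
qed

lemma cube_concat_const_left:
  assumes "0 < k" "f \<in> cube_loops k X p"
  shows "cube_homotopic k X p (cube_concat (\<lambda>_. p) f) f"
proof -
  \<comment> \<open>Rests at 0 during the first half, then runs through the interval at double
    speed. During the rest \<open>f\<close> takes the value \<open>p\<close> at points of the cube,
    so agreement with the concatenation is shown on the cube only.\<close>
  define u :: "real \<Rightarrow> real" where "u = (\<lambda>t. max (2 * t - 1) 0)"
  have "cube_homotopic k X p (\<lambda>x. f (x(0 := u (x 0)))) (\<lambda>x. f (x(0 := x 0)))"
  proof (rule cube_homotopic_reparametrize[where v = "\<lambda>t. t"])
    show "continuous_on {0..1} u" unfolding u_def by (intro continuous_intros)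
  qed (use assms in \<open>auto simp: u_def max_def\<close>)
  moreover have "f (x(0 := u (x 0))) = cube_concat (\<lambda>_. p) f x" if "x \<in> topspace (cube k)" for x
    using cube_loops_first[OF assms(2) that assms(1), of 0] by (auto simp: cube_concat_def u_def max_def)
  ultimately show ?thesis by (subst cube_homotopic_cong[of k _ "\<lambda>x. f (x(0 := u (x 0)))" _ f]) auto
qed

lemma cube_concat_reverse_left:
  assumes "0 < k" "f \<in> cube_loops k X p"
  shows "cube_homotopic k X p (cube_concat (\<lambda>x. f (x(0 := 1 - x 0))) f) (\<lambda>_. p)"
proof -
  \<comment> \<open>Runs from 1 down to 0 and back to 1. Both ends being 1, it can be deformed into
    the constant 1, on which \<open>f\<close> has the value \<open>p\<close>.\<close>
  define u :: "real \<Rightarrow> real" where "u = (\<lambda>t. \<bar>2 * t - 1\<bar>)"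
  have "cube_homotopic k X p (\<lambda>x. f (x(0 := u (x 0)))) (\<lambda>x. f (x(0 := 1)))"
  proof (rule cube_homotopic_reparametrize[where v = "\<lambda>t. 1"])
    show "continuous_on {0..1} u" unfolding u_def by (intro continuous_intros)
  qed (use assms in \<open>auto simp: u_def abs_if\<close>)
  moreover have "f (x(0 := u (x 0))) = cube_concat (\<lambda>x. f (x(0 := 1 - x 0))) f x" for x
    by (cases "x 0 \<le> 1/2") (auto simp: cube_concat_def u_def abs_of_nonpos)
  moreover have "f (x(0 := 1)) = p" if "x \<in> topspace (cube k)" for x
    using cube_loops_first[OF assms(2) that assms(1)] by simp
  ultimately show ?thesis
    by (subst cube_homotopic_cong[of k _ "\<lambda>x. f (x(0 := u (x 0)))" _ "\<lambda>x. f (x(0 := 1))"]) auto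
qed

lemma group_homotopy_group:
  assumes k: "0 < k" and p: "p \<in> topspace X"
  shows "group (homotopy_group k X p)"
proof (rule groupI)
  note mult = homotopy_group_mult[OF k]
  note const = const_cube_loop[OF p]
  fix a assume "a \<in> carrier (homotopy_group k X p)"
  then obtain f where f: "f \<in> cube_loops k X p" "a = cube_class k X p f" by auto
  show "\<one>\<^bsub>homotopy_group k X p\<^esub> \<otimes>\<^bsub>homotopy_group k X p\<^esub> a = a"
    using f const cube_concat_const_left[OF k f(1)]
    by (simp add: mult cube_class_eq_iff cube_concat_loops k)
  \<comment> \<open>A homotopy of the reversed map to itself, given by reparametrising twice in the
    same way, certifies that it is a loop.\<close>
  have "(\<lambda>x. f (x(0 := 1 - x 0))) \<in> cube_loops k X p"
  proof -
    have "cube_homotopic k X p (\<lambda>x. f (x(0 := 1 - x 0))) (\<lambda>x. f (x(0 := 1 - x 0)))"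
      by (rule cube_homotopic_reparametrize[OF k f(1)]) (auto intro!: continuous_intros)
    then show ?thesis by (rule cube_homotopic_imp_cube_loops)
  qed
  then show "\<exists>b\<in>carrier (homotopy_group k X p). b \<otimes>\<^bsub>homotopy_group k X p\<^esub> a = \<one>\<^bsub>homotopy_group k X p\<^esub>"
    using f cube_concat_reverse_left[OF k f(1)]
    by (intro bexI[of _ "cube_class k X p (\<lambda>x. f (x(0 := 1 - x 0)))"])
      (auto simp: mult cube_class_eq_iff cube_concat_loops k)
  fix b assume "b \<in> carrier (homotopy_group k X p)"
  then obtain g where g: "g \<in> cube_loops k X p" "b = cube_class k X p g" by auto
  show "a \<otimes>\<^bsub>homotopy_group k X p\<^esub> b \<in> carrier (homotopy_group k X p)"
    using f g by (simp add: mult cube_concat_loops k)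
  fix c assume "c \<in> carrier (homotopy_group k X p)"
  then obtain h where h: "h \<in> cube_loops k X p" "c = cube_class k X p h" by auto
  show "a \<otimes>\<^bsub>homotopy_group k X p\<^esub> b \<otimes>\<^bsub>homotopy_group k X p\<^esub> c =
      a \<otimes>\<^bsub>homotopy_group k X p\<^esub> (b \<otimes>\<^bsub>homotopy_group k X p\<^esub> c)"
    using f g h cube_concat_assoc[OF k f(1) g(1) h(1)]
    by (simp add: mult cube_class_eq_iff cube_concat_loops k)
next
  show "\<one>\<^bsub>homotopy_group k X p\<^esub> \<in> carrier (homotopy_group k X p)"
    using const_cube_loop[OF p] by simp
qed

lemma homotopy_incl_hom:
  assumes k: "0 < k" and XY: "continuous_map X Y id"
  shows "homotopy_incl k Y p \<in> hom (homotopy_group k X p) (homotopy_group k Y p)"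
proof -
  have loops: "f \<in> cube_loops k Y p" if "f \<in> cube_loops k X p" for f
    using that continuous_map_compose[OF _ XY, of "cube k" f] by (auto simp: cube_loops_def)
  show ?thesis
    by (auto intro!: homI simp: homotopy_incl_class[OF XY] homotopy_group_mult[OF k] cube_concat_loops[OF k] loops)
qed

section \<open>Path components and the direct limit theorem\<close>

text \<open>The 0-cube is a single point with empty boundary, so no condition at the base point
  remains. Through this equivalence the two comparison results for loops also cover degree
  0.\<close>

lemma path_component_of_iff_cube_homotopic:
  "path_component_of X x y \<longleftrightarrow> cube_homotopic 0 X p (\<lambda>_. x) (\<lambda>_. y)"
proof -
  have "(\<lambda>_. undefined) \<in> topspace (cube 0)" by (simp add: mem_topspace_cube)
  then have "cube 0 \<noteq> trivial_topology" by auto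
  moreover have "cube_boundary 0 = {}" by (simp add: cube_boundary_def)
  ultimately show ?thesis by (simp add: cube_homotopic_def homotopic_constant_maps)
qed

lemma path_component_of_id_mono:
  "\<lbrakk>continuous_map X Y id; path_component_of X x y\<rbrakk> \<Longrightarrow> path_component_of Y x y"
  using cube_homotopic_mono path_component_of_iff_cube_homotopic by metis

lemma path_components_incl_class:
  assumes "continuous_map X Y id" "x \<in> topspace X"
  shows "path_components_incl Y (path_component_of_set X x) = path_component_of_set Y x"
proof -
  have "path_component_of X x x" using assms(2) by (simp add: path_component_of_refl)
  moreover have "path_component_of Y x z" if "path_component_of X x y" "path_component_of Y y z" for y z
    by (rule path_component_of_trans[OF path_component_of_id_mono[OF assms(1) that(1)] that(2)])
  ultimately have "(\<exists>y. path_component_of X x y \<and> path_component_of Y y z) \<longleftrightarrow> path_component_of Y x z" for z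
    by meson
  then show ?thesis by (simp add: path_components_incl_def)
qed

lemma path_component_of_in_stage:
  assumes fam: "dense_directed_family M A leq Ms" and lcf: "locally_cone_fillable M A leq Ms"
    and \<alpha>: "\<alpha> \<in> A" and xy: "x \<in> topspace (Ms \<alpha>)" "y \<in> topspace (Ms \<alpha>)" "path_component_of M x y"
  shows "\<exists>\<beta>\<in>A. leq \<alpha> \<beta> \<and> path_component_of (Ms \<beta>) x y"
proof -
  have "(\<lambda>_. z) \<in> cube_loops 0 X x" if "z \<in> topspace X" for z and X :: "'a topology"
    using that by (simp add: cube_loops_def cube_boundary_def)
  then show ?thesis
    using cube_homotopic_in_stage[OF fam lcf \<alpha> xy(1), of "\<lambda>_. x" 0 "\<lambda>_. y"] xy
    unfolding path_component_of_iff_cube_homotopic[where p = x] by blast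
qed

lemma path_component_of_stage_point:
  assumes fam: "dense_directed_family M A leq Ms" and lcf: "locally_cone_fillable M A leq Ms"
    and lcf0: "locally_cone_fillable M {()} (\<lambda>_ _. True) (\<lambda>_. M)"
    and \<alpha>: "\<alpha> \<in> A" "p \<in> topspace (Ms \<alpha>)" and y: "y \<in> topspace M"
  shows "\<exists>\<beta>\<in>A. leq \<alpha> \<beta> \<and> (\<exists>x\<in>topspace (Ms \<beta>). path_component_of M x y)"
proof -
  have "(\<lambda>_. y) \<in> cube_loops 0 M p"
    using y by (simp add: cube_loops_def cube_boundary_def)
  from cube_loop_homotopic_into_stage[OF fam lcf lcf0 \<alpha> this]
  obtain \<beta> g where \<beta>: "\<beta> \<in> A" "leq \<alpha> \<beta>" and g: "g \<in> cube_loops 0 (Ms \<beta>) p"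
    "cube_homotopic 0 M p (\<lambda>_. y) g"
    by blast
  \<comment> \<open>The only point of \<open>cube 0\<close>; the approximating map is evaluated
    there.\<close>
  let ?o = "\<lambda>_::nat. undefined :: real"
  have "x = ?o" if "x \<in> topspace (cube 0)" for x
    using that by (auto simp: mem_topspace_cube)
  then have "cube_homotopic 0 M p (\<lambda>_. y) (\<lambda>_. g ?o)"
    using g(2) by (subst cube_homotopic_cong[of 0 _ "\<lambda>_. y" _ g]) auto
  then have "path_component_of M (g ?o) y"
    by (simp add: path_component_of_iff_cube_homotopic[where p = p] cube_homotopic_sym)
  moreover have "g ?o \<in> topspace (Ms \<beta>)"
    using g(1) by (auto simp: cube_loops_def mem_topspace_cube dest!: continuous_map_image_subset_topspace)
  ultimately show ?thesis using \<beta> by blast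
qed

section \<open>Path components of topological groups\<close>

lemma path_component_of_mult:
  assumes G: "topological_group X G" and "path_component_of X x x'" "path_component_of X y y'"
  shows "path_component_of X (x \<otimes>\<^bsub>G\<^esub> y) (x' \<otimes>\<^bsub>G\<^esub> y')"
proof -
  obtain f g where f: "pathin X f" "f 0 = x" "f 1 = x'" and g: "pathin X g" "g 0 = y" "g 1 = y'"
    using assms(2,3) by (auto simp: path_component_of_def)
  have "continuous_map (prod_topology X X) X (\<lambda>(x, y). x \<otimes>\<^bsub>G\<^esub> y)"
    using G by (simp add: topological_group_def)
  from continuous_map_compose[OF continuous_map_pairedI this] f(1) g(1)
  have "pathin X (\<lambda>t. f t \<otimes>\<^bsub>G\<^esub> g t)" by (simp add: pathin_def o_def)
  then show ?thesis
    unfolding path_component_of_def using f g by (intro exI[of _ "\<lambda>t. f t \<otimes>\<^bsub>G\<^esub> g t"]) simp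
qed

lemma path_component_group_simps [simp]:
  "carrier (path_component_group X G) = path_components_of X"
  "\<one>\<^bsub>path_component_group X G\<^esub> = path_component_of_set X \<one>\<^bsub>G\<^esub>"
  by (simp_all add: path_component_group_def)

lemma path_component_group_mult:
  assumes G: "topological_group X G" and x: "x \<in> topspace X" and y: "y \<in> topspace X"
  shows "path_component_of_set X x \<otimes>\<^bsub>path_component_group X G\<^esub> path_component_of_set X y =
    path_component_of_set X (x \<otimes>\<^bsub>G\<^esub> y)"
proof -
  have "(\<exists>x'. path_component_of X x x' \<and> (\<exists>y'. path_component_of X y y' \<and> path_component_of X (x' \<otimes>\<^bsub>G\<^esub> y') z))
      \<longleftrightarrow> path_component_of X (x \<otimes>\<^bsub>G\<^esub> y) z" for z
    using path_component_of_mult[OF G] path_component_of_refl[of X x] path_component_of_refl[of X y] x y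
      path_component_of_trans by metis
  then show ?thesis by (simp add: path_component_group_def)
qed

lemma group_path_component_group:
  assumes G: "topological_group X G"
  shows "group (path_component_group X G)"
proof (rule groupI)
  interpret group G using G by (simp add: topological_group_def)
  have car: "carrier G = topspace X" using G by (simp add: topological_group_def)
  note mult = path_component_group_mult[OF G]
  show "\<one>\<^bsub>path_component_group X G\<^esub> \<in> carrier (path_component_group X G)"
    using one_closed car by (simp add: path_components_of_def)
  fix a assume "a \<in> carrier (path_component_group X G)"
  then obtain x where x: "x \<in> topspace X" "a = path_component_of_set X x"
    by (auto simp: path_components_of_def)
  show "\<one>\<^bsub>path_component_group X G\<^esub> \<otimes>\<^bsub>path_component_group X G\<^esub> a = a"
    using x one_closed car by (simp add: mult)
  have "inv\<^bsub>G\<^esub> x \<in> topspace X" using x(1) inv_closed car by simp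
  then show "\<exists>b\<in>carrier (path_component_group X G). b \<otimes>\<^bsub>path_component_group X G\<^esub> a = \<one>\<^bsub>path_component_group X G\<^esub>"
    using x car by (intro bexI[of _ "path_component_of_set X (inv\<^bsub>G\<^esub> x)"]) (auto simp: mult path_components_of_def)
  fix b assume "b \<in> carrier (path_component_group X G)"
  then obtain y where y: "y \<in> topspace X" "b = path_component_of_set X y"
    by (auto simp: path_components_of_def)
  show "a \<otimes>\<^bsub>path_component_group X G\<^esub> b \<in> carrier (path_component_group X G)"
    using x y car m_closed by (auto simp: mult path_components_of_def)
  fix c assume "c \<in> carrier (path_component_group X G)"
  then obtain z where z: "z \<in> topspace X" "c = path_component_of_set X z"
    by (auto simp: path_components_of_def)
  show "a \<otimes>\<^bsub>path_component_group X G\<^esub> b \<otimes>\<^bsub>path_component_group X G\<^esub> c =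
      a \<otimes>\<^bsub>path_component_group X G\<^esub> (b \<otimes>\<^bsub>path_component_group X G\<^esub> c)"
    using x y z car m_closed m_assoc by (simp add: mult)
qed

lemma path_components_incl_hom:
  assumes G: "topological_group X G" and G': "topological_group Y G'"
    and XY: "continuous_map X Y id" and id: "id \<in> hom G G'"
  shows "path_components_incl Y \<in> hom (path_component_group X G) (path_component_group Y G')"
proof (rule homI)
  have car: "carrier G = topspace X" and "group G" using G by (simp_all add: topological_group_def)
  have XsubY: "x \<in> topspace Y" if "x \<in> topspace X" for x
    using continuous_map_image_subset_topspace[OF XY] that by auto
  fix a assume "a \<in> carrier (path_component_group X G)"
  then obtain x where x: "x \<in> topspace X" "a = path_component_of_set X x"
    by (auto simp: path_components_of_def)
  then show "path_components_incl Y a \<in> carrier (path_component_group Y G')"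
    using path_components_incl_class[OF XY x(1)] XsubY by (simp add: path_components_of_def)
  fix b assume "b \<in> carrier (path_component_group X G)"
  then obtain y where y: "y \<in> topspace X" "b = path_component_of_set X y"
    by (auto simp: path_components_of_def)
  have "x \<otimes>\<^bsub>G\<^esub> y \<in> topspace X"
    using monoid.m_closed[OF group.is_monoid[OF \<open>group G\<close>], of x y] x y car by simp
  moreover have "x \<otimes>\<^bsub>G\<^esub> y = x \<otimes>\<^bsub>G'\<^esub> y"
    using hom_mult[OF id, of x y] x y car by simp
  ultimately show "path_components_incl Y (a \<otimes>\<^bsub>path_component_group X G\<^esub> b) =
      path_components_incl Y a \<otimes>\<^bsub>path_component_group Y G'\<^esub> path_components_incl Y b"
    using x y XsubY path_components_incl_class[OF XY]
    by (simp add: path_component_group_mult[OF G] path_component_group_mult[OF G'])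
qed

lemma dense_directed_family_stages_containing:
  assumes fam: "dense_directed_family M A leq Ms" and p: "p \<in> directed_union A Ms"
  shows "directed_set {\<alpha>\<in>A. p \<in> topspace (Ms \<alpha>)} leq"
  unfolding directed_set_def
proof (intro conjI ballI)
  have refl: "reflp_on A leq" and trans: "transp_on A leq"
    using fam by (simp_all add: dense_directed_family_def directed_set_def)
  show "{\<alpha>\<in>A. p \<in> topspace (Ms \<alpha>)} \<noteq> {}" using p by (auto simp: directed_union_def)
  show "reflp_on {\<alpha>\<in>A. p \<in> topspace (Ms \<alpha>)} leq" using refl by (rule reflp_on_subset) auto
  show "transp_on {\<alpha>\<in>A. p \<in> topspace (Ms \<alpha>)} leq" using trans by (rule transp_on_subset) auto
  fix \<alpha> \<beta> assume \<alpha>: "\<alpha> \<in> {\<alpha>\<in>A. p \<in> topspace (Ms \<alpha>)}" and \<beta>: "\<beta> \<in> {\<alpha>\<in>A. p \<in> topspace (Ms \<alpha>)}"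
  then obtain \<gamma> where "\<gamma> \<in> A" "leq \<alpha> \<gamma>" "leq \<beta> \<gamma>"
    using fam unfolding dense_directed_family_def directed_set_def by blast
  moreover from this have "p \<in> topspace (Ms \<gamma>)"
    using fam \<alpha> unfolding dense_directed_family_def by blast
  ultimately show "\<exists>\<gamma>\<in>{\<alpha>\<in>A. p \<in> topspace (Ms \<alpha>)}. leq \<alpha> \<gamma> \<and> leq \<beta> \<gamma>" by blast
qed

theorem theorem1p13:
  fixes M :: "'a topology"
    and A :: "'i set"
    and leq :: "'i \<Rightarrow> 'i \<Rightarrow> bool"
    and Ms :: "'i \<Rightarrow> 'a topology"
  assumes "dense_directed_family M A leq Ms"
    and "admits_well_filled_charts TYPE('e::real_vector) M A leq Ms"
  shows "\<forall>k. \<forall>p \<in> directed_union A Ms.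
    (let A\<^sub>p = {\<alpha>\<in>A. p \<in> topspace (Ms \<alpha>)} in
      (k \<ge> 1 \<longrightarrow>
        group_direct_limit TYPE('h) A\<^sub>p leq
          (\<lambda>\<alpha>. homotopy_group k (Ms \<alpha>) p) (\<lambda>\<alpha> \<beta>. homotopy_incl k (Ms \<beta>) p)
          (homotopy_group k M p) (\<lambda>\<alpha>. homotopy_incl k M p)) \<and>
      (k = 0 \<longrightarrow>
        set_direct_limit TYPE('h) A\<^sub>p leq
          (\<lambda>\<alpha>. path_components_of (Ms \<alpha>)) (\<lambda>\<alpha> \<beta>. path_components_incl (Ms \<beta>))
          (path_components_of M) (\<lambda>\<alpha>. path_components_incl M)) \<and>
      (k = 0 \<longrightarrow>
        (\<forall>G Gs.
          topological_group M G \<and> (\<forall>\<alpha>\<in>A. topological_group (Ms \<alpha>) (Gs \<alpha>)) \<and>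
          (\<forall>\<alpha>\<in>A. id \<in> hom (Gs \<alpha>) G) \<and>
          (\<forall>\<alpha>\<in>A. \<forall>\<beta>\<in>A. leq \<alpha> \<beta> \<longrightarrow> id \<in> hom (Gs \<alpha>) (Gs \<beta>)) \<and>
          p = \<one>\<^bsub>G\<^esub> \<longrightarrow>
          group_direct_limit TYPE('h) A\<^sub>p leq
            (\<lambda>\<alpha>. path_component_group (Ms \<alpha>) (Gs \<alpha>)) (\<lambda>\<alpha> \<beta>. path_components_incl (Ms \<beta>))
            (path_component_group M G) (\<lambda>\<alpha>. path_components_incl M))))"
proof (intro allI ballI)
  note fam = assms(1)
  have lcf: "locally_cone_fillable M A leq Ms"
    by (rule admits_well_filled_charts_locally_cone_fillable[OF assms])
  have "Hausdorff_space M" using fam by (simp add: dense_directed_family_def)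
  \<comment> \<open>With \<open>M\<close> as its only stage, \<open>M\<close> again admits
    well-filled charts. This instance is what produces homotopies in \<open>M\<close>.\<close>
  then have lcf0: "locally_cone_fillable M {()} (\<lambda>_ _. True) (\<lambda>_. M)"
    by (rule admits_well_filled_charts_locally_cone_fillable[OF dense_directed_family_trivial
          admits_well_filled_charts_trivial[OF assms(2)]])
  have MsM: "continuous_map (Ms \<alpha>) M id" "topspace (Ms \<alpha>) \<subseteq> topspace M" if "\<alpha> \<in> A" for \<alpha>
    using fam that by (simp_all add: dense_directed_family_def)
  have bond: "continuous_map (Ms \<alpha>) (Ms \<beta>) id" "topspace (Ms \<alpha>) \<subseteq> topspace (Ms \<beta>)"
    if "\<alpha> \<in> A" "\<beta> \<in> A" "leq \<alpha> \<beta>" for \<alpha> \<beta>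
    using fam that by (simp_all add: dense_directed_family_def)
  fix k p assume p: "p \<in> directed_union A Ms"
  define Ap where "Ap = {\<alpha>\<in>A. p \<in> topspace (Ms \<alpha>)}"
  have dir: "directed_set Ap leq"
    unfolding Ap_def by (rule dense_directed_family_stages_containing[OF fam p])
  have Ap: "\<alpha> \<in> A" "p \<in> topspace (Ms \<alpha>)" if "\<alpha> \<in> Ap" for \<alpha>
    using that by (simp_all add: Ap_def)
  \<comment> \<open>The approximation results return indices in \<open>A\<close>; lying above an
    index of \<open>Ap\<close>, these belong to \<open>Ap\<close> themselves.\<close>
  have Ap_up: "\<beta> \<in> Ap" if "\<alpha> \<in> Ap" "\<beta> \<in> A" "leq \<alpha> \<beta>" for \<alpha> \<beta>
    using that bond(2)[of \<alpha> \<beta>] by (auto simp: Ap_def)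
  \<comment> \<open>A loop or point of \<open>M\<close> comes without a stage;
    \<open>\<alpha>0\<close> supplies one that contains the base point, from which the approximation
    can start.\<close>
  obtain \<alpha>0 where \<alpha>0: "\<alpha>0 \<in> Ap" using dir by (auto simp: directed_set_def)
  have loops_bond: "f \<in> cube_loops k (Ms \<beta>) p"
    if "f \<in> cube_loops k (Ms \<alpha>) p" "\<alpha> \<in> A" "\<beta> \<in> A" "leq \<alpha> \<beta>" for f \<alpha> \<beta>
    using that dense_directed_family_mono[OF fam that(2-4)] by (auto simp: cube_loops_def)
  have pos: "group_direct_limit TYPE('h) Ap leq
          (\<lambda>\<alpha>. homotopy_group k (Ms \<alpha>) p) (\<lambda>\<alpha> \<beta>. homotopy_incl k (Ms \<beta>) p)
          (homotopy_group k M p) (\<lambda>\<alpha>. homotopy_incl k M p)" if "k \<ge> 1"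
  proof (rule group_direct_limitI)
    have k: "0 < k" using that by simp
    show "group_direct_system Ap leq (\<lambda>\<alpha>. homotopy_group k (Ms \<alpha>) p) (\<lambda>\<alpha> \<beta>. homotopy_incl k (Ms \<beta>) p)"
      unfolding group_direct_system_def set_direct_system_def
    proof (intro conjI ballI impI)
      show "directed_set Ap leq" by (rule dir)
      show "group (homotopy_group k (Ms \<alpha>) p)" if "\<alpha> \<in> Ap" for \<alpha>
        by (rule group_homotopy_group[OF k Ap(2)[OF that]])
      show hom: "homotopy_incl k (Ms \<beta>) p \<in> hom (homotopy_group k (Ms \<alpha>) p) (homotopy_group k (Ms \<beta>) p)"
        if "\<alpha> \<in> Ap" "\<beta> \<in> Ap" "leq \<alpha> \<beta>" for \<alpha> \<beta>
        by (rule homotopy_incl_hom[OF k bond(1)[OF Ap(1)[OF that(1)] Ap(1)[OF that(2)] that(3)]])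
      then show "homotopy_incl k (Ms \<beta>) p \<in> carrier (homotopy_group k (Ms \<alpha>) p) \<rightarrow> carrier (homotopy_group k (Ms \<beta>) p)"
        if "\<alpha> \<in> Ap" "\<beta> \<in> Ap" "leq \<alpha> \<beta>" for \<alpha> \<beta>
        using that by (simp add: hom_def)
      show "homotopy_incl k (Ms \<alpha>) p x = x" if "x \<in> carrier (homotopy_group k (Ms \<alpha>) p)" for \<alpha> x
        using that by (auto simp: homotopy_incl_class)
      show "homotopy_incl k (Ms \<gamma>) p (homotopy_incl k (Ms \<beta>) p x) = homotopy_incl k (Ms \<gamma>) p x"
        if "\<alpha> \<in> Ap" "\<beta> \<in> Ap" "\<gamma> \<in> Ap" "leq \<alpha> \<beta> \<and> leq \<beta> \<gamma>" "x \<in> carrier (homotopy_group k (Ms \<alpha>) p)" for \<alpha> \<beta> \<gamma> x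
      proof -
        have "leq \<alpha> \<gamma>" using dir that unfolding directed_set_def by (meson transp_onD)
        then show ?thesis
          using that Ap loops_bond by (auto simp: homotopy_incl_class[OF bond(1)])
      qed
    qed
    show "group (homotopy_group k M p)"
      by (rule group_homotopy_group[OF k subsetD[OF MsM(2)[OF Ap(1)[OF \<alpha>0]] Ap(2)[OF \<alpha>0]]])
    show "homotopy_incl k M p \<in> hom (homotopy_group k (Ms \<alpha>) p) (homotopy_group k M p)" if "\<alpha> \<in> Ap" for \<alpha>
      by (rule homotopy_incl_hom[OF k MsM(1)[OF Ap(1)[OF that]]])
    show "homotopy_incl k M p (homotopy_incl k (Ms \<beta>) p x) = homotopy_incl k M p x"
      if "\<alpha> \<in> Ap" "\<beta> \<in> Ap" "leq \<alpha> \<beta>" "x \<in> carrier (homotopy_group k (Ms \<alpha>) p)" for \<alpha> \<beta> x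
      using that Ap loops_bond by (auto simp: homotopy_incl_class[OF bond(1)] homotopy_incl_class[OF MsM(1)])
    show "\<exists>\<alpha>\<in>Ap. \<exists>x\<in>carrier (homotopy_group k (Ms \<alpha>) p). homotopy_incl k M p x = y"
      if y: "y \<in> carrier (homotopy_group k M p)" for y
    proof -
      obtain f where f: "f \<in> cube_loops k M p" "y = cube_class k M p f" using y by auto
      obtain \<beta> g where "\<beta> \<in> A" "leq \<alpha>0 \<beta>" and g: "g \<in> cube_loops k (Ms \<beta>) p" "cube_homotopic k M p f g"
        using cube_loop_homotopic_into_stage[OF fam lcf lcf0 Ap[OF \<alpha>0] f(1)] by blast
      then have \<beta>: "\<beta> \<in> Ap" using Ap_up \<alpha>0 by blast
      have "homotopy_incl k M p (cube_class k (Ms \<beta>) p g) = y"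
        using homotopy_incl_class[OF MsM(1)[OF Ap(1)[OF \<beta>]] g(1)] f g(2) cube_class_eq_iff[OF f(1), of g] by simp
      then show ?thesis using \<beta> g(1) by (intro bexI[of _ \<beta>] bexI[of _ "cube_class k (Ms \<beta>) p g"]) auto
    qed
    show "\<exists>\<beta>\<in>Ap. leq \<alpha> \<beta> \<and> homotopy_incl k (Ms \<beta>) p x = homotopy_incl k (Ms \<beta>) p y"
      if \<alpha>: "\<alpha> \<in> Ap" and xy: "x \<in> carrier (homotopy_group k (Ms \<alpha>) p)" "y \<in> carrier (homotopy_group k (Ms \<alpha>) p)"
        "homotopy_incl k M p x = homotopy_incl k M p y" for \<alpha> x y
    proof -
      obtain f g where f: "f \<in> cube_loops k (Ms \<alpha>) p" "x = cube_class k (Ms \<alpha>) p f"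
        and g: "g \<in> cube_loops k (Ms \<alpha>) p" "y = cube_class k (Ms \<alpha>) p g" using xy by auto
      have fM: "f \<in> cube_loops k M p"
        using f(1) continuous_map_compose[OF _ MsM(1)[OF Ap(1)[OF \<alpha>]], of "cube k" f] by (auto simp: cube_loops_def)
      have "cube_homotopic k M p f g"
        using xy(3) f g homotopy_incl_class[OF MsM(1)[OF Ap(1)[OF \<alpha>]]] cube_class_eq_iff[OF fM] by simp
      then obtain \<beta> where \<beta>: "\<beta> \<in> A" "leq \<alpha> \<beta>" "cube_homotopic k (Ms \<beta>) p f g"
        using cube_homotopic_in_stage[OF fam lcf Ap[OF \<alpha>] f(1) g(1)] by blast
      have "homotopy_incl k (Ms \<beta>) p x = homotopy_incl k (Ms \<beta>) p y"
        using f g \<beta>(3) homotopy_incl_class[OF bond(1)[OF Ap(1)[OF \<alpha>] \<beta>(1,2)]]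
          cube_class_eq_iff[OF cube_homotopic_imp_cube_loops(1)[OF \<beta>(3)], of g] by simp
      then show ?thesis using Ap_up[OF \<alpha> \<beta>(1,2)] \<beta>(2) by blast
    qed
  qed
  have sys0: "set_direct_system Ap leq (\<lambda>\<alpha>. path_components_of (Ms \<alpha>)) (\<lambda>\<alpha> \<beta>. path_components_incl (Ms \<beta>))"
    unfolding set_direct_system_def
  proof (intro conjI ballI impI)
    show "directed_set Ap leq" by (rule dir)
    show "path_components_incl (Ms \<beta>) \<in> path_components_of (Ms \<alpha>) \<rightarrow> path_components_of (Ms \<beta>)"
      if "\<alpha> \<in> Ap" "\<beta> \<in> Ap" "leq \<alpha> \<beta>" for \<alpha> \<beta>
      using path_components_incl_class[OF bond(1)] bond(2) that Ap by (fastforce simp: path_components_of_def)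
    show "path_components_incl (Ms \<alpha>) C = C" if "C \<in> path_components_of (Ms \<alpha>)" for \<alpha> C
      using that by (auto simp: path_components_of_def path_components_incl_class)
    show "path_components_incl (Ms \<gamma>) (path_components_incl (Ms \<beta>) C) = path_components_incl (Ms \<gamma>) C"
      if "\<alpha> \<in> Ap" "\<beta> \<in> Ap" "\<gamma> \<in> Ap" "leq \<alpha> \<beta> \<and> leq \<beta> \<gamma>" and C: "C \<in> path_components_of (Ms \<alpha>)" for \<alpha> \<beta> \<gamma> C
    proof -
      have "leq \<alpha> \<gamma>" using dir that unfolding directed_set_def by (meson transp_onD)
      moreover obtain x where "x \<in> topspace (Ms \<alpha>)" "C = path_component_of_set (Ms \<alpha>) x"
        using C by (auto simp: path_components_of_def)
      moreover from this have "x \<in> topspace (Ms \<beta>)" using bond(2) that Ap by blast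
      ultimately show ?thesis
        using that Ap by (simp add: path_components_incl_class[OF bond(1)])
    qed
  qed
  have l0: "path_components_incl M \<in> path_components_of (Ms \<alpha>) \<rightarrow> path_components_of M" if "\<alpha> \<in> Ap" for \<alpha>
    using path_components_incl_class[OF MsM(1)] MsM(2) that Ap by (fastforce simp: path_components_of_def)
  have compat0: "path_components_incl M (path_components_incl (Ms \<beta>) C) = path_components_incl M C"
    if "\<alpha> \<in> Ap" "\<beta> \<in> Ap" "leq \<alpha> \<beta>" and C: "C \<in> path_components_of (Ms \<alpha>)" for \<alpha> \<beta> C
  proof -
    obtain x where "x \<in> topspace (Ms \<alpha>)" "C = path_component_of_set (Ms \<alpha>) x"
      using C by (auto simp: path_components_of_def)
    moreover from this have "x \<in> topspace (Ms \<beta>)" using bond(2) that Ap by blast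
    ultimately show ?thesis
      using that Ap by (simp add: path_components_incl_class[OF bond(1)] path_components_incl_class[OF MsM(1)])
  qed
  have surj0: "\<exists>\<alpha>\<in>Ap. \<exists>C\<in>path_components_of (Ms \<alpha>). path_components_incl M C = D"
    if D: "D \<in> path_components_of M" for D
  proof -
    obtain y where y: "y \<in> topspace M" "D = path_component_of_set M y"
      using D by (auto simp: path_components_of_def)
    obtain \<beta> x where "\<beta> \<in> A" "leq \<alpha>0 \<beta>" and x: "x \<in> topspace (Ms \<beta>)" "path_component_of M x y"
      using path_component_of_stage_point[OF fam lcf lcf0 Ap[OF \<alpha>0] y(1)] by blast
    then have \<beta>: "\<beta> \<in> Ap" using Ap_up \<alpha>0 by blast
    have "path_component_of_set M x = D"
      using x(2) y(2) path_component_of_equiv by metis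
    then show ?thesis
      using \<beta> x(1) path_components_incl_class[OF MsM(1)[OF Ap(1)[OF \<beta>]] x(1)]
      by (intro bexI[of _ \<beta>] bexI[of _ "path_component_of_set (Ms \<beta>) x"]) (auto simp: path_components_of_def)
  qed
  have inj0: "\<exists>\<beta>\<in>Ap. leq \<alpha> \<beta> \<and> path_components_incl (Ms \<beta>) C = path_components_incl (Ms \<beta>) D"
    if \<alpha>: "\<alpha> \<in> Ap" and CD: "C \<in> path_components_of (Ms \<alpha>)" "D \<in> path_components_of (Ms \<alpha>)"
      "path_components_incl M C = path_components_incl M D" for \<alpha> C D
  proof -
    obtain x y where x: "x \<in> topspace (Ms \<alpha>)" "C = path_component_of_set (Ms \<alpha>) x"
      and y: "y \<in> topspace (Ms \<alpha>)" "D = path_component_of_set (Ms \<alpha>) y"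
      using CD by (auto simp: path_components_of_def)
    have "path_component_of_set M x = path_component_of_set M y"
      using CD(3) x y path_components_incl_class[OF MsM(1)[OF Ap(1)[OF \<alpha>]]] by simp
    moreover have "y \<in> topspace M" using y(1) MsM(2) Ap(1)[OF \<alpha>] by blast
    ultimately have "path_component_of M x y"
      by (metis mem_Collect_eq path_component_of_refl)
    then obtain \<beta> where \<beta>: "\<beta> \<in> A" "leq \<alpha> \<beta>" "path_component_of (Ms \<beta>) x y"
      using path_component_of_in_stage[OF fam lcf Ap(1)[OF \<alpha>] x(1) y(1)] by blast
    then have "path_component_of_set (Ms \<beta>) x = path_component_of_set (Ms \<beta>) y"
      using path_component_of_equiv by metis
    then have "path_components_incl (Ms \<beta>) C = path_components_incl (Ms \<beta>) D"
      using x y path_components_incl_class[OF bond(1)[OF Ap(1)[OF \<alpha>] \<beta>(1,2)]] by simp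
    then show ?thesis using Ap_up[OF \<alpha> \<beta>(1,2)] \<beta>(2) by blast
  qed
  have zero: "set_direct_limit TYPE('h) Ap leq
          (\<lambda>\<alpha>. path_components_of (Ms \<alpha>)) (\<lambda>\<alpha> \<beta>. path_components_incl (Ms \<beta>))
          (path_components_of M) (\<lambda>\<alpha>. path_components_incl M)"
    by (rule set_direct_limitI[OF sys0 l0 compat0 surj0 inj0])
  \<comment> \<open>The carriers are the sets of path components, so the facts already shown for
    sets carry over; what has to be added is that these are groups and that the maps are
    homomorphisms.\<close>
  have zero_group: "group_direct_limit TYPE('h) Ap leq
            (\<lambda>\<alpha>. path_component_group (Ms \<alpha>) (Gs \<alpha>)) (\<lambda>\<alpha> \<beta>. path_components_incl (Ms \<beta>))
            (path_component_group M G) (\<lambda>\<alpha>. path_components_incl M)"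
    if G: "topological_group M G" and Gs: "\<And>\<alpha>. \<alpha> \<in> A \<Longrightarrow> topological_group (Ms \<alpha>) (Gs \<alpha>)"
      and id: "\<And>\<alpha>. \<alpha> \<in> A \<Longrightarrow> id \<in> hom (Gs \<alpha>) G"
        "\<And>\<alpha> \<beta>. \<lbrakk>\<alpha> \<in> A; \<beta> \<in> A; leq \<alpha> \<beta>\<rbrakk> \<Longrightarrow> id \<in> hom (Gs \<alpha>) (Gs \<beta>)" for G Gs
  proof (rule group_direct_limitI)
    show "group_direct_system Ap leq (\<lambda>\<alpha>. path_component_group (Ms \<alpha>) (Gs \<alpha>)) (\<lambda>\<alpha> \<beta>. path_components_incl (Ms \<beta>))"
      unfolding group_direct_system_def
    proof (intro conjI ballI impI)
      show "set_direct_system Ap leq (\<lambda>\<alpha>. carrier (path_component_group (Ms \<alpha>) (Gs \<alpha>)))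
          (\<lambda>\<alpha> \<beta>. path_components_incl (Ms \<beta>))"
        using sys0 by simp
      show "group (path_component_group (Ms \<alpha>) (Gs \<alpha>))" if "\<alpha> \<in> Ap" for \<alpha>
        using group_path_component_group[OF Gs[OF Ap(1)[OF that]]] .
      show "path_components_incl (Ms \<beta>) \<in> hom (path_component_group (Ms \<alpha>) (Gs \<alpha>)) (path_component_group (Ms \<beta>) (Gs \<beta>))"
        if "\<alpha> \<in> Ap" "\<beta> \<in> Ap" "leq \<alpha> \<beta>" for \<alpha> \<beta>
        using Ap(1) that by (intro path_components_incl_hom Gs bond(1) id(2))
    qed
    show "group (path_component_group M G)" by (rule group_path_component_group[OF G])
    show "path_components_incl M \<in> hom (path_component_group (Ms \<alpha>) (Gs \<alpha>)) (path_component_group M G)"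
      if "\<alpha> \<in> Ap" for \<alpha>
      using Ap(1)[OF that] by (intro path_components_incl_hom Gs G MsM(1) id(1))
  qed (simp_all add: compat0 surj0 inj0)
  show "let A\<^sub>p = {\<alpha>\<in>A. p \<in> topspace (Ms \<alpha>)} in
      (k \<ge> 1 \<longrightarrow>
        group_direct_limit TYPE('h) A\<^sub>p leq
          (\<lambda>\<alpha>. homotopy_group k (Ms \<alpha>) p) (\<lambda>\<alpha> \<beta>. homotopy_incl k (Ms \<beta>) p)
          (homotopy_group k M p) (\<lambda>\<alpha>. homotopy_incl k M p)) \<and>
      (k = 0 \<longrightarrow>
        set_direct_limit TYPE('h) A\<^sub>p leq
          (\<lambda>\<alpha>. path_components_of (Ms \<alpha>)) (\<lambda>\<alpha> \<beta>. path_components_incl (Ms \<beta>))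
          (path_components_of M) (\<lambda>\<alpha>. path_components_incl M)) \<and>
      (k = 0 \<longrightarrow>
        (\<forall>G Gs.
          topological_group M G \<and> (\<forall>\<alpha>\<in>A. topological_group (Ms \<alpha>) (Gs \<alpha>)) \<and>
          (\<forall>\<alpha>\<in>A. id \<in> hom (Gs \<alpha>) G) \<and>
          (\<forall>\<alpha>\<in>A. \<forall>\<beta>\<in>A. leq \<alpha> \<beta> \<longrightarrow> id \<in> hom (Gs \<alpha>) (Gs \<beta>)) \<and>
          p = \<one>\<^bsub>G\<^esub> \<longrightarrow>
          group_direct_limit TYPE('h) A\<^sub>p leq
            (\<lambda>\<alpha>. path_component_group (Ms \<alpha>) (Gs \<alpha>)) (\<lambda>\<alpha> \<beta>. path_components_incl (Ms \<beta>))
            (path_component_group M G) (\<lambda>\<alpha>. path_components_incl M)))"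
    unfolding Let_def Ap_def[symmetric] using pos zero zero_group by simp
qed

end
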